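(* Let $(\mathbf X,Y)$ be a random pair in $\mathbb R^d\times\mathbb R$ with distribution $\mathbb Q$, such that $Y=g^*(\mathbf X)+Z$ with $g^*:\mathbb R^d\to\mathbb R$ measurable, $\mathbb E[Z]=0$, $\mathbb V(Z)=\sigma^2<\infty$, $Z$ independent of $\mathbf X$, and $\mathbb Q(\mathcal S)=1$ where $\mathcal S=\mathbb R^d\times[-L,L]$ for some $L>0$. Let $\mathbf D_n=((\mathbf X_1,Y_1),\dots,(\mathbf X_n,Y_n))$ be an i.i.d. sample from $\mathbb Q$. Let $\alpha\in[0,\tfrac12)$ and let $(\mathcal C_n)_{n\ge1}$, $\mathcal C_n=\mathcal C_n(\mathbf D_n)$, be an $\alpha$-suitable sequence of data-dependent finite collections of sets of $\mathbb R^d$ (defined in the context), with $\mathbf c_n=\bigcup_{\mathbf r\in\mathcal C_n}\mathbf r$, such that: 1. $\mathbb Q(\mathbf c_n^c)=O_{\mathbb P}(n^{\alpha-1/2})$; 2. for each $n$ there is a family $\Pi_n$ of finite collections of disjoint sets of $\mathbb R^d$ which is a refinement of the family $\{\mathcal P(\mathcal C_n(\mathbf d_n)):\mathbf d_n\in\mathcal S^n\}$, such that $\widetilde{\mathcal M}(\Pi_n)=o(n)$ and $\log(\widetilde\Delta_n(\Pi_n))=o(n)$; 3. there is a $\mathbb Q$-Donsker class $\mathcal B$ of sets such that for all $n\ge1$ and all $\mathbf d_n\in\mathcal S^n$, $\{\mathbf r\times\mathbb R:\mathbf r\in\mathcal C_n(\mathbf d_n)\}\subseteq\mathcal B$. Assume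 moreover that the estimator $(\sigma_n^2)$ of $\sigma^2$ involved in the definition of $\alpha$-suitability is such that $|\sigma_n^2-\sigma^2|=O_{\mathbb P}(n^{\alpha-1/2})$. Then the estimator $$g_n=\sum_{A\in\mathcal P(\mathcal C_n),\ \mathbb Q_n(A)>0}\mathbb E_n[Y\mid\mathbf X\in A]\,\mathbf 1_A$$ is weakly consistent: $$\ell(g^*,g_n)=\mathcal L(g_n)-\mathcal L(g^* )=o_{\mathbb P}(1).$$
   Context: **Risk.** $\mathcal L(g)=\int (g(\mathbf x)-y)^2\,d\mathbb Q(\mathbf x,y)$ (for the random function $g_n$, the integral is taken with the sample $\mathbf D_n$ fixed), so $\ell(g^*,g_n)=\int(g_n(\mathbf x)-g^*(\mathbf x))^2\,d\mathbb Q(\mathbf x,y)$. $\mathbb P$ is the underlying probability measure on which the sample is defined. **Empirical quantities.** For $\mathbf r\subseteq\mathbb R^d$: $\mathbb Q_n(\mathbf r)=\frac1n\sum_{i=1}^n\mathbf 1_{\mathbf X_i\in\mathbf r}$ and $\mathbb Q(\mathbf r)=\mathbb Q(\mathbf r\times\mathbb R)$. If $\mathbb Q_n(\mathbf r)>0$, $\mathbb E_n[h(Y)\mid\mathbf X\in\mathbf r]=\frac{\sum_{i=1}^n h(Y_i)\mathbf 1_{\mathbf X_i\in\mathbf r}}{\sum_{i=1}^n\mathbf 1_{\mathbf X_i\in\mathbf r}}$ and $\mathbb V_n(Y\mid\mathbf X\in\mathbf r)=\mathbb E_n[Y^2\mid\mathbf X\in\mathbf r]-\mathbb E_n[Y\mid\mathbf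 X\in\mathbf r]^2$. $\mathbb E_n[Y]=\frac1n\sum_{i=1}^nY_i$. $x_+=\max\{x,0\}$, $a\wedge b=\min\{a,b\}$, and $\mathbf c^c$ is the complement in $\mathbb R^d$. **Generated partition and redundancy.** Let $\mathcal C$ be a finite collection of sets of $\mathbb R^d$ and $\mathbf c=\bigcup_{\mathbf r\in\mathcal C}\mathbf r$. The activation function is $\varphi_{\mathcal C}(\mathbf x)=\{\mathbf r\in\mathcal C:\mathbf x\in\mathbf r\}$. $\mathcal P(\mathcal C)$ is the partition of $\mathbf c$ into the (nonempty) fibers of $\varphi_{\mathcal C}$ restricted to $\mathbf c$, i.e. two points of $\mathbf c$ are in the same cell iff they belong to exactly the same elements of $\mathcal C$. The maximal and minimal redundancies are $M(\mathcal C)=\max_{\mathbf x\in\mathbf c}\#\varphi_{\mathcal C}(\mathbf x)$ and $m(\mathcal C)=\min_{\mathbf x\in\mathbf c}\#\varphi_{\mathcal C}(\mathbf x)$. **$\alpha$-suitable sequence.** Let $\alpha\in[0,1/2)$. A sequence $(\mathcal C_n)_{n\ge1}$ of data-dependent finite collections of sets of $\mathbb R^d$ is $\alpha$-suitable if: (i) (set coverage) $\mathbb Q_n(\mathbf r)>n^{-\alpha}$ for all $\mathbf r\in\mathcal C_n$, $n\ge1$. (ii) (collection coverage) $\mathbb Q_n(\mathbf c_n^c)=o_{\mathbb P}(1)$, where $\mathbf c_n=\bigcup_{\mathbf r\in\mathcal C_n}\mathbf r$. (iii) (significance) for some consistent estimator $(\sigma_n^2)$ of $\sigma^2$ and (possibly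 random) sequences $\beta_n=o_{\mathbb P}(1)$ and $\varepsilon_n=o_{\mathbb P}(1)$, for all $n\ge1$, $\mathcal C_n=\mathcal C_n^s\cup\mathcal C_n^i$, where $$\mathcal C_n^s=\Big\{\mathbf r\in\mathcal C_n:\beta_n\big|\mathbb E_n[Y\mid\mathbf X\in\mathbf r]-\mathbb E_n[Y]\big|\ge\sqrt{(\mathbb V_n(Y\mid\mathbf X\in\mathbf r)-\sigma_n^2)_+}\Big\},$$ $$\mathcal C_n^i=\Big\{\mathbf r\in\mathcal C_n\setminus\mathcal C_n^s:\varepsilon_n\ge\sqrt{(\mathbb V_n(Y\mid\mathbf X\in\mathbf r)-\sigma_n^2)_+}\Big\}.$$ (iv) (redundancy) $\dfrac{M(\mathcal C_n^s)}{m(\mathcal C_n^s)}=o_{\mathbb P}(\beta_n^{-2}\wedge n^{1/2-\alpha})$ and $\dfrac{M(\mathcal C_n^i)}{m(\mathcal C_n^i)}=o_{\mathbb P}(\varepsilon_n^{-2}\wedge n^{1/2-\alpha})$. (Conventions: $0^{-2}=+\infty$; a ratio corresponding to an empty collection is taken to be $0$. $U_n=o_{\mathbb P}(V_n)$ means $U_n/V_n\to0$ in probability.) **Refinement.** For two families $\mathcal F,\mathcal F'$ of finite collections of disjoint sets, $\mathcal F'$ is a refinement of $\mathcal F$ if for every $F\in\mathcal F$ there is $F'\in\mathcal F'$ such that every $A\in F$ satisfies $A=\bigcup_{A'\in F':A'\subseteq A}A'$. **Complexity of a family.** Let $\Pi$ be a family of finite collections of disjoint sets of $\mathbb R^d$.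 $\widetilde{\mathcal M}(\Pi)=\sup\{\#\mathcal P:\mathcal P\in\Pi\}$. For $\mathbf x_1^n=\{\mathbf x_1,\dots,\mathbf x_n\}$, $\widetilde\Delta(\mathbf x_1^n,\Pi)=\#\big\{\{\mathbf x_1^n\cap A:A\in\mathcal P\}\setminus\{\emptyset\}:\mathcal P\in\Pi\big\}$, and $\widetilde\Delta_n(\Pi)=\max_{\mathbf x_1^n\in(\mathbb R^d)^n}\widetilde\Delta(\mathbf x_1^n,\Pi)$. **Donsker classes.** A class $\mathcal F$ of functions in $L^1(\mathbb Q)$ on $\mathcal S$ is $\mathbb Q$-Donsker if the empirical process $\{\sqrt n(\int f\,d\mathbb Q_n-\int f\,d\mathbb Q):f\in\mathcal F\}$ (with $\mathbb Q_n$ the empirical measure of $\mathbf D_n$) converges in distribution in $\ell^\infty(\mathcal F)$ to a tight limit process (in the Hoffmann-Jørgensen sense with outer probabilities). A class $\mathcal B$ of Borel sets of $\mathcal S$ is $\mathbb Q$-Donsker if $\{\mathbf 1_A:A\in\mathcal B\}$ is a $\mathbb Q$-Donsker class of functions. A set $\mathbf r\times\mathbb R$ is identified with its trace on $\mathcal S$.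
   Formalization: "Data-dependent collection" is taken to include joint measurability, in the sample and two points, of the relation that the points lie in the same cell of P(C_n); without some measurability the loss ℓ(g*,g_n) need not be a random variable, so o_P(1) is undefined. *)

theory Defs
  imports "HOL-Probability.Probability" "HOL-Library.Landau_Symbols"
begin

section \<open>Stochastic orders of magnitude\<close>

text \<open>
  Several sequences below (redundancy ratios, suprema) are not assumed to be measurable, so the
  stochastic orders use the outer probability, which is the probability on measurable events.
\<close>

definition little_oP :: "'w measure \<Rightarrow> (nat \<Rightarrow> 'w \<Rightarrow> real) \<Rightarrow> (nat \<Rightarrow> 'w \<Rightarrow> real) \<Rightarrow> bool" where
  "little_oP M U V \<longleftrightarrow>
     (\<forall>e>0. (\<lambda>n. outer_measure_of M {\<omega> \<in> space M. \<bar>U n \<omega> / V n \<omega>\<bar> > e}) \<longlonglongrightarrow> 0)"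

definition big_OP :: "'w measure \<Rightarrow> (nat \<Rightarrow> 'w \<Rightarrow> real) \<Rightarrow> (nat \<Rightarrow> real) \<Rightarrow> bool" where
  "big_OP M U a \<longleftrightarrow>
     (\<forall>e>0. \<exists>K. \<forall>\<^sub>F n in sequentially.
        outer_measure_of M {\<omega> \<in> space M. \<bar>U n \<omega>\<bar> > K * a n} < ennreal e)"

section \<open>Weak convergence in the sense of Hoffmann-Joergensen and Donsker classes\<close>

definition outer_expectation :: "'w measure \<Rightarrow> ('w \<Rightarrow> real) \<Rightarrow> real" where
  "outer_expectation M T =
     Inf {integral\<^sup>L M U | U. integrable M U \<and> (\<forall>\<omega>\<in>space M. T \<omega> \<le> U \<omega>)}"

definition ell_infty :: "'i set \<Rightarrow> ('i \<Rightarrow> real) set" where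
  "ell_infty I = {z \<in> extensional I. bounded (z ` I)}"

text \<open>
  The \<open>insert 0\<close> only matters for empty \<open>I\<close>; off \<open>ell_infty I\<close> the value is irrelevant and is
  set to \<open>0\<close> because the locale \<open>Metric_space\<close> asks for a nonnegative function everywhere.
\<close>

definition sup_dist :: "'i set \<Rightarrow> ('i \<Rightarrow> real) \<Rightarrow> ('i \<Rightarrow> real) \<Rightarrow> real" where
  "sup_dist I z z' =
     (if z \<in> ell_infty I \<and> z' \<in> ell_infty I
      then Sup (insert 0 ((\<lambda>i. \<bar>z i - z' i\<bar>) ` I)) else 0)"

lemma Metric_space_ell_infty: "Metric_space (ell_infty I) (sup_dist I)"
proof
  have bdd: "bdd_above (insert 0 ((\<lambda>i. \<bar>x i - y i\<bar>) ` I))"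
    if xy: "x \<in> ell_infty I" "y \<in> ell_infty I" for x y :: "'a \<Rightarrow> real"
  proof -
    obtain a b where a: "\<And>i. i \<in> I \<Longrightarrow> \<bar>x i\<bar> \<le> a" and b: "\<And>i. i \<in> I \<Longrightarrow> \<bar>y i\<bar> \<le> b"
      using xy by (auto simp: ell_infty_def bounded_iff)
    have "\<bar>x i - y i\<bar> \<le> a + b" if "i \<in> I" for i
      using a[OF that] b[OF that] by linarith
    then show ?thesis
      by (auto intro!: bdd_aboveI[of _ "a + b"])
  qed
  show nonneg: "0 \<le> sup_dist I x y" for x y :: "'a \<Rightarrow> real"
    unfolding sup_dist_def using bdd[of x y] by (auto intro!: cSup_upper)
  have le: "\<bar>x i - y i\<bar> \<le> sup_dist I x y"
    if "x \<in> ell_infty I" "y \<in> ell_infty I" "i \<in> I" for x y :: "'a \<Rightarrow> real" and i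
    using cSup_upper[OF _ bdd[OF that(1,2)], of "\<bar>x i - y i\<bar>"] that by (simp add: sup_dist_def)
  show "sup_dist I x y = sup_dist I y x" for x y :: "'a \<Rightarrow> real"
    by (simp add: sup_dist_def abs_minus_commute conj_commute)
  show "sup_dist I x y = 0 \<longleftrightarrow> x = y" if "x \<in> ell_infty I" "y \<in> ell_infty I" for x y
  proof
    assume "sup_dist I x y = 0"
    then show "x = y"
      using le[OF that] that by (intro extensionalityI[of _ I]) (auto simp: ell_infty_def)
  next
    assume "x = y"
    moreover have "insert 0 ((\<lambda>i. \<bar>y i - y i\<bar>) ` I) = {0}" by auto
    ultimately show "sup_dist I x y = 0"
      by (simp only: sup_dist_def cSup_singleton if_cancel)
  qed
  show "sup_dist I x z \<le> sup_dist I x y + sup_dist I y z"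
    if xyz: "x \<in> ell_infty I" "y \<in> ell_infty I" "z \<in> ell_infty I" for x y z
  proof -
    have "\<bar>x i - z i\<bar> \<le> sup_dist I x y + sup_dist I y z" if i: "i \<in> I" for i
      using le[OF xyz(1,2) i] le[OF xyz(2,3) i] by linarith
    then have "Sup (insert 0 ((\<lambda>i. \<bar>x i - z i\<bar>) ` I)) \<le> sup_dist I x y + sup_dist I y z"
      using nonneg[of x y] nonneg[of y z] by (intro cSup_least) auto
    then show ?thesis
      using xyz by (simp add: sup_dist_def[of I x z])
  qed
qed

text \<open>
  The maps \<open>Z n\<close> need not be measurable; the limit law \<open>\<mu>\<close> is a Borel probability measure on the
  topological space \<open>T\<close>.
\<close>

definition tight_borel_prob :: "'z topology \<Rightarrow> 'z measure \<Rightarrow> bool" where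
  "tight_borel_prob T \<mu> \<longleftrightarrow>
     prob_space \<mu> \<and> space \<mu> = topspace T \<and>
     sets \<mu> = sigma_sets (topspace T) {U. openin T U} \<and>
     (\<forall>e>0. \<exists>K\<in>sets \<mu>. compactin T K \<and> measure \<mu> K > 1 - e)"

definition HJ_converges ::
  "'w measure \<Rightarrow> 'z topology \<Rightarrow> (nat \<Rightarrow> 'w \<Rightarrow> 'z) \<Rightarrow> 'z measure \<Rightarrow> bool" where
  "HJ_converges M T Z \<mu> \<longleftrightarrow>
     (\<forall>n. Z n \<in> space M \<rightarrow> topspace T) \<and>
     (\<forall>h. continuous_map T euclideanreal h \<and> bounded (h ` topspace T) \<longrightarrow>
        (\<lambda>n. outer_expectation M (\<lambda>\<omega>. h (Z n \<omega>))) \<longlonglongrightarrow> integral\<^sup>L \<mu> h)"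

text \<open>
  Being Donsker is a property of the law \<open>Q\<close> alone: as usual in the Hoffmann-Joergensen theory, the
  observations are the coordinate projections on the infinite product of \<open>Q\<close> (outer expectations
  may depend on the space carrying the sample).
\<close>

definition empirical_process ::
  "'s measure \<Rightarrow> ('s \<Rightarrow> real) set \<Rightarrow> nat \<Rightarrow> (nat \<Rightarrow> 's) \<Rightarrow> ('s \<Rightarrow> real) \<Rightarrow> real" where
  "empirical_process Q \<F> n z =
     (\<lambda>f\<in>\<F>. sqrt (real n) * ((\<Sum>i=1..n. f (z i)) / real n - integral\<^sup>L Q f))"

definition donsker_class :: "'s measure \<Rightarrow> ('s \<Rightarrow> real) set \<Rightarrow> bool" where
  "donsker_class Q \<F> \<longleftrightarrow>
     (\<forall>f\<in>\<F>. integrable Q f) \<and>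
     (\<exists>\<mu>. tight_borel_prob (Metric_space.mtopology (ell_infty \<F>) (sup_dist \<F>)) \<mu> \<and>
        HJ_converges (Pi\<^sub>M UNIV (\<lambda>_. Q)) (Metric_space.mtopology (ell_infty \<F>) (sup_dist \<F>))
          (empirical_process Q \<F>) \<mu>)"

definition donsker_sets :: "'s measure \<Rightarrow> 's set set \<Rightarrow> bool" where
  "donsker_sets Q \<B> \<longleftrightarrow> \<B> \<subseteq> sets Q \<and> donsker_class Q (indicator ` \<B>)"

section \<open>Empirical quantities\<close>

text \<open>A sample of size \<open>n\<close> is a function on \<open>{1..n}\<close>.\<close>

type_synonym 'd data = "nat \<Rightarrow> (real ^ 'd) \<times> real"

definition data_space :: "nat \<Rightarrow> ((real ^ 'd) \<times> real) set \<Rightarrow> 'd data set" where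
  "data_space n S = ({1..n} \<rightarrow>\<^sub>E S)"

definition emp_prob :: "nat \<Rightarrow> 'd data \<Rightarrow> (real ^ 'd) set \<Rightarrow> real" where
  "emp_prob n d r = (\<Sum>i=1..n. indicator r (fst (d i))) / real n"

definition emp_mean :: "nat \<Rightarrow> 'd data \<Rightarrow> real" where
  "emp_mean n d = (\<Sum>i=1..n. snd (d i)) / real n"

definition emp_cond_exp :: "nat \<Rightarrow> 'd data \<Rightarrow> (real \<Rightarrow> real) \<Rightarrow> (real ^ 'd) set \<Rightarrow> real" where
  "emp_cond_exp n d h r =
     (\<Sum>i=1..n. h (snd (d i)) * indicator r (fst (d i))) / (\<Sum>i=1..n. indicator r (fst (d i)))"

definition emp_cond_var :: "nat \<Rightarrow> 'd data \<Rightarrow> (real ^ 'd) set \<Rightarrow> real" where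
  "emp_cond_var n d r = emp_cond_exp n d (\<lambda>y. y\<^sup>2) r - (emp_cond_exp n d (\<lambda>y. y) r)\<^sup>2"

definition x_marginal :: "((real ^ 'd) \<times> real) measure \<Rightarrow> (real ^ 'd) set \<Rightarrow> real" where
  "x_marginal Q r = measure Q (r \<times> UNIV)"

section \<open>Generated partition and redundancy\<close>

definition activation :: "'x set set \<Rightarrow> 'x \<Rightarrow> 'x set set" where
  "activation \<C> x = {r \<in> \<C>. x \<in> r}"

definition gen_partition :: "'x set set \<Rightarrow> 'x set set" where
  "gen_partition \<C> = (\<lambda>x. {x' \<in> \<Union>\<C>. activation \<C> x' = activation \<C> x}) ` \<Union>\<C>"

definition max_redundancy :: "'x set set \<Rightarrow> nat" where
  "max_redundancy \<C> = Max ((\<lambda>x. card (activation \<C> x)) ` \<Union>\<C>)"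

definition min_redundancy :: "'x set set \<Rightarrow> nat" where
  "min_redundancy \<C> = Min ((\<lambda>x. card (activation \<C> x)) ` \<Union>\<C>)"

definition redundancy_ratio :: "'x set set \<Rightarrow> real" where
  "redundancy_ratio \<C> =
     (if \<C> = {} then 0 else real (max_redundancy \<C>) / real (min_redundancy \<C>))"

section \<open>Data-dependent collections and suitability\<close>

text \<open>
  The second condition is the measurability implicit in calling the collection (and the regression
  function built on it) data-dependent: the event that two points lie in the same cell of the
  generated partition is jointly measurable in the sample and the two points.
\<close>

definition data_dependent_collection ::
  "((real ^ 'd) \<times> real) set \<Rightarrow> nat \<Rightarrow> ('d::finite data \<Rightarrow> (real ^ 'd) set set) \<Rightarrow> bool" where
  "data_dependent_collection S n \<C> \<longleftrightarrow>
     (\<forall>d\<in>data_space n S. finite (\<C> d)) \<and>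
     {(d, x, x'). d \<in> data_space n S \<and> (\<exists>A\<in>gen_partition (\<C> d). x \<in> A \<and> x' \<in> A)}
       \<in> sets (Pi\<^sub>M {1..n} (\<lambda>_. restrict_space borel S) \<Otimes>\<^sub>M (borel \<Otimes>\<^sub>M borel))"

definition significant_sets ::
  "nat \<Rightarrow> 'd data \<Rightarrow> real \<Rightarrow> real \<Rightarrow> (real ^ 'd) set set \<Rightarrow> (real ^ 'd) set set" where
  "significant_sets n d s2 b \<C> =
     {r \<in> \<C>. b * \<bar>emp_cond_exp n d (\<lambda>y. y) r - emp_mean n d\<bar>
               \<ge> sqrt (max (emp_cond_var n d r - s2) 0)}"

definition insignificant_sets ::
  "nat \<Rightarrow> 'd data \<Rightarrow> real \<Rightarrow> real \<Rightarrow> real \<Rightarrow> (real ^ 'd) set set \<Rightarrow> (real ^ 'd) set set" where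
  "insignificant_sets n d s2 b e \<C> =
     {r \<in> \<C> - significant_sets n d s2 b \<C>. e \<ge> sqrt (max (emp_cond_var n d r - s2) 0)}"

text \<open>\<open>b\<^sup>-\<^sup>2 \<and> n\<^bsup>1/2 - \<alpha>\<^esup>\<close> with the convention \<open>0\<^sup>-\<^sup>2 = \<infinity>\<close>.\<close>

definition redundancy_bound :: "real \<Rightarrow> nat \<Rightarrow> real \<Rightarrow> real" where
  "redundancy_bound \<alpha> n b =
     (if b = 0 then real n powr (1/2 - \<alpha>) else min (1 / b\<^sup>2) (real n powr (1/2 - \<alpha>)))"

text \<open>
  \<open>D n \<omega>\<close> is the sample of size \<open>n\<close> and \<open>s2 n\<close> is the estimator of \<open>sigma2\<close>, a function of the sample,
  for which the significance condition holds; it is a parameter because rates are imposed on it.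
  Conditions on the random collection are required almost surely.
\<close>

definition alpha_suitable ::
  "'w measure \<Rightarrow> ((real ^ 'd) \<times> real) set \<Rightarrow> (nat \<Rightarrow> 'w \<Rightarrow> 'd::finite data) \<Rightarrow> real \<Rightarrow> real \<Rightarrow>
   (nat \<Rightarrow> 'd data \<Rightarrow> real) \<Rightarrow> (nat \<Rightarrow> 'd data \<Rightarrow> (real ^ 'd) set set) \<Rightarrow> bool" where
  "alpha_suitable M S D sigma2 \<alpha> s2 \<C> \<longleftrightarrow>
     (\<forall>n\<ge>1. data_dependent_collection S n (\<C> n)) \<and>
     (AE \<omega> in M. \<forall>n\<ge>1. \<forall>r\<in>\<C> n (D n \<omega>). emp_prob n (D n \<omega>) r > real n powr (-\<alpha>)) \<and>
     little_oP M (\<lambda>n \<omega>. emp_prob n (D n \<omega>) (- \<Union>(\<C> n (D n \<omega>)))) (\<lambda>_ _. 1) \<and>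
     little_oP M (\<lambda>n \<omega>. s2 n (D n \<omega>) - sigma2) (\<lambda>_ _. 1) \<and>
     (\<exists>\<beta> \<epsilon> :: nat \<Rightarrow> 'w \<Rightarrow> real.
        little_oP M \<beta> (\<lambda>_ _. 1) \<and> little_oP M \<epsilon> (\<lambda>_ _. 1) \<and>
        (AE \<omega> in M. \<forall>n\<ge>1. \<C> n (D n \<omega>) =
            significant_sets n (D n \<omega>) (s2 n (D n \<omega>)) (\<beta> n \<omega>) (\<C> n (D n \<omega>)) \<union>
            insignificant_sets n (D n \<omega>) (s2 n (D n \<omega>)) (\<beta> n \<omega>) (\<epsilon> n \<omega>) (\<C> n (D n \<omega>))) \<and>
        little_oP M
          (\<lambda>n \<omega>. redundancy_ratio
             (significant_sets n (D n \<omega>) (s2 n (D n \<omega>)) (\<beta> n \<omega>) (\<C> n (D n \<omega>))))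
          (\<lambda>n \<omega>. redundancy_bound \<alpha> n (\<beta> n \<omega>)) \<and>
        little_oP M
          (\<lambda>n \<omega>. redundancy_ratio
             (insignificant_sets n (D n \<omega>) (s2 n (D n \<omega>)) (\<beta> n \<omega>) (\<epsilon> n \<omega>) (\<C> n (D n \<omega>))))
          (\<lambda>n \<omega>. redundancy_bound \<alpha> n (\<epsilon> n \<omega>)))"

section \<open>Families of partitions and their complexity\<close>

definition refinement :: "'x set set set \<Rightarrow> 'x set set set \<Rightarrow> bool" where
  "refinement F' F \<longleftrightarrow> (\<forall>P\<in>F. \<exists>P'\<in>F'. \<forall>A\<in>P. A = \<Union>{A' \<in> P'. A' \<subseteq> A})"

definition max_cells :: "'x set set set \<Rightarrow> enat" where
  "max_cells \<F> = (SUP P\<in>\<F>. enat (card P))"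

definition trace_count :: "'x set \<Rightarrow> 'x set set set \<Rightarrow> nat" where
  "trace_count xs \<F> = card ((\<lambda>P. (\<lambda>A. xs \<inter> A) ` P - {{}}) ` \<F>)"

definition growth_number :: "nat \<Rightarrow> 'x set set set \<Rightarrow> nat" where
  "growth_number n \<F> = Max {trace_count (x ` {1..n}) \<F> | x :: nat \<Rightarrow> 'x. True}"

section \<open>Risk and the partitioning estimator\<close>

definition risk :: "((real ^ 'd) \<times> real) measure \<Rightarrow> (real ^ 'd \<Rightarrow> real) \<Rightarrow> real" where
  "risk Q g = (\<integral>z. (g (fst z) - snd z)\<^sup>2 \<partial>Q)"

definition excess_risk ::
  "((real ^ 'd) \<times> real) measure \<Rightarrow> (real ^ 'd \<Rightarrow> real) \<Rightarrow> (real ^ 'd \<Rightarrow> real) \<Rightarrow> real" where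
  "excess_risk Q gstar g = risk Q g - risk Q gstar"

definition partition_estimator ::
  "nat \<Rightarrow> 'd data \<Rightarrow> (real ^ 'd) set set \<Rightarrow> real ^ 'd \<Rightarrow> real" where
  "partition_estimator n d \<C> x =
     (\<Sum>A\<in>{A \<in> gen_partition \<C>. emp_prob n d A > 0}.
        emp_cond_exp n d (\<lambda>y. y) A * indicator A x)"

end

theory Submission
  imports Defs "HOL-Probability.Hoeffding"
begin

text \<open>
  Write \<open>Y = g(X) + Z\<close> and let \<open>E r\<close> be the empirical mean of \<open>Y\<close> on \<open>r\<close>. On a set \<open>r\<close> of the covering,
  the empirical variance of \<open>Y\<close> splits into the mean square of \<open>E r - g\<close>, the variance of \<open>Z\<close> and
  averages of the centred variables \<open>Z\<close>, \<open>g(X) Z\<close> and \<open>Z\<^sup>2 - \<sigma>\<^sup>2\<close>. By the Donsker property the latter are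
  of order \<open>n\<^bsup>-1/2\<^esup>\<close> uniformly in \<open>r\<close>, so on a significant or insignificant set the mean square of
  \<open>E r - g\<close> is bounded by \<open>\<beta>\<^sup>2\<close> or \<open>\<epsilon>\<^sup>2\<close> up to \<open>n\<^bsup>\<alpha> - 1/2\<^esup>\<close>. Since the cell means are least squares fits,
  comparing each cell with all sets of the covering that contain it transfers the bound to the
  partition at the cost of the redundancy ratio. Passing from the sample to \<open>Q\<close> only needs that
  the sums over the cells of the deviations of \<open>1\<close>, \<open>g\<close>, \<open>g\<^sup>2\<close> and \<open>Z\<close> tend to \<open>0\<close>, which
  follows from the complexity of the partitions.

  No measurability of suprema is available. For the partitions this is circumvented by selecting the
  worst signs of the cells measurably from the sample before introducing a ghost sample. For the
  Donsker class, weights are introduced by a randomised resampling that preserves the law of the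
  sample; this turns a measurable event on which all sets have small deviation into another one
  on which all weighted sets have small deviation.
\<close>

section \<open>Concentration inequalities\<close>

text \<open>The exponents in the redundancy condition come from one division: a covering set holds
  more than n^(1 - \<alpha>) sample points, so deviations of order n^(1/2) become n^(\<alpha> - 1/2)
  per point. This is also the rate assumed for the variance estimator, and the redundancy ratio,
  which multiplies all these errors, is small against its inverse. On the cells no such division is
  possible, because a cell may contain very few points or none. Hence the errors on covering sets
  are controlled one by one, with a rate, whereas those on cells are only controlled summed over the
  cells, without a rate. The noise enters at both levels: least squares fits \<open>Y\<close> rather
  than the regression function, so each comparison of a cell with a covering set leaves a noise term
  on the cell. All noise functions involved have mean 0 on every cylinder over \<open>X\<close>, by
  independence, so their deviations are plain sums. Boundedness of \<open>Y\<close> forces the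
  regression function to be bounded almost surely, and a truncated version of it makes all weights
  bounded on \<open>S\<close>.\<close>

lemma indep_vars_PiM_component:
  assumes "\<And>i. i \<in> K \<Longrightarrow> prob_space (M i)" "I \<subseteq> K" "I \<noteq> {}"
  shows "prob_space.indep_vars (PiM K M) M (\<lambda>i \<omega>. \<omega> i) I"
proof -
  interpret prob_space "PiM K M" by (rule prob_space_PiM) (rule assms)
  have "distr (PiM K M) (\<Pi>\<^sub>M i\<in>I. M i) (\<lambda>\<omega>. \<lambda>i\<in>I. \<omega> i) = (\<Pi>\<^sub>M i\<in>I. M i)"
    using distr_PiM_reindex[of K M "\<lambda>i. i" I] assms by auto
  also have "\<dots> = (\<Pi>\<^sub>M i\<in>I. distr (PiM K M) (M i) (\<lambda>\<omega>. \<omega> i))"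
    using assms by (intro PiM_cong refl distr_PiM_component[symmetric]) auto
  finally show ?thesis
    using assms by (subst indep_vars_iff_distr_eq_PiM') auto
qed

text \<open>The product may have infinitely many factors and the functions may vary with the index:
  the resampling noise is a sequence indexed by all naturals, and the function of its coordinate
  \<open>i\<close> involves the fixed observation \<open>d i\<close>.\<close>

lemma Hoeffding_PiM:
  fixes h :: "'i \<Rightarrow> 'a \<Rightarrow> real" and c s :: real
  assumes P: "prob_space P" and I: "finite I" "I \<subseteq> K" "I \<noteq> {}"
    and h[measurable]: "\<And>i. i \<in> I \<Longrightarrow> h i \<in> borel_measurable P"
    and bound: "\<And>i x. i \<in> I \<Longrightarrow> x \<in> space P \<Longrightarrow> \<bar>h i x\<bar> \<le> c"
    and "c > 0" "s \<ge> 0"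
  shows "measure (PiM K (\<lambda>_. P))
           {\<omega> \<in> space (PiM K (\<lambda>_. P)). \<bar>(\<Sum>i\<in>I. h i (\<omega> i)) - (\<Sum>i\<in>I. \<integral>x. h i x \<partial>P)\<bar> \<ge> s}
         \<le> 2 * exp (- s\<^sup>2 / (2 * card I * c\<^sup>2))"
proof -
  interpret P: prob_space P by fact
  interpret prob_space "PiM K (\<lambda>_. P)" by (rule prob_space_PiM) (rule P)
  have "indep_vars (\<lambda>_. P) (\<lambda>i \<omega>. \<omega> i) I"
    by (rule indep_vars_PiM_component) (use P I in auto)
  then have ind: "indep_vars (\<lambda>_. borel) (\<lambda>i \<omega>. h i (\<omega> i)) I"
    by (rule indep_vars_compose2) auto
  have expect: "expectation (\<lambda>\<omega>. h i (\<omega> i)) = (\<integral>x. h i x \<partial>P)" if "i \<in> I" for i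
  proof -
    have "(\<integral>x. h i x \<partial>P) = (\<integral>x. h i x \<partial>distr (PiM K (\<lambda>_. P)) P (\<lambda>\<omega>. \<omega> i))"
      using that I P by (subst distr_PiM_component) auto
    also have "\<dots> = expectation (\<lambda>\<omega>. h i (\<omega> i))"
      using that I by (subst integral_distr) auto
    finally show ?thesis by simp
  qed
  interpret Hoeffding_ineq "PiM K (\<lambda>_. P)" I "\<lambda>i \<omega>. h i (\<omega> i)" "\<lambda>_. -c" "\<lambda>_. c"
    "(\<Sum>i\<in>I. expectation (\<lambda>\<omega>. h i (\<omega> i)))"
  proof unfold_locales
    fix i assume i: "i \<in> I"
    show "AE \<omega> in PiM K (\<lambda>_. P). h i (\<omega> i) \<in> {- c..c}"
    proof (rule AE_I2)
      fix \<omega> assume "\<omega> \<in> space (PiM K (\<lambda>_. P))"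
      then have "\<omega> i \<in> space P" using i I by (auto simp: space_PiM)
      from bound[OF i this] show "h i (\<omega> i) \<in> {- c..c}" by auto
    qed
  qed (use I ind in simp_all)
  have card: "card I > 0" using I by (simp add: card_gt_0_iff)
  have "(\<Sum>i\<in>I. (c - - c)\<^sup>2) = 4 * card I * c\<^sup>2"
    by (simp add: power2_eq_square)
  then have "(\<Sum>i\<in>I. (c - - c)\<^sup>2) > 0" using card \<open>c > 0\<close> by simp
  from Hoeffding_ineq_abs_ge[OF \<open>s \<ge> 0\<close> this] show ?thesis
    by (simp add: expect power2_eq_square mult_ac divide_simps cong: sum.cong)
qed

text \<open>This is cosh x \<le> exp (x^2 / 2), the bound for the exponential moment of a random
  sign. It is Hoeffding's lemma for a fair coin with parameter 2 x; evenness covers negative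
  x.\<close>

lemma exp_plus_exp_minus_le: "exp x + exp (- x) \<le> 2 * exp (x\<^sup>2 / 2)" for x :: real
proof -
  have *: "exp x + exp (- x) \<le> 2 * exp (x\<^sup>2 / 2)" if "x \<ge> 0" for x :: real
  proof -
    have pos: "1 + 1 / 2 * (exp (2 * x) - 1) > 0" by (simp add: field_simps add_pos_pos)
    have "ln (1 + 1 / 2 * (exp (2 * x) - 1)) \<le> x + x\<^sup>2 / 2"
      using Hoeffdings_lemma_aux[of "2 * x" "1/2"] that by (simp add: power2_eq_square)
    then have "1 + 1 / 2 * (exp (2 * x) - 1) \<le> exp (x + x\<^sup>2 / 2)"
      using pos by (metis exp_le_cancel_iff exp_ln)
    then have "exp (- x) * (1 + exp (2 * x)) \<le> exp (- x) * (2 * exp (x + x\<^sup>2 / 2))"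
      by (intro mult_left_mono) (auto simp: field_simps)
    then show ?thesis
      by (simp add: algebra_simps flip: exp_add)
  qed
  show ?thesis
    using *[of x] *[of "-x"] by (cases "x \<ge> 0") auto
qed

text \<open>Hoeffding's inequality for random signs in counting form: \<open>J\<close> holds the
  indices with negative sign. Counting suits the symmetrisation, which averages over the 2^n swaps
  of a double sample instead of introducing random signs.\<close>

lemma card_sign_sets_le:
  fixes c :: "'i \<Rightarrow> real" and a t :: real
  assumes "finite I" and bound: "\<And>i. i \<in> I \<Longrightarrow> \<bar>c i\<bar> \<le> a" and "a > 0" "t \<ge> 0" "I \<noteq> {}"
  shows "real (card {J \<in> Pow I. (\<Sum>i\<in>I - J. c i) - (\<Sum>i\<in>J. c i) > t})
         \<le> 2 ^ card I * exp (- t\<^sup>2 / (2 * card I * a\<^sup>2))"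
proof -
  define n where "n = card I"
  have n: "n > 0" using assms by (simp add: n_def card_gt_0_iff)
  \<comment> \<open>The Chernoff parameter minimising n (l a)^2 / 2 - l t.\<close>
  define l where "l = t / (n * a\<^sup>2)"
  have l: "l \<ge> 0" using assms by (simp add: l_def)
  define s where "s J = (\<Sum>i\<in>I - J. c i) - (\<Sum>i\<in>J. c i)" for J
  have "real (card {J \<in> Pow I. s J > t}) = (\<Sum>J\<in>{J \<in> Pow I. s J > t}. 1)"
    by simp
  also have "\<dots> \<le> (\<Sum>J\<in>{J \<in> Pow I. s J > t}. exp (l * s J - l * t))"
    using l by (intro sum_mono) (auto simp: mult_left_mono)
  also have "\<dots> \<le> (\<Sum>J\<in>Pow I. exp (l * s J - l * t))"
    using assms by (intro sum_mono2) auto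
  also have "\<dots> = exp (- l * t) * (\<Sum>J\<in>Pow I. exp (l * s J))"
    by (simp add: sum_distrib_left flip: exp_add)
  also have "(\<Sum>J\<in>Pow I. exp (l * s J)) = (\<Sum>J\<in>Pow I. (\<Prod>i\<in>J. exp (- (l * c i))) * (\<Prod>i\<in>I - J. exp (l * c i)))"
  proof (rule sum.cong[OF refl])
    fix J assume "J \<in> Pow I"
    then have "finite J" "finite (I - J)" using \<open>finite I\<close> by (auto intro: finite_subset)
    then show "exp (l * s J) = (\<Prod>i\<in>J. exp (- (l * c i))) * (\<Prod>i\<in>I - J. exp (l * c i))"
      by (simp add: s_def right_diff_distrib sum_distrib_left sum_negf flip: exp_sum exp_add)
  qed
  \<comment> \<open>Expanding the product chooses one of the two exponentials for each index, that
    is, a subset \<open>J\<close>.\<close>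
  also have "\<dots> = (\<Prod>i\<in>I. exp (- (l * c i)) + exp (l * c i))"
    using \<open>finite I\<close> by (simp add: prod_add)
  also have "\<dots> \<le> (\<Prod>i\<in>I. 2 * exp ((l * a)\<^sup>2 / 2))"
  proof (rule prod_mono)
    fix i assume i: "i \<in> I"
    have "exp (l * c i) + exp (- (l * c i)) \<le> 2 * exp ((l * c i)\<^sup>2 / 2)"
      by (rule exp_plus_exp_minus_le)
    also have "(l * c i)\<^sup>2 \<le> (l * a)\<^sup>2"
      using bound[OF i] l assms by (intro abs_le_square_iff[THEN iffD1]) (auto simp: abs_mult mult_left_mono)
    finally show "0 \<le> exp (- (l * c i)) + exp (l * c i) \<and>
      exp (- (l * c i)) + exp (l * c i) \<le> 2 * exp ((l * a)\<^sup>2 / 2)"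
      by (simp add: add.commute add_nonneg_nonneg)
  qed
  also have "\<dots> = 2 ^ n * exp (n * (l * a)\<^sup>2 / 2)"
    by (simp add: n_def power_mult_distrib flip: exp_of_nat_mult)
  finally have "real (card {J \<in> Pow I. s J > t}) \<le> exp (- l * t) * (2 ^ n * exp (n * (l * a)\<^sup>2 / 2))"
    by simp
  also have "\<dots> = 2 ^ n * (exp (- l * t) * exp (n * (l * a)\<^sup>2 / 2))"
    by (rule mult.left_commute)
  also have "exp (- l * t) * exp (n * (l * a)\<^sup>2 / 2) = exp (n * (l * a)\<^sup>2 / 2 - l * t)"
    by (subst exp_add[symmetric]) simp
  also have "n * (l * a)\<^sup>2 / 2 - l * t = - t\<^sup>2 / (2 * n * a\<^sup>2)"
    using n \<open>a > 0\<close> by (simp add: l_def power2_eq_square field_simps)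
  finally show ?thesis by (simp add: s_def n_def)
qed

section \<open>Weighted deviations by resampling\<close>

text \<open>Given \<open>d\<close>, the coordinates are independent, so the probability of a
  cylinder is a product of functions of the single \<open>d i\<close>; integrating over
  \<open>d\<close> factorises again, and each factor has its value under \<open>P\<close> because
  both \<open>\<phi>\<close> and \<open>\<psi>\<close> preserve \<open>P\<close>. Filling the
  coordinates outside \<open>I\<close> with \<open>\<psi>\<close> turns a finite sample into a point
  of the infinite product, where the Donsker property provides its good events.\<close>

lemma distr_resample_PiM:
  fixes P :: "'a measure" and N :: "'b measure" and I :: "'i set"
  assumes P: "prob_space P" and N: "prob_space N" and I: "finite I"
    and \<phi>[measurable]: "case_prod \<phi> \<in> P \<Otimes>\<^sub>M N \<rightarrow>\<^sub>M P" and \<psi>[measurable]: "\<psi> \<in> N \<rightarrow>\<^sub>M P"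
    and dphi: "distr (P \<Otimes>\<^sub>M N) P (case_prod \<phi>) = P" and dpsi: "distr N P \<psi> = P"
  shows "(\<lambda>(d, e) i. if i \<in> I then \<phi> (d i) (e i) else \<psi> (e i))
           \<in> PiM I (\<lambda>_. P) \<Otimes>\<^sub>M PiM UNIV (\<lambda>_. N) \<rightarrow>\<^sub>M PiM UNIV (\<lambda>_. P)" (is "?\<Phi> \<in> ?D \<rightarrow>\<^sub>M ?U")
    and "distr (PiM I (\<lambda>_. P) \<Otimes>\<^sub>M PiM UNIV (\<lambda>_. N)) (PiM UNIV (\<lambda>_. P))
           (\<lambda>(d, e) i. if i \<in> I then \<phi> (d i) (e i) else \<psi> (e i)) = PiM UNIV (\<lambda>_. P)"
proof -
  interpret P: prob_space P by fact
  interpret N: prob_space N by fact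
  interpret UP: product_prob_space "\<lambda>_::'i. P" UNIV by unfold_locales
  interpret UN: product_prob_space "\<lambda>_::'i. N" UNIV by unfold_locales
  interpret IP: finite_product_prob_space "\<lambda>_::'i. P" I by unfold_locales (fact I)
  interpret PN: pair_prob_space "PiM I (\<lambda>_. P)" "PiM UNIV (\<lambda>_::'i. N)" by unfold_locales
  have space: "\<phi> x b \<in> space P" if "x \<in> space P" "b \<in> space N" for x b
    using measurable_space[OF \<phi>, of "(x, b)"] that by (simp add: space_pair_measure)
  show meas[measurable]: "?\<Phi> \<in> ?D \<rightarrow>\<^sub>M ?U"
  proof (rule measurable_PiM_single')
    fix i :: 'i
    show "(\<lambda>x. ?\<Phi> x i) \<in> ?D \<rightarrow>\<^sub>M P"
    proof (cases "i \<in> I")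
      case True
      then have "(\<lambda>(d, e). \<phi> (d i) (e i)) \<in> ?D \<rightarrow>\<^sub>M P"
        using measurable_compose[OF _ \<phi>, of "\<lambda>(d, e). (d i, e i)" ?D]
        by (simp add: case_prod_beta')
      with True show ?thesis by (simp add: case_prod_beta')
    qed (simp add: case_prod_beta')
  next
    show "?\<Phi> \<in> space ?D \<rightarrow> UNIV \<rightarrow>\<^sub>E space P"
      using space measurable_space[OF \<psi>]
      by (fastforce simp: space_PiM space_pair_measure PiE_iff split: if_splits)
  qed
  show "distr ?D ?U ?\<Phi> = ?U"
  proof (rule UP.PiM_eq)
    fix J :: "'i set" and F assume J: "finite J" and F: "\<And>j. j \<in> J \<Longrightarrow> F j \<in> sets P"
    \<comment> \<open>\<open>\<kappa> j x\<close> is the probability that the observation resampled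
      from \<open>x\<close> falls into \<open>F j\<close>; by \<open>dphi\<close> its mean is the
      measure of \<open>F j\<close>.\<close>
    define \<kappa> where "\<kappa> j x = emeasure N {b \<in> space N. \<phi> x b \<in> F j}" for j x
    have \<kappa>_meas: "\<kappa> j \<in> borel_measurable P" if "j \<in> J" for j
    proof -
      note F[OF that, measurable]
      show ?thesis unfolding \<kappa>_def by measurable
    qed
    have \<kappa>_int: "(\<integral>\<^sup>+x. \<kappa> j x \<partial>P) = emeasure P (F j)" if "j \<in> J" for j
    proof -
      note F[OF that, measurable]
      have "emeasure P (F j) = emeasure (distr (P \<Otimes>\<^sub>M N) P (case_prod \<phi>)) (F j)"
        by (simp add: dphi)
      also have "\<dots> = emeasure (P \<Otimes>\<^sub>M N) {z \<in> space (P \<Otimes>\<^sub>M N). case_prod \<phi> z \<in> F j}"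
        by (subst emeasure_distr) (auto intro!: arg_cong[where f = "emeasure _"])
      also have "\<dots> = (\<integral>\<^sup>+x. emeasure N (Pair x -` {z \<in> space (P \<Otimes>\<^sub>M N). case_prod \<phi> z \<in> F j}) \<partial>P)"
        by (rule N.emeasure_pair_measure_alt) measurable
      also have "\<dots> = (\<integral>\<^sup>+x. \<kappa> j x \<partial>P)"
        unfolding \<kappa>_def
        by (intro nn_integral_cong arg_cong[where f = "emeasure _"]) (auto simp: space_pair_measure)
      finally show ?thesis by simp
    qed
    have \<psi>_eq: "emeasure N {b \<in> space N. \<psi> b \<in> F j} = emeasure P (F j)" if "j \<in> J" for j
    proof -
      note F[OF that, measurable]
      have "emeasure P (F j) = emeasure (distr N P \<psi>) (F j)"
        by (simp add: dpsi)
      also have "\<dots> = emeasure N {b \<in> space N. \<psi> b \<in> F j}"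
        by (subst emeasure_distr) (auto intro!: arg_cong[where f = "emeasure _"])
      finally show ?thesis by simp
    qed
    let ?E = "prod_emb UNIV (\<lambda>_. P) J (Pi\<^sub>E J F)"
    have E[measurable]: "?E \<in> sets ?U"
      using J F by (intro sets_PiM_I) auto
    have "emeasure (distr ?D ?U ?\<Phi>) ?E = emeasure ?D (?\<Phi> -` ?E \<inter> space ?D)"
      by (rule emeasure_distr[OF meas E])
    also have "\<dots> = (\<integral>\<^sup>+d. emeasure (PiM UNIV (\<lambda>_. N)) (Pair d -` (?\<Phi> -` ?E \<inter> space ?D)) \<partial>PiM I (\<lambda>_. P))"
      by (rule UN.P.emeasure_pair_measure_alt) measurable
    also have "\<dots> = (\<integral>\<^sup>+d. (\<Prod>i\<in>I. if i \<in> J then \<kappa> i (d i) else 1) * (\<Prod>j\<in>J - I. emeasure P (F j)) \<partial>PiM I (\<lambda>_. P))"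
    proof (rule nn_integral_cong)
      fix d assume d: "d \<in> space (PiM I (\<lambda>_. P))"
      define T where "T j = {b \<in> space N. (if j \<in> I then \<phi> (d j) b else \<psi> b) \<in> F j}" for j
      have T: "T j \<in> sets N" if "j \<in> J" for j
      proof (cases "j \<in> I")
        case True
        note F[OF that, measurable]
        have "d j \<in> space P" using d True by (auto simp: space_PiM)
        then show ?thesis unfolding T_def using True by simp
      next
        case False
        note F[OF that, measurable]
        show ?thesis unfolding T_def using False by simp
      qed
      have "Pair d -` (?\<Phi> -` ?E \<inter> space ?D) =
          {e \<in> space (PiM UNIV (\<lambda>_. N)). \<forall>j\<in>J. e j \<in> T j}"
        using d measurable_space[OF meas]
        by (force simp: prod_emb_def T_def space_pair_measure space_PiM PiE_iff)
      then have "emeasure (PiM UNIV (\<lambda>_. N)) (Pair d -` (?\<Phi> -` ?E \<inter> space ?D)) = (\<Prod>j\<in>J. emeasure N (T j))"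
        using UN.emeasure_PiM_Collect[of J T] J T by simp
      also have "\<dots> = (\<Prod>j\<in>J. if j \<in> I then \<kappa> j (d j) else emeasure P (F j))"
        by (intro prod.cong) (auto simp: T_def \<kappa>_def \<psi>_eq)
      also have "\<dots> = (\<Prod>j\<in>I \<inter> J. \<kappa> j (d j)) * (\<Prod>j\<in>J - I. emeasure P (F j))"
        using J by (simp add: prod.If_cases Int_commute Diff_eq)
      also have "(\<Prod>j\<in>I \<inter> J. \<kappa> j (d j)) = (\<Prod>i\<in>I. if i \<in> J then \<kappa> i (d i) else 1)"
        using I by (simp add: prod.If_cases)
      finally show "emeasure (PiM UNIV (\<lambda>_. N)) (Pair d -` (?\<Phi> -` ?E \<inter> space ?D)) =
        (\<Prod>i\<in>I. if i \<in> J then \<kappa> i (d i) else 1) * (\<Prod>j\<in>J - I. emeasure P (F j))" .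
    qed
    also have "\<dots> = (\<integral>\<^sup>+d. (\<Prod>i\<in>I. if i \<in> J then \<kappa> i (d i) else 1) \<partial>PiM I (\<lambda>_. P)) * (\<Prod>j\<in>J - I. emeasure P (F j))"
    proof (rule nn_integral_multc)
      have "(\<lambda>d. if i \<in> J then \<kappa> i (d i) else 1) \<in> borel_measurable (PiM I (\<lambda>_. P))" if "i \<in> I" for i
        using that measurable_compose[OF measurable_component_singleton[OF that] \<kappa>_meas[of i]] by (cases "i \<in> J") auto
      then show "(\<lambda>d. \<Prod>i\<in>I. if i \<in> J then \<kappa> i (d i) else 1) \<in> borel_measurable (PiM I (\<lambda>_. P))"
        by (intro borel_measurable_prod_ennreal)
    qed
    also have "(\<integral>\<^sup>+d. (\<Prod>i\<in>I. if i \<in> J then \<kappa> i (d i) else 1) \<partial>PiM I (\<lambda>_. P)) =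
        (\<Prod>i\<in>I. \<integral>\<^sup>+x. (if i \<in> J then \<kappa> i x else 1) \<partial>P)"
    proof (rule UP.product_nn_integral_prod[OF I])
      show "(\<lambda>x. if i \<in> J then \<kappa> i x else 1) \<in> borel_measurable P" for i
        using \<kappa>_meas by (cases "i \<in> J") auto
    qed
    also have "\<dots> = (\<Prod>i\<in>I. if i \<in> J then emeasure P (F i) else 1)"
      by (intro prod.cong) (auto simp: \<kappa>_int P.emeasure_space_1)
    also have "\<dots> = (\<Prod>j\<in>I \<inter> J. emeasure P (F j))"
      using I by (simp add: prod.If_cases)
    also have "\<dots> * (\<Prod>j\<in>J - I. emeasure P (F j)) = (\<Prod>j\<in>J. emeasure P (F j))"
      using J by (subst prod.union_disjoint[symmetric]) (auto intro: prod.cong)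
    finally show "emeasure (distr ?D ?U ?\<Phi>) ?E = (\<Prod>j\<in>J. emeasure P (F j))" .
  qed simp
qed

text \<open>Fubini and Markov: the conditional probability of leaving \<open>G\<close> has mean at
  most \<open>\<eta>\<close>, so it is below 1/2 except on an event of probability 2
  \<open>\<eta>\<close>. The exceptional event \<open>A\<close> is quantified after
  \<open>d\<close>, since it will depend on the sample and on a single set of the Donsker class; no
  union over the class is formed.\<close>

lemma resample_good_set:
  fixes P :: "'a measure" and N :: "'b measure" and I :: "'i set"
  assumes P: "prob_space P" and N: "prob_space N" and I: "finite I"
    and \<phi>: "case_prod \<phi> \<in> P \<Otimes>\<^sub>M N \<rightarrow>\<^sub>M P" and \<psi>: "\<psi> \<in> N \<rightarrow>\<^sub>M P"
    and dphi: "distr (P \<Otimes>\<^sub>M N) P (case_prod \<phi>) = P" and dpsi: "distr N P \<psi> = P"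
    and G: "G \<in> sets (PiM UNIV (\<lambda>_::'i. P))" "measure (PiM UNIV (\<lambda>_. P)) G \<ge> 1 - \<eta>"
  obtains G' where "G' \<in> sets (PiM I (\<lambda>_. P))" "measure (PiM I (\<lambda>_. P)) G' \<ge> 1 - 2 * \<eta>"
    "\<And>d A. \<lbrakk>d \<in> G'; A \<in> sets (PiM UNIV (\<lambda>_::'i. N)); measure (PiM UNIV (\<lambda>_::'i. N)) A \<le> 1 / 2\<rbrakk> \<Longrightarrow>
       \<exists>e\<in>space (PiM UNIV (\<lambda>_::'i. N)). e \<notin> A \<and> (\<lambda>i. if i \<in> I then \<phi> (d i) (e i) else \<psi> (e i)) \<in> G"
proof -
  interpret P: prob_space P by fact
  interpret N: prob_space N by fact
  define U where "U = PiM UNIV (\<lambda>_::'i. P)"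
  define D where "D = PiM I (\<lambda>_::'i. P)"
  define E where "E = PiM UNIV (\<lambda>_::'i. N)"
  interpret U: prob_space U unfolding U_def by (rule prob_space_PiM) (rule P)
  interpret D: prob_space D unfolding D_def by (rule prob_space_PiM) (rule P)
  interpret E: prob_space E unfolding E_def by (rule prob_space_PiM) (rule N)
  interpret DE: pair_prob_space D E by unfold_locales
  define \<Phi> where "\<Phi> = (\<lambda>(d, e) i. if i \<in> I then \<phi> (d i) (e i) else \<psi> (e i))"
  note resample = distr_resample_PiM[OF P N I \<phi> \<psi> dphi dpsi]
  have \<Phi>[measurable]: "\<Phi> \<in> D \<Otimes>\<^sub>M E \<rightarrow>\<^sub>M U"
    using resample(1) by (simp add: U_def D_def E_def \<Phi>_def)
  have law: "distr (D \<Otimes>\<^sub>M E) U \<Phi> = U"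
    using resample(2) by (simp add: U_def D_def E_def \<Phi>_def)
  have [measurable]: "G \<in> sets U" using G by (simp add: U_def)
  define q where "q d = measure E {e \<in> space E. \<Phi> (d, e) \<notin> G}" for d
  have q_meas[measurable]: "q \<in> borel_measurable D" unfolding q_def by measurable
  have "(\<integral>\<^sup>+d. ennreal (q d) \<partial>D) = (\<integral>\<^sup>+d. emeasure E (Pair d -` {z \<in> space (D \<Otimes>\<^sub>M E). \<Phi> z \<notin> G}) \<partial>D)"
    unfolding q_def
    by (intro nn_integral_cong) (auto simp: space_pair_measure E.emeasure_eq_measure intro!: arg_cong[where f = "measure _"])
  also have "\<dots> = emeasure (D \<Otimes>\<^sub>M E) {z \<in> space (D \<Otimes>\<^sub>M E). \<Phi> z \<notin> G}"
    by (rule E.emeasure_pair_measure_alt[symmetric]) measurable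
  also have "\<dots> = emeasure (distr (D \<Otimes>\<^sub>M E) U \<Phi>) (space U - G)"
    using measurable_space[OF \<Phi>]
    by (subst emeasure_distr) (auto intro!: arg_cong[where f = "emeasure _"])
  also have "\<dots> \<le> ennreal \<eta>"
  proof -
    have "measure U (space U - G) \<le> \<eta>"
      using G by (subst U.prob_compl) (auto simp: U_def)
    then show ?thesis by (subst law, subst U.emeasure_eq_measure) (rule ennreal_leI)
  qed
  finally have q_le: "(\<integral>\<^sup>+d. ennreal (q d) \<partial>D) \<le> ennreal \<eta>" .
  have "\<eta> \<ge> 0" using G U.prob_le_1[of G] by (simp add: U_def)
  define G' where "G' = {d \<in> space D. q d < 1 / 2}"
  show ?thesis
  proof
    show G'[measurable]: "G' \<in> sets (PiM I (\<lambda>_. P))" unfolding G'_def D_def[symmetric] by measurable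
    have "emeasure D {d \<in> space D. 1 \<le> 2 * ennreal (q d)} \<le> 2 * (\<integral>\<^sup>+d. ennreal (q d) * indicator (space D) d \<partial>D)"
      by (intro nn_integral_Markov_inequality) auto
    also have "(\<integral>\<^sup>+d. ennreal (q d) * indicator (space D) d \<partial>D) = (\<integral>\<^sup>+d. ennreal (q d) \<partial>D)"
      by (intro nn_integral_cong) auto
    also have "2 * \<dots> \<le> 2 * ennreal \<eta>"
      using q_le by (intro mult_left_mono) auto
    also have "\<dots> = ennreal (2 * \<eta>)" using \<open>\<eta> \<ge> 0\<close> by (simp add: ennreal_mult)
    also have "{d \<in> space D. 1 \<le> 2 * ennreal (q d)} = space D - G'"
    proof -
      have "1 \<le> 2 * ennreal (q d) \<longleftrightarrow> \<not> q d < 1 / 2" for d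
      proof -
        have "2 * ennreal (q d) = ennreal (2 * q d)"
          by (simp add: ennreal_mult q_def)
        then have "1 \<le> 2 * ennreal (q d) \<longleftrightarrow> 1 \<le> 2 * q d"
          by simp
        then show ?thesis by auto
      qed
      then show ?thesis by (auto simp: G'_def)
    qed
    finally have "measure D (space D - G') \<le> 2 * \<eta>"
      using \<open>\<eta> \<ge> 0\<close> by (simp add: D.emeasure_eq_measure)
    then show "measure (PiM I (\<lambda>_. P)) G' \<ge> 1 - 2 * \<eta>"
      using D.prob_compl[of G'] G' by (simp add: D_def)
    fix d A assume d: "d \<in> G'" and A: "A \<in> sets (PiM UNIV (\<lambda>_::'i. N))" "measure (PiM UNIV (\<lambda>_::'i. N)) A \<le> 1 / 2"
    have [measurable]: "A \<in> sets E" using A by (simp add: E_def)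
    have [measurable]: "d \<in> space D" using d by (simp add: G'_def)
    \<comment> \<open>Both bad events have probability at most 1/2, the second strictly less, so
      together they do not exhaust the space.\<close>
    have "measure E (A \<union> {e \<in> space E. \<Phi> (d, e) \<notin> G}) \<le> measure E A + q d"
      unfolding q_def by (rule measure_Un_le) measurable
    also have "\<dots> < 1" using A d by (simp add: E_def G'_def)
    finally have "A \<union> {e \<in> space E. \<Phi> (d, e) \<notin> G} \<noteq> space E"
      using E.prob_space by auto
    moreover have "A \<subseteq> space E" by (rule sets.sets_into_space) fact
    ultimately obtain e where "e \<in> space E" "e \<notin> A" "\<Phi> (d, e) \<in> G" by auto
    then show "\<exists>e\<in>space (PiM UNIV (\<lambda>_::'i. N)). e \<notin> A \<and> (\<lambda>i. if i \<in> I then \<phi> (d i) (e i) else \<psi> (e i)) \<in> G"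
      by (auto simp: E_def \<Phi>_def)
  qed
qed

text \<open>
  Resample the observation \<open>x\<close> by keeping it with probability \<open>h(x, y) = (a(x) + a(y)) / 2\<close> and
  replacing it by an independent copy \<open>y\<close> otherwise. As \<open>h\<close> is symmetric, the law does not change, and
  the conditional expectation of the count of a set \<open>B\<close> contains the \<open>a\<close>-weighted count of \<open>B\<close>.
  For each \<open>B\<close> separately, some realisation is both good and close to this conditional expectation.
\<close>

lemma resampled_deviation:
  fixes P :: "'a measure" and a :: "'a \<Rightarrow> real" and K :: real and n :: nat
  assumes P: "prob_space P" and a[measurable]: "a \<in> borel_measurable P"
    and a01: "\<And>x. x \<in> space P \<Longrightarrow> 0 \<le> a x \<and> a x \<le> 1"
    and \<B>: "\<B> \<subseteq> sets P" and n: "n > 0"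
    and G: "G \<in> sets (PiM UNIV (\<lambda>_::nat. P))" "measure (PiM UNIV (\<lambda>_. P)) G \<ge> 1 - \<eta>"
    and dev: "\<And>z B. z \<in> G \<Longrightarrow> B \<in> \<B> \<Longrightarrow>
      \<bar>(\<Sum>i=1..n. indicator B (z i)) - n * measure P B\<bar> \<le> K * sqrt n"
  shows "\<exists>G'\<in>sets (PiM {1..n} (\<lambda>_. P)). measure (PiM {1..n} (\<lambda>_. P)) G' \<ge> 1 - 2 * \<eta> \<and>
    (\<forall>d\<in>G'. \<forall>B\<in>\<B>. \<bar>((\<Sum>i=1..n. a (d i) * indicator B (d i)) - n * (\<integral>x. a x * indicator B x \<partial>P)) / 2
       + (\<integral>x. a x \<partial>P) * ((\<Sum>i=1..n. indicator B (d i)) - n * measure P B) / 2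
       - measure P B * ((\<Sum>i=1..n. a (d i)) - n * (\<integral>x. a x \<partial>P)) / 2\<bar> \<le> (K + 2) * sqrt n)"
proof -
  interpret P: prob_space P by fact
  define U :: "real measure" where "U = uniform_measure lborel {0..1}"
  interpret U: prob_space U unfolding U_def by (rule prob_space_uniform_measure) auto
  have [measurable_cong]: "sets U = sets borel" by (simp add: U_def)
  have space_U: "space U = UNIV" by (simp add: U_def)
  have U_less: "measure U {..<t} = t" if "0 \<le> t" "t \<le> 1" for t
  proof -
    have "{0..1} \<inter> {..<t} = {0..<t}" using that by auto
    then show ?thesis
      using that by (simp add: U_def measure_uniform_measure)
  qed
  \<comment> \<open>The noise of one observation: an independent copy \<open>y\<close> and a uniform
    \<open>u\<close> that decides whether \<open>x\<close> is kept.\<close>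
  define N where "N = P \<Otimes>\<^sub>M U"
  interpret PU: pair_prob_space P U by unfold_locales
  interpret PP: pair_prob_space P P by unfold_locales
  interpret N: prob_space N unfolding N_def by unfold_locales
  have [measurable_cong]: "sets N = sets (P \<Otimes>\<^sub>M U)" by (simp add: N_def)
  define h where "h x y = (a x + a y) / 2" for x y
  have [measurable]: "case_prod h \<in> borel_measurable (P \<Otimes>\<^sub>M P)"
    unfolding h_def by measurable
  define \<phi> where "\<phi> x = (\<lambda>(y, u). if u < h x y then x else y)" for x
  have \<phi>[measurable]: "case_prod \<phi> \<in> P \<Otimes>\<^sub>M N \<rightarrow>\<^sub>M P"
    unfolding \<phi>_def h_def N_def by (simp add: case_prod_beta') measurable
  have \<psi>: "fst \<in> N \<rightarrow>\<^sub>M P" unfolding N_def by measurable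
  have dpsi: "distr N P fst = P"
    unfolding N_def by (rule U.distr_pair_fst)
  define F where "F t = emeasure U {u \<in> space U. u < t}" for t
  define F' where "F' t = emeasure U {u \<in> space U. t \<le> u}" for t
  have [measurable]: "F \<in> borel_measurable borel" "F' \<in> borel_measurable borel"
    unfolding F_def F'_def by measurable
  have FF': "F t + F' t = 1" for t
  proof -
    have "F t + F' t = emeasure U ({u \<in> space U. u < t} \<union> {u \<in> space U. t \<le> u})"
      unfolding F_def F'_def by (intro plus_emeasure) auto
    also have "{u \<in> space U. u < t} \<union> {u \<in> space U. t \<le> u} = space U" by auto
    finally show ?thesis by (simp add: U.emeasure_space_1)
  qed
  have nn_add: "(\<integral>\<^sup>+x. \<integral>\<^sup>+y. f x y + g x y \<partial>P \<partial>P) =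
      (\<integral>\<^sup>+x. \<integral>\<^sup>+y. f x y \<partial>P \<partial>P) + (\<integral>\<^sup>+x. \<integral>\<^sup>+y. g x y \<partial>P \<partial>P)"
    if [measurable]: "case_prod f \<in> borel_measurable (P \<Otimes>\<^sub>M P)" "case_prod g \<in> borel_measurable (P \<Otimes>\<^sub>M P)"
    for f g :: "'a \<Rightarrow> 'a \<Rightarrow> ennreal"
  proof -
    have "(\<integral>\<^sup>+x. \<integral>\<^sup>+y. f x y + g x y \<partial>P \<partial>P) = (\<integral>\<^sup>+x. (\<integral>\<^sup>+y. f x y \<partial>P) + (\<integral>\<^sup>+y. g x y \<partial>P) \<partial>P)"
      by (intro nn_integral_cong nn_integral_add) measurable
    also have "\<dots> = (\<integral>\<^sup>+x. \<integral>\<^sup>+y. f x y \<partial>P \<partial>P) + (\<integral>\<^sup>+x. \<integral>\<^sup>+y. g x y \<partial>P \<partial>P)"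
      by (intro nn_integral_add) measurable
    finally show ?thesis .
  qed
  have dphi: "distr (P \<Otimes>\<^sub>M N) P (case_prod \<phi>) = P"
  proof (rule measure_eqI)
    fix A assume "A \<in> sets (distr (P \<Otimes>\<^sub>M N) P (case_prod \<phi>))"
    then have A[measurable]: "A \<in> sets P" by simp
    have "emeasure (distr (P \<Otimes>\<^sub>M N) P (case_prod \<phi>)) A = (\<integral>\<^sup>+z. indicator A z \<partial>distr (P \<Otimes>\<^sub>M N) P (case_prod \<phi>))"
      by simp
    also have "\<dots> = (\<integral>\<^sup>+z. indicator A (case_prod \<phi> z) \<partial>(P \<Otimes>\<^sub>M N))"
      by (rule nn_integral_distr) measurable
    also have "\<dots> = (\<integral>\<^sup>+x. \<integral>\<^sup>+v. indicator A (\<phi> x v) \<partial>N \<partial>P)"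
      by (subst N.nn_integral_fst[symmetric]) simp_all
    also have "\<dots> = (\<integral>\<^sup>+x. \<integral>\<^sup>+y. \<integral>\<^sup>+u. indicator A (\<phi> x (y, u)) \<partial>U \<partial>P \<partial>P)"
      unfolding N_def
      by (intro nn_integral_cong, subst U.nn_integral_fst[symmetric]) (simp_all flip: N_def)
    also have "\<dots> = (\<integral>\<^sup>+x. \<integral>\<^sup>+y. F (h x y) * indicator A x + F' (h x y) * indicator A y \<partial>P \<partial>P)"
    proof (intro nn_integral_cong)
      fix x y assume "x \<in> space P" "y \<in> space P"
      have "(\<integral>\<^sup>+u. indicator A (\<phi> x (y, u)) \<partial>U) =
          (\<integral>\<^sup>+u. indicator A x * indicator {u \<in> space U. u < h x y} u + indicator A y * indicator {u \<in> space U. h x y \<le> u} u \<partial>U)"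
        by (intro nn_integral_cong) (auto simp: \<phi>_def indicator_def)
      then show "(\<integral>\<^sup>+u. indicator A (\<phi> x (y, u)) \<partial>U) = F (h x y) * indicator A x + F' (h x y) * indicator A y"
        by (simp add: nn_integral_add nn_integral_cmult F_def F'_def mult.commute)
    qed
    also have "\<dots> = (\<integral>\<^sup>+x. \<integral>\<^sup>+y. F (h x y) * indicator A x \<partial>P \<partial>P) + (\<integral>\<^sup>+x. \<integral>\<^sup>+y. F' (h x y) * indicator A y \<partial>P \<partial>P)"
      by (rule nn_add) measurable
    \<comment> \<open>Exchanging \<open>x\<close> and \<open>y\<close>, which leaves the symmetric
      \<open>h\<close> unchanged, gives the kept and the replaced part the same indicator, with
      factors \<open>F\<close> and \<open>F'\<close> that add up to 1.\<close>
    also have "(\<integral>\<^sup>+x. \<integral>\<^sup>+y. F (h x y) * indicator A x \<partial>P \<partial>P) = (\<integral>\<^sup>+y. \<integral>\<^sup>+x. F (h x y) * indicator A x \<partial>P \<partial>P)"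
      by (rule PP.Fubini') measurable
    also have "\<dots> = (\<integral>\<^sup>+x. \<integral>\<^sup>+y. F (h x y) * indicator A y \<partial>P \<partial>P)"
      by (simp add: h_def add.commute)
    also have "\<dots> + (\<integral>\<^sup>+x. \<integral>\<^sup>+y. F' (h x y) * indicator A y \<partial>P \<partial>P) =
        (\<integral>\<^sup>+x. \<integral>\<^sup>+y. (F (h x y) + F' (h x y)) * indicator A y \<partial>P \<partial>P)"
      by (subst nn_add[symmetric]) (simp_all add: distrib_right)
    also have "\<dots> = emeasure P A"
      by (simp add: FF' P.emeasure_space_1)
    finally show "emeasure (distr (P \<Otimes>\<^sub>M N) P (case_prod \<phi>)) A = emeasure P A" .
  qed simp
  have int_a: "integrable P a"
    using a01 by (intro P.integrable_const_bound[of _ 1] AE_I2) auto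
  define p where "p = (\<integral>x. a x \<partial>P)"
  \<comment> \<open>The product of a(x) and the indicator at \<open>x\<close> is the weighted count
    that is wanted; the other terms are constants or multiples of a(x) or of the indicator
    alone.\<close>
  have \<phi>_int: "(\<integral>v. indicator B (\<phi> x v) \<partial>N) =
      (a x + p) / 2 * indicator B x + measure P B - a x * measure P B / 2 - (\<integral>y. a y * indicator B y \<partial>P) / 2"
    if x: "x \<in> space P" and B[measurable]: "B \<in> sets P" for x B
  proof -
    have int_aB: "integrable P (\<lambda>y. a y * indicator B y)"
      using a01 by (intro P.integrable_const_bound[of _ 1] AE_I2) (auto simp: indicator_def)
    have "(\<integral>v. indicator B (\<phi> x v) \<partial>N) = (\<integral>y. \<integral>u. indicat_real B (\<phi> x (y, u)) \<partial>U \<partial>P)"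
      unfolding N_def
    proof (rule PU.integral_fst'[symmetric])
      have "(\<lambda>v. indicat_real B (\<phi> x v)) \<in> borel_measurable N"
        using x by measurable
      then show "integrable (P \<Otimes>\<^sub>M U) (\<lambda>v. indicat_real B (\<phi> x v))"
        by (intro PU.P.integrable_const_bound[of _ 1]) (auto simp: N_def)
    qed
    also have "\<dots> = (\<integral>y. h x y * indicator B x + (1 - h x y) * indicator B y \<partial>P)"
    proof (intro Bochner_Integration.integral_cong refl)
      fix y assume y: "y \<in> space P"
      have h: "0 \<le> h x y" "h x y \<le> 1" using a01[OF x] a01[OF y] by (auto simp: h_def)
      have "(\<integral>u. indicat_real B (\<phi> x (y, u)) \<partial>U) =
          (\<integral>u. indicator B y + (indicator B x - indicator B y) * indicator {..<h x y} u \<partial>U)"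
        by (intro Bochner_Integration.integral_cong) (auto simp: \<phi>_def indicator_def)
      also have "\<dots> = indicator B y + (indicator B x - indicator B y) * h x y"
        using h by (subst Bochner_Integration.integral_add)
          (use U.prob_space in \<open>auto simp: U_less space_U U.emeasure_eq_measure\<close>)
      finally show "(\<integral>u. indicat_real B (\<phi> x (y, u)) \<partial>U) = h x y * indicator B x + (1 - h x y) * indicator B y"
        by (simp add: algebra_simps)
    qed
    also have "\<dots> = (\<integral>y. a x / 2 * indicator B x + a y * (indicator B x / 2) + indicator B y
        - a x / 2 * indicator B y - (a y * indicator B y) / 2 \<partial>P)"
      by (intro Bochner_Integration.integral_cong) (auto simp: h_def field_simps)
    also have "\<dots> = a x / 2 * indicator B x + p * (indicator B x / 2) + measure P B
        - a x / 2 * measure P B - (\<integral>y. a y * indicator B y \<partial>P) / 2"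
      using int_a int_aB by (simp add: P.prob_space p_def P.emeasure_eq_measure)
    finally show ?thesis by (simp add: field_simps)
  qed
  obtain G' where G': "G' \<in> sets (PiM {1..n} (\<lambda>_. P))" "measure (PiM {1..n} (\<lambda>_. P)) G' \<ge> 1 - 2 * \<eta>"
    and good: "\<And>d A. \<lbrakk>d \<in> G'; A \<in> sets (PiM UNIV (\<lambda>_::nat. N)); measure (PiM UNIV (\<lambda>_::nat. N)) A \<le> 1 / 2\<rbrakk> \<Longrightarrow>
       \<exists>e\<in>space (PiM UNIV (\<lambda>_::nat. N)). e \<notin> A \<and> (\<lambda>i. if i \<in> {1..n} then \<phi> (d i) (e i) else fst (e i)) \<in> G"
    using resample_good_set[OF P N.prob_space_axioms finite_atLeastAtMost \<phi> \<psi> dphi dpsi G, of 1 n] by blast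
  show ?thesis
  proof (intro bexI[of _ G'] conjI ballI G')
    fix d B assume d: "d \<in> G'" and "B \<in> \<B>"
    then have B[measurable]: "B \<in> sets P" using \<B> by auto
    have dP: "d i \<in> space P" if "i \<in> {1..n}" for i
      using sets.sets_into_space[OF G'(1)] d that by (auto simp: space_PiM PiE_iff)
    \<comment> \<open>\<open>m\<close> is the expected count of \<open>B\<close> given the sample
      \<open>d\<close>. With the threshold 2 sqrt n, Hoeffding's bound is 2 exp (-2) \<le> 1/2,
      which is what \<open>good\<close> admits; this explains the 2 in \<open>K + 2\<close>.\<close>
    define m where "m = (\<Sum>i=1..n. \<integral>v. indicat_real B (\<phi> (d i) v) \<partial>N)"
    define A where "A = {\<omega> \<in> space (PiM UNIV (\<lambda>_::nat. N)).
      \<bar>(\<Sum>i=1..n. indicat_real B (\<phi> (d i) (\<omega> i))) - m\<bar> \<ge> 2 * sqrt n}"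
    have meas: "(\<lambda>v. indicat_real B (\<phi> (d i) v)) \<in> borel_measurable N" if "i \<in> {1..n}" for i
      using dP[OF that] by measurable
    have "measure (PiM UNIV (\<lambda>_::nat. N)) A \<le> 2 * exp (- (2 * sqrt n)\<^sup>2 / (2 * card {1..n} * (1::real)\<^sup>2))"
      unfolding A_def m_def
      using n by (intro Hoeffding_PiM N.prob_space_axioms meas) auto
    also have "\<dots> = 2 * exp (- 2)" using n by (simp add: power2_eq_square)
    also have "\<dots> \<le> 1 / 2"
    proof -
      have "4 \<le> (1 + 1 :: real) ^ 2" by simp
      also have "(1 + 1 :: real) ^ 2 \<le> exp 1 ^ 2" by (intro power_mono exp_ge_add_one_self) auto
      also have "\<dots> = exp 2" by (simp flip: exp_of_nat_mult)
      finally show ?thesis by (simp add: exp_minus field_simps)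
    qed
    finally have "measure (PiM UNIV (\<lambda>_::nat. N)) A \<le> 1 / 2" .
    moreover have "A \<in> sets (PiM UNIV (\<lambda>_::nat. N))"
    proof -
      have "(\<lambda>\<omega>. indicat_real B (\<phi> (d i) (\<omega> i))) \<in> borel_measurable (PiM UNIV (\<lambda>_::nat. N))" if "i \<in> {1..n}" for i
        using measurable_compose[OF measurable_component_singleton[of i UNIV] meas[OF that]] by simp
      then show ?thesis unfolding A_def by measurable
    qed
    ultimately obtain e where e: "e \<notin> A" "e \<in> space (PiM UNIV (\<lambda>_::nat. N))"
      and eG: "(\<lambda>i. if i \<in> {1..n} then \<phi> (d i) (e i) else fst (e i)) \<in> G"
      using good[OF d] by blast
    have 1: "\<bar>(\<Sum>i=1..n. indicat_real B (\<phi> (d i) (e i))) - m\<bar> \<le> 2 * sqrt n"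
      using e by (auto simp: A_def)
    have 2: "\<bar>(\<Sum>i=1..n. indicat_real B (\<phi> (d i) (e i))) - n * measure P B\<bar> \<le> K * sqrt n"
      using dev[OF eG \<open>B \<in> \<B>\<close>] by simp
    have lin: "(\<Sum>i=1..n. x i / 2 + p * y i / 2 + q - z i * q / 2 - r / 2) =
        (\<Sum>i=1..n. x i) / 2 + p * (\<Sum>i=1..n. y i) / 2 + n * q - (\<Sum>i=1..n. z i) * q / 2 - n * r / 2"
      for x y z :: "nat \<Rightarrow> real" and q r :: real
      by (simp add: sum.distrib sum_subtractf sum_distrib_left sum_distrib_right sum_divide_distrib)
    have "m = (\<Sum>i=1..n. (a (d i) * indicator B (d i)) / 2 + p * indicator B (d i) / 2 + measure P B
          - a (d i) * measure P B / 2 - (\<integral>y. a y * indicator B y \<partial>P) / 2)"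
      unfolding m_def by (intro sum.cong refl) (simp add: \<phi>_int dP field_simps)
    also have "\<dots> = (\<Sum>i=1..n. a (d i) * indicator B (d i)) / 2 + p * (\<Sum>i=1..n. indicator B (d i)) / 2 + n * measure P B
          - (\<Sum>i=1..n. a (d i)) * measure P B / 2 - n * (\<integral>y. a y * indicator B y \<partial>P) / 2"
      by (rule lin)
    finally have m: "m = \<dots>" .
    have "\<bar>m - n * measure P B\<bar> \<le> (K + 2) * sqrt n"
      using 1 2 by (simp add: distrib_right abs_le_iff)
    \<comment> \<open>The expression is \<open>m - n * measure P B\<close>: the two products of
      \<open>p\<close> and \<open>measure P B\<close> created by the centring cancel.\<close>
    then show "\<bar>((\<Sum>i=1..n. a (d i) * indicator B (d i)) - n * (\<integral>x. a x * indicator B x \<partial>P)) / 2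
       + (\<integral>x. a x \<partial>P) * ((\<Sum>i=1..n. indicator B (d i)) - n * measure P B) / 2
       - measure P B * ((\<Sum>i=1..n. a (d i)) - n * (\<integral>x. a x \<partial>P)) / 2\<bar> \<le> (K + 2) * sqrt n"
      unfolding m p_def by (simp add: field_simps)
  qed
qed

section \<open>Uniform deviations for data-dependent partitions\<close>

text \<open>
  The function \<open>f d\<close> may depend on the sample \<open>d\<close>, which replaces the supremum over a class. After the
  symmetrisation only its traces on the two halves of the double sample are counted, so that the bound
  involves \<open>N\<close> for \<open>n\<close> points rather than for \<open>2 n\<close>.
\<close>

lemma ghost_sample_deviation:
  fixes P :: "'a measure" and f :: "(nat \<Rightarrow> 'a) \<Rightarrow> 'a \<Rightarrow> real" and w :: "'a \<Rightarrow> real"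
    and n N :: nat and c t :: real
  assumes P: "prob_space P" and n: "n > 0"
    and f[measurable]: "case_prod f \<in> borel_measurable (PiM {1..n} (\<lambda>_. P) \<Otimes>\<^sub>M P)"
    and f1: "\<And>d x. d \<in> space (PiM {1..n} (\<lambda>_. P)) \<Longrightarrow> x \<in> space P \<Longrightarrow> \<bar>f d x\<bar> \<le> 1"
    and w[measurable]: "w \<in> borel_measurable P"
    and wc: "\<And>x. x \<in> space P \<Longrightarrow> \<bar>w x\<bar> \<le> c" and c: "c > 0" and t: "t > 0"
    and traces: "\<And>x. x \<in> {1..n} \<rightarrow> space P \<Longrightarrow>
      finite ((\<lambda>d. \<lambda>i\<in>{1..n}. f d (x i)) ` space (PiM {1..n} (\<lambda>_. P))) \<and>
      card ((\<lambda>d. \<lambda>i\<in>{1..n}. f d (x i)) ` space (PiM {1..n} (\<lambda>_. P))) \<le> N"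
    and large: "4 \<le> exp (n * t\<^sup>2 / (8 * c\<^sup>2))"
  shows "{d \<in> space (PiM {1..n} (\<lambda>_. P)).
           (\<Sum>i=1..n. w (d i) * f d (d i)) - n * (\<integral>x. w x * f d x \<partial>P) \<ge> n * t}
         \<in> sets (PiM {1..n} (\<lambda>_. P))" (is "?meas")
    and "measure (PiM {1..n} (\<lambda>_. P)) {d \<in> space (PiM {1..n} (\<lambda>_. P)).
           (\<Sum>i=1..n. w (d i) * f d (d i)) - n * (\<integral>x. w x * f d x \<partial>P) \<ge> n * t}
         \<le> 2 * N\<^sup>2 * exp (- n * t\<^sup>2 / (32 * c\<^sup>2))" (is "?le")
proof -
  interpret P: prob_space P by fact
  define I where "I = {1..n}"
  define J where "J = {n+1..2*n}"
  have IJ: "I \<inter> J = {}" "finite I" "finite J" and IJ_un: "I \<union> J = {1..2*n}"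
    and cards: "card I = n" "card J = n" and ne: "I \<noteq> {}" "J \<noteq> {}"
    using n by (auto simp: I_def J_def)
  interpret PS: product_prob_space "\<lambda>_::nat. P" UNIV by unfold_locales
  define \<Omega> where "\<Omega> = PiM {1..2*n} (\<lambda>_. P)"
  define D where "D = PiM I (\<lambda>_. P)"
  define D' where "D' = PiM J (\<lambda>_. P)"
  interpret \<Omega>: prob_space \<Omega> unfolding \<Omega>_def by (rule prob_space_PiM) (rule P)
  interpret D: prob_space D unfolding D_def by (rule prob_space_PiM) (rule P)
  interpret D': prob_space D' unfolding D'_def by (rule prob_space_PiM) (rule P)
  have [measurable]: "case_prod f \<in> borel_measurable (D \<Otimes>\<^sub>M P)" using f by (simp add: D_def I_def)
  note f1 = f1[folded I_def, folded D_def]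
  note traces = traces[folded I_def, folded D_def]
  have Dcomp: "d i \<in> space P" if "d \<in> space D" "i \<in> I" for d i
    using that by (auto simp: D_def space_PiM PiE_iff)
  have \<Omega>comp: "e i \<in> space P" if "e \<in> space \<Omega>" "i \<in> {1..2*n}" for e i
    using that by (auto simp: \<Omega>_def space_PiM PiE_iff)
  have res[measurable]: "(\<lambda>e. restrict e I) \<in> \<Omega> \<rightarrow>\<^sub>M D"
    unfolding \<Omega>_def D_def IJ_un[symmetric] by (rule measurable_restrict_subset) auto
  have comp[measurable]: "(\<lambda>e. e i) \<in> \<Omega> \<rightarrow>\<^sub>M P" if "i \<in> {1..2*n}" for i
    unfolding \<Omega>_def using that by (rule measurable_component_singleton)
  \<comment> \<open>The function is selected by the first half only, so that given this half the
    ghost half is an independent sample for a fixed function.\<close>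
  define s where "s e = (\<Sum>i\<in>I. w (e i) * f (restrict e I) (e i)) -
    (\<Sum>i\<in>I. w (e (n + i)) * f (restrict e I) (e (n + i)))" for e
  have s_meas[measurable]: "s \<in> borel_measurable \<Omega>"
  proof -
    have "(\<lambda>e. w (e i) * f (restrict e I) (e i)) \<in> borel_measurable \<Omega>" if "i \<in> {1..2*n}" for i
    proof -
      note comp[OF that, measurable]
      have "(\<lambda>e. case_prod f (restrict e I, e i)) \<in> borel_measurable \<Omega>" by measurable
      then show ?thesis by simp
    qed
    then show ?thesis unfolding s_def I_def by measurable
  qed
  define E where "E = {e \<in> space \<Omega>. n * t / 2 < s e}"
  have E[measurable]: "E \<in> sets \<Omega>" unfolding E_def by measurable
  define bad where "bad = {d \<in> space D.
    (\<Sum>i\<in>I. w (d i) * f d (d i)) - n * (\<integral>x. w x * f d x \<partial>P) \<ge> n * t}"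
  have bad[measurable]: "bad \<in> sets D"
  proof -
    have "(\<lambda>d. w (d i) * f d (d i)) \<in> borel_measurable D" if "i \<in> I" for i
    proof -
      have [measurable]: "(\<lambda>d. d i) \<in> D \<rightarrow>\<^sub>M P"
        unfolding D_def using that by (rule measurable_component_singleton)
      have "(\<lambda>d. case_prod f (d, d i)) \<in> borel_measurable D" by measurable
      then show ?thesis by simp
    qed
    then have [measurable]: "(\<lambda>d. \<Sum>i\<in>I. w (d i) * f d (d i)) \<in> borel_measurable D"
      by (rule borel_measurable_sum)
    show ?thesis unfolding bad_def by measurable
  qed
  have step1: "measure D bad \<le> 2 * measure \<Omega> E"
  proof -
    \<comment> \<open>For a bad \<open>d\<close> the ghost sum is within n t / 2 of its mean with
      probability at least 1/2, by Hoeffding's bound and \<open>large\<close>. The difference of the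
      two sums then still exceeds n t / 2.\<close>
    have "indicator bad d \<le> 2 * (\<integral>\<^sup>+d'. indicator E (merge I J (d, d')) \<partial>D')" if d: "d \<in> space D" for d
    proof (cases "d \<in> bad")
      case True
      define h where "h x = w x * f d x" for x
      define m where "m = (\<integral>x. h x \<partial>P)"
      have [measurable]: "h \<in> borel_measurable P" unfolding h_def using d by measurable
      define T where "T = {d' \<in> space D'. \<bar>(\<Sum>j\<in>J. h (d' j)) - (\<Sum>j\<in>J. \<integral>x. h x \<partial>P)\<bar> \<ge> n * t / 2}"
      have "measure D' T \<le> 2 * exp (- (n * t / 2)\<^sup>2 / (2 * card J * c\<^sup>2))"
        unfolding T_def D'_def
      proof (rule Hoeffding_PiM)
        show "\<bar>h x\<bar> \<le> c" if "x \<in> space P" for x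
          using mult_mono[OF wc[OF that] f1[OF d that]] c by (simp add: h_def abs_mult)
      qed (use IJ ne c t P in auto)
      also have "- (n * t / 2)\<^sup>2 / (2 * card J * c\<^sup>2) = - (n * t\<^sup>2 / (8 * c\<^sup>2))"
        using n by (simp add: cards power2_eq_square)
      also have "2 * exp (- (n * t\<^sup>2 / (8 * c\<^sup>2))) \<le> 1 / 2"
        using large by (simp add: exp_minus field_simps)
      finally have T_le: "measure D' T \<le> 1 / 2" .
      have [measurable]: "T \<in> sets D'"
      proof -
        have "(\<lambda>d'. h (d' j)) \<in> borel_measurable D'" if "j \<in> J" for j
          unfolding D'_def using that by measurable
        then have [measurable]: "(\<lambda>d'. \<Sum>j\<in>J. h (d' j)) \<in> borel_measurable D'"
          by (rule borel_measurable_sum)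
        show ?thesis unfolding T_def by measurable
      qed
      have "1 / 2 \<le> measure D' (space D' - T)"
        using T_le by (subst D'.prob_compl) auto
      then have "ennreal 1 \<le> ennreal (2 * measure D' (space D' - T))"
        by (intro ennreal_leI) auto
      also have "\<dots> = 2 * emeasure D' (space D' - T)"
        by (simp add: ennreal_mult D'.emeasure_eq_measure)
      also have "\<dots> = 2 * (\<integral>\<^sup>+d'. indicator (space D' - T) d' \<partial>D')"
        by simp
      also have "\<dots> \<le> 2 * (\<integral>\<^sup>+d'. indicator E (merge I J (d, d')) \<partial>D')"
      proof (intro mult_left_mono nn_integral_mono)
        fix d' assume d': "d' \<in> space D'"
        show "indicator (space D' - T) d' \<le> (indicator E (merge I J (d, d')) :: ennreal)"
        proof (cases "d' \<in> T")
          case False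
          define e where "e = merge I J (d, d')"
          have e: "e \<in> space \<Omega>" "restrict e I = d"
            using d d' IJ unfolding e_def \<Omega>_def IJ_un[symmetric] D_def D'_def
            by (auto simp: space_PiM PiE_iff merge_def extensional_def fun_eq_iff)
          have eI: "e i = d i" "e (n + i) = d' (n + i)" if "i \<in> I" for i
            using that by (auto simp: e_def merge_def I_def J_def)
          have J_sum: "(\<Sum>j\<in>J. h (d' j)) = (\<Sum>i\<in>I. h (d' (n + i)))"
            using sum.shift_bounds_cl_nat_ivl[of "\<lambda>j. h (d' j)" 1 n n]
            by (simp add: J_def I_def add.commute mult_2)
          have "(\<Sum>j\<in>J. h (d' j)) < n * m + n * t / 2"
            proof -
            have "\<bar>(\<Sum>j\<in>J. h (d' j)) - n * m\<bar> < n * t / 2"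
              using False d' by (simp add: T_def cards m_def not_le)
            then show ?thesis by linarith
          qed
          moreover have "n * t \<le> (\<Sum>i\<in>I. h (d i)) - n * m"
            using True by (simp add: bad_def h_def m_def)
          moreover have "s e = (\<Sum>i\<in>I. h (d i)) - (\<Sum>j\<in>J. h (d' j))"
            unfolding s_def J_sum by (simp add: e eI h_def)
          ultimately have "e \<in> E" using e by (simp add: E_def)
          then show ?thesis by (simp add: e_def indicator_def)
        qed simp
      qed auto
      finally show ?thesis using True by simp
    qed simp
    then have "(\<integral>\<^sup>+d. indicator bad d \<partial>D) \<le> (\<integral>\<^sup>+d. 2 * (\<integral>\<^sup>+d'. indicator E (merge I J (d, d')) \<partial>D') \<partial>D)"
      by (intro nn_integral_mono)
    also have "\<dots> = 2 * (\<integral>\<^sup>+d. (\<integral>\<^sup>+d'. indicator E (merge I J (d, d')) \<partial>D') \<partial>D)"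
    proof (rule nn_integral_cmult)
      have [measurable]: "merge I J \<in> D \<Otimes>\<^sub>M D' \<rightarrow>\<^sub>M \<Omega>"
        unfolding D_def D'_def \<Omega>_def IJ_un[symmetric] by (rule measurable_merge)
      show "(\<lambda>d. \<integral>\<^sup>+d'. indicator E (merge I J (d, d')) \<partial>D') \<in> borel_measurable D"
        by measurable
    qed
    also have "(\<integral>\<^sup>+d. (\<integral>\<^sup>+d'. indicator E (merge I J (d, d')) \<partial>D') \<partial>D) = (\<integral>\<^sup>+e. indicator E e \<partial>\<Omega>)"
      unfolding D_def D'_def \<Omega>_def IJ_un[symmetric]
      by (rule PS.product_nn_integral_fold[symmetric])
        (use IJ E in \<open>auto simp: \<Omega>_def IJ_un\<close>)
    finally have "emeasure D bad \<le> 2 * emeasure \<Omega> E" by simp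
    also have "\<dots> = ennreal (2 * measure \<Omega> E)"
      by (simp add: \<Omega>.emeasure_eq_measure ennreal_mult)
    finally show ?thesis by (simp add: D.emeasure_eq_measure)
  qed
  \<comment> \<open>\<open>swap H\<close> exchanges \<open>i\<close> and \<open>n + i\<close> for
    \<open>i\<close> in \<open>H\<close>; as a permutation of coordinates it preserves the law of
    the double sample. The 2^n choices of \<open>H\<close> play the role of random signs.\<close>
  define swap where "swap H k = (if k \<in> H then n + k else if n < k \<and> k - n \<in> H then k - n else k)" for H and k :: nat
  define sw where "sw H e = (\<lambda>k\<in>{1..2*n}. e (swap H k))" for H and e :: "nat \<Rightarrow> 'a"
  have swap: "inj_on (swap H) {1..2*n}" "swap H \<in> {1..2*n} \<rightarrow> {1..2*n}" if "H \<subseteq> I" for H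
  proof -
    have H: "1 \<le> k \<and> k \<le> n" if "k \<in> H" for k using that \<open>H \<subseteq> I\<close> by (auto simp: I_def)
    show "inj_on (swap H) {1..2*n}"
    proof (rule inj_onI)
      fix x y assume "swap H x = swap H y"
      then show "x = y"
        using H[of x] H[of y] H[of "x - n"] H[of "y - n"] by (auto simp: swap_def split: if_splits)
    qed
    show "swap H \<in> {1..2*n} \<rightarrow> {1..2*n}"
    proof
      fix x assume "x \<in> {1..2*n}"
      then show "swap H x \<in> {1..2*n}"
        using H[of x] H[of "x - n"] by (auto simp: swap_def)
    qed
  qed
  have sw_meas[measurable]: "sw H \<in> \<Omega> \<rightarrow>\<^sub>M \<Omega>" if "H \<subseteq> I" for H
  proof -
    have "(\<lambda>e. e (swap H k)) \<in> \<Omega> \<rightarrow>\<^sub>M P" if "k \<in> {1..2*n}" for k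
      using swap[OF \<open>H \<subseteq> I\<close>] that by (intro comp) auto
    then have "(\<lambda>e. \<lambda>k\<in>{1..2*n}. e (swap H k)) \<in> \<Omega> \<rightarrow>\<^sub>M PiM {1..2*n} (\<lambda>_. P)"
      by (rule measurable_restrict)
    then show ?thesis by (simp add: sw_def[abs_def] \<Omega>_def)
  qed
  have sw_law: "emeasure \<Omega> {e \<in> space \<Omega>. sw H e \<in> E} = emeasure \<Omega> E" if "H \<subseteq> I" for H
  proof -
    have "distr \<Omega> \<Omega> (sw H) = \<Omega>"
      unfolding \<Omega>_def sw_def[abs_def] by (rule distr_PiM_reindex) (use swap[OF that] P in auto)
    then have "emeasure \<Omega> E = emeasure (distr \<Omega> \<Omega> (sw H)) E" by simp
    also have "\<dots> = emeasure \<Omega> {e \<in> space \<Omega>. sw H e \<in> E}"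
      using sw_meas[OF that] by (subst emeasure_distr) (auto intro!: arg_cong[where f = "emeasure _"])
    finally show ?thesis by simp
  qed
  define b where "b = exp (- n * t\<^sup>2 / (32 * c\<^sup>2))"
  \<comment> \<open>Swapping changes the first half and hence the selected function, so the signs
    cannot be averaged for one function. But only its values at the fixed 2 n points matter, and
    these form one of at most N^2 pairs of traces; once a pair is fixed, the sum no longer depends
    on the selecting sample.\<close>
  have count: "real (card {H \<in> Pow I. sw H e \<in> E}) \<le> N\<^sup>2 * (2 ^ n * b)" if e: "e \<in> space \<Omega>" for e
  proof -
    define V where "V x = (\<lambda>d. \<lambda>i\<in>I. f d (x i)) ` space D" for x
    define y where "y i = e (n + i)" for i
    have eP: "e \<in> I \<rightarrow> space P" "y \<in> I \<rightarrow> space P"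
      using \<Omega>comp[OF e] by (auto simp: I_def y_def)
    have V: "finite (V e)" "finite (V y)" "card (V e) \<le> N" "card (V y) \<le> N"
      using traces[OF eP(1)] traces[OF eP(2)] by (auto simp: V_def)
    define cc where "cc v v' i = w (e i) * v i - w (y i) * v' i" for v v' :: "nat \<Rightarrow> real" and i
    define S where "S = (\<lambda>(v, v'). {H \<in> Pow I. (\<Sum>i\<in>I - H. cc v v' i) - (\<Sum>i\<in>H. cc v v' i) > n * t / 2})"
    have "{H \<in> Pow I. sw H e \<in> E} \<subseteq> (\<Union>p\<in>V e \<times> V y. S p)"
    proof safe
      fix H assume H: "H \<subseteq> I" and "sw H e \<in> E"
      define d where "d = restrict (sw H e) I"
      have sw_space: "sw H e \<in> space \<Omega>" using \<open>sw H e \<in> E\<close> by (simp add: E_def)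
      have d: "d \<in> space D" using measurable_space[OF res sw_space] by (simp add: d_def)
      define v where "v = (\<lambda>i\<in>I. f d (e i))"
      define v' where "v' = (\<lambda>i\<in>I. f d (y i))"
      have v: "v \<in> V e" "v' \<in> V y" using d by (auto simp: V_def v_def v'_def)
      have I12: "i \<in> {1..2*n}" "n + i \<in> {1..2*n}" if "i \<in> I" for i
        using that by (auto simp: I_def)
      have sw1: "sw H e i = y i" "sw H e (n + i) = e i" if "i \<in> H" for i
        using that H I12[of i] by (auto simp: sw_def swap_def y_def I_def)
      have sw2: "sw H e i = e i" "sw H e (n + i) = y i" if "i \<in> I - H" for i
        using that I12[of i] H by (auto simp: sw_def swap_def y_def I_def)
      have "s (sw H e) = (\<Sum>i\<in>I. w (sw H e i) * f d (sw H e i) - w (sw H e (n + i)) * f d (sw H e (n + i)))"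
        by (simp add: s_def d_def sum_subtractf)
      also have "\<dots> = (\<Sum>i\<in>I - H. w (sw H e i) * f d (sw H e i) - w (sw H e (n + i)) * f d (sw H e (n + i)))
          + (\<Sum>i\<in>H. w (sw H e i) * f d (sw H e i) - w (sw H e (n + i)) * f d (sw H e (n + i)))"
        using H IJ by (intro sum.subset_diff) auto
      also have "(\<Sum>i\<in>I - H. w (sw H e i) * f d (sw H e i) - w (sw H e (n + i)) * f d (sw H e (n + i))) =
          (\<Sum>i\<in>I - H. cc v v' i)"
        by (intro sum.cong refl) (simp add: sw2 cc_def v_def v'_def)
      also have "(\<Sum>i\<in>H. w (sw H e i) * f d (sw H e i) - w (sw H e (n + i)) * f d (sw H e (n + i))) =
          (\<Sum>i\<in>H. - cc v v' i)"
        using H by (intro sum.cong refl) (auto simp: sw1 cc_def v_def v'_def subset_iff)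
      finally have "H \<in> S (v, v')" using H \<open>sw H e \<in> E\<close> by (simp add: S_def E_def sum_negf)
      then show "H \<in> (\<Union>p\<in>V e \<times> V y. S p)" using v by blast
    qed
    then have "card {H \<in> Pow I. sw H e \<in> E} \<le> card (\<Union>p\<in>V e \<times> V y. S p)"
      using V IJ by (intro card_mono) (auto simp: S_def)
    also have "\<dots> \<le> (\<Sum>p\<in>V e \<times> V y. card (S p))"
      using V by (intro card_UN_le) auto
    finally have "real (card {H \<in> Pow I. sw H e \<in> E}) \<le> (\<Sum>p\<in>V e \<times> V y. real (card (S p)))"
      by (simp flip: of_nat_sum)
    also have "\<dots> \<le> (\<Sum>p\<in>V e \<times> V y. 2 ^ n * b)"
    proof (rule sum_mono)
      fix p assume "p \<in> V e \<times> V y"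
      then obtain d d' where d: "d \<in> space D" "d' \<in> space D"
        and p: "p = ((\<lambda>i\<in>I. f d (e i)), (\<lambda>i\<in>I. f d' (y i)))"
        by (auto simp: V_def)
      define v where "v = (\<lambda>i\<in>I. f d (e i))"
      define v' where "v' = (\<lambda>i\<in>I. f d' (y i))"
      \<comment> \<open>The terms are bounded by 2 c and the threshold is n t / 2, whence the 32 in
        the exponent.\<close>
      have "real (card {H \<in> Pow I. (\<Sum>i\<in>I - H. cc v v' i) - (\<Sum>i\<in>H. cc v v' i) > n * t / 2})
          \<le> 2 ^ card I * exp (- (n * t / 2)\<^sup>2 / (2 * card I * (2 * c)\<^sup>2))"
      proof (rule card_sign_sets_le)
        fix i assume i: "i \<in> I"
        have "\<bar>w (e i) * v i\<bar> \<le> c" "\<bar>w (y i) * v' i\<bar> \<le> c"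
          using mult_mono[OF wc f1, of "e i" d "e i"] mult_mono[OF wc f1, of "y i" d' "y i"] d eP i c
          by (auto simp: v_def v'_def abs_mult)
        then show "\<bar>cc v v' i\<bar> \<le> 2 * c" unfolding cc_def by linarith
      qed (use c t IJ ne in auto)
      also have "- (n * t / 2)\<^sup>2 / (2 * card I * (2 * c)\<^sup>2) = - n * t\<^sup>2 / (32 * c\<^sup>2)"
        using n by (simp add: cards power2_eq_square)
      finally have "real (card (S (v, v'))) \<le> 2 ^ n * b"
        by (simp add: S_def b_def cards)
      then show "real (card (S p)) \<le> 2 ^ n * b"
        by (simp add: p v_def v'_def)
    qed
    also have "\<dots> = real (card (V e) * card (V y)) * (2 ^ n * b)"
      by (simp add: card_cartesian_product)
    also have "\<dots> \<le> N\<^sup>2 * (2 ^ n * b)"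
      using V by (intro mult_right_mono of_nat_mono) (auto simp: power2_eq_square b_def intro!: mult_mono)
    finally show ?thesis .
  qed
  \<comment> \<open>All 2^n swapped events have the probability of \<open>E\<close>; exchanging sum
    and integral leaves the count for a fixed double sample.\<close>
  have "2 ^ n * emeasure \<Omega> E = (\<Sum>H\<in>Pow I. emeasure \<Omega> E)"
    using IJ by (simp add: card_Pow cards)
  also have "\<dots> = (\<Sum>H\<in>Pow I. emeasure \<Omega> {e \<in> space \<Omega>. sw H e \<in> E})"
    by (intro sum.cong) (auto simp: sw_law)
  also have "\<dots> = (\<Sum>H\<in>Pow I. \<integral>\<^sup>+e. indicator {e \<in> space \<Omega>. sw H e \<in> E} e \<partial>\<Omega>)"
  proof (rule sum.cong[OF refl])
    fix H assume "H \<in> Pow I"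
    then have [measurable]: "sw H \<in> \<Omega> \<rightarrow>\<^sub>M \<Omega>" by (intro sw_meas) auto
    show "emeasure \<Omega> {e \<in> space \<Omega>. sw H e \<in> E} = (\<integral>\<^sup>+e. indicator {e \<in> space \<Omega>. sw H e \<in> E} e \<partial>\<Omega>)"
      by simp
  qed
  also have "\<dots> = (\<integral>\<^sup>+e. (\<Sum>H\<in>Pow I. indicator {e \<in> space \<Omega>. sw H e \<in> E} e) \<partial>\<Omega>)"
  proof (rule nn_integral_sum[symmetric])
    fix H assume "H \<in> Pow I"
    then have [measurable]: "sw H \<in> \<Omega> \<rightarrow>\<^sub>M \<Omega>" by (intro sw_meas) auto
    show "(indicator {e \<in> space \<Omega>. sw H e \<in> E} :: _ \<Rightarrow> ennreal) \<in> borel_measurable \<Omega>" by measurable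
  qed
  also have "\<dots> \<le> (\<integral>\<^sup>+e. ennreal (N\<^sup>2 * (2 ^ n * b)) \<partial>\<Omega>)"
  proof (rule nn_integral_mono)
    fix e assume e: "e \<in> space \<Omega>"
    have "(\<Sum>H\<in>Pow I. indicator {e \<in> space \<Omega>. sw H e \<in> E} e) = (\<Sum>H\<in>Pow I. if sw H e \<in> E then 1 else 0 :: ennreal)"
      using e by (intro sum.cong) (auto simp: indicator_def)
    also have "\<dots> = of_nat (card {H \<in> Pow I. sw H e \<in> E})"
      using IJ by (simp add: sum.If_cases Int_def)
    also have "\<dots> = ennreal (real (card {H \<in> Pow I. sw H e \<in> E}))"
      by (simp add: ennreal_of_nat_eq_real_of_nat)
    also have "\<dots> \<le> ennreal (N\<^sup>2 * (2 ^ n * b))"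
      using count[OF e] by (rule ennreal_leI)
    finally show "(\<Sum>H\<in>Pow I. indicator {e \<in> space \<Omega>. sw H e \<in> E} e) \<le> ennreal (N\<^sup>2 * (2 ^ n * b))" .
  qed
  also have "\<dots> = ennreal (N\<^sup>2 * (2 ^ n * b))" by (simp add: \<Omega>.emeasure_space_1)
  finally have "ennreal (2 ^ n * measure \<Omega> E) \<le> ennreal (2 ^ n * (N\<^sup>2 * b))"
    by (simp add: \<Omega>.emeasure_eq_measure ennreal_mult ennreal_power mult.left_commute flip: ennreal_numeral)
  then have "2 ^ n * measure \<Omega> E \<le> 2 ^ n * (N\<^sup>2 * b)"
    by (subst (asm) ennreal_le_iff) (auto simp: b_def)
  then have "measure \<Omega> E \<le> N\<^sup>2 * b" by simp
  with step1 have "measure D bad \<le> 2 * N\<^sup>2 * b" by simp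
  then show ?le by (simp add: bad_def D_def I_def b_def)
  show ?meas using bad by (simp add: bad_def D_def I_def)
qed

section \<open>Generated partitions and cell means\<close>

lemma finite_gen_partition: "finite \<C> \<Longrightarrow> finite (gen_partition \<C>)"
proof -
  assume "finite \<C>"
  have "gen_partition \<C> \<subseteq> (\<lambda>T. {x \<in> \<Union>\<C>. activation \<C> x = T}) ` Pow \<C>"
    by (auto simp: gen_partition_def activation_def)
  with \<open>finite \<C>\<close> show ?thesis by (metis finite_Pow_iff finite_imageI finite_subset)
qed

lemma Union_gen_partition: "\<Union>(gen_partition \<C>) = \<Union>\<C>"
  by (auto simp: gen_partition_def)

lemma disjoint_gen_partition: "disjoint (gen_partition \<C>)"
  by (auto simp: gen_partition_def disjoint_def)

lemma gen_partition_nonempty: "A \<in> gen_partition \<C> \<Longrightarrow> A \<noteq> {}"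
  by (auto simp: gen_partition_def)

lemma gen_partition_subset_iff:
  assumes "A \<in> gen_partition \<C>" "x \<in> A" "r \<in> \<C>"
  shows "A \<subseteq> r \<longleftrightarrow> x \<in> r"
  using assms by (auto simp: gen_partition_def activation_def)

lemma sum_indicator_disjoint:
  fixes v :: "'x set \<Rightarrow> real"
  assumes "finite \<P>" "disjoint \<P>" "A \<in> \<P>" "x \<in> A"
  shows "(\<Sum>B\<in>\<P>. v B * indicator B x) = v A"
proof -
  have "v B * indicator B x = (if B = A then v A else 0)" if "B \<in> \<P>" for B
    using assms that by (auto simp: disjoint_def indicator_def)
  then have "(\<Sum>B\<in>\<P>. v B * indicator B x) = (\<Sum>B\<in>\<P>. if B = A then v A else 0)"
    by (intro sum.cong) auto
  then show ?thesis using assms by simp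
qed

lemma sum_indicator_disjoint_zero:
  fixes v :: "'x set \<Rightarrow> real"
  assumes "x \<notin> \<Union>\<P>"
  shows "(\<Sum>B\<in>\<P>. v B * indicator B x) = 0"
  using assms by (intro sum.neutral) auto

text \<open>Double counting. A cell inside \<open>\<Union>R\<close> lies in at least the minimal
  redundancy many sets of \<open>R\<close>, and each of them bounds \<open>T A\<close> by its own
  error on the cell; summing over sets first, a sample point is charged by at most the maximal
  redundancy many sets. \<open>T\<close> is abstract because the cell error itself satisfies the
  hypothesis only after a noise term is subtracted.\<close>

lemma covering_approximation:
  fixes x :: "nat \<Rightarrow> 'x" and u :: "nat \<Rightarrow> real" and \<theta> T :: "'x set \<Rightarrow> real" and \<kappa> :: real
  assumes C: "finite \<C>" and R: "R \<subseteq> \<C>" "{} \<notin> R" and \<kappa>: "\<kappa> \<ge> 0"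
    and approx: "\<And>r. r \<in> R \<Longrightarrow>
      (\<Sum>i=1..n. (\<theta> r - u i)\<^sup>2 * indicator r (x i)) \<le> \<kappa> * (\<Sum>i=1..n. indicator r (x i))"
    and T0: "\<And>A. A \<in> gen_partition \<C> \<Longrightarrow> T A \<ge> 0"
    and T: "\<And>A r. A \<in> gen_partition \<C> \<Longrightarrow> r \<in> R \<Longrightarrow> A \<subseteq> r \<Longrightarrow>
      T A \<le> (\<Sum>i=1..n. (\<theta> r - u i)\<^sup>2 * indicator A (x i))"
  shows "(\<Sum>A\<in>{A \<in> gen_partition \<C>. A \<subseteq> \<Union>R}. T A) \<le> n * \<kappa> * redundancy_ratio R"
proof (cases "R = {}")
  case True
  then show ?thesis using gen_partition_nonempty
    by (auto simp: redundancy_ratio_def intro!: sum_nonpos)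
next
  case False
  define P where "P = gen_partition \<C>"
  define m where "m = min_redundancy R"
  define M where "M = max_redundancy R"
  have finR: "finite R" using C R finite_subset by blast
  have finP: "finite P" unfolding P_def by (rule finite_gen_partition) (rule C)
  have fin_act: "finite ((\<lambda>x. card (activation R x)) ` \<Union>R)"
    by (rule finite_subset[of _ "{..card R}"]) (auto simp: activation_def finR card_mono)
  \<comment> \<open>Otherwise \<open>Min\<close> and \<open>Max\<close> would range over the empty
    set.\<close>
  have ne: "\<Union>R \<noteq> {}" using False R by auto
  have m_le: "m \<le> card (activation R y)" if "y \<in> \<Union>R" for y
    unfolding m_def min_redundancy_def using fin_act that by (intro Min_le) auto
  have M_ge: "card (activation R y) \<le> M" for y
  proof (cases "y \<in> \<Union>R")
    case True
    then show ?thesis unfolding M_def max_redundancy_def using fin_act by (intro Max_ge) auto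
  next
    case False
    then have "activation R y = {}" by (auto simp: activation_def)
    then show ?thesis by simp
  qed
  have "m \<in> (\<lambda>x. card (activation R x)) ` \<Union>R"
    unfolding m_def min_redundancy_def using fin_act ne by (intro Min_in) auto
  then have m_pos: "m > 0"
    using finR by (auto simp: activation_def card_gt_0_iff)
  define e where "e r i = (\<theta> r - u i)\<^sup>2" for r i
  have e0: "e r i \<ge> 0" for r i by (simp add: e_def)
  define PR where "PR = {A \<in> P. A \<subseteq> \<Union>R}"
  have finPR: "finite PR" using finP by (simp add: PR_def)
  have cell: "m * T A \<le> (\<Sum>r\<in>{r \<in> R. A \<subseteq> r}. \<Sum>i=1..n. e r i * indicator A (x i))" if A: "A \<in> PR" for A
  proof -
    obtain y where y: "y \<in> A" using A gen_partition_nonempty[of A \<C>] by (auto simp: PR_def P_def)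
    \<comment> \<open>The cells are those of \<open>\<C>\<close>, hence finer than those of
      \<open>R\<close>, so the sets of \<open>R\<close> containing one point of the cell contain all
      of it.\<close>
    have act: "activation R y = {r \<in> R. A \<subseteq> r}"
      using gen_partition_subset_iff[OF _ y] A R by (auto simp: activation_def PR_def P_def)
    have "m * T A \<le> card {r \<in> R. A \<subseteq> r} * T A"
      using m_le[of y] A y T0[of A] act by (intro mult_right_mono) (auto simp: PR_def P_def)
    also have "\<dots> = (\<Sum>r\<in>{r \<in> R. A \<subseteq> r}. T A)" by simp
    also have "\<dots> \<le> (\<Sum>r\<in>{r \<in> R. A \<subseteq> r}. \<Sum>i=1..n. e r i * indicator A (x i))"
      unfolding e_def using A by (intro sum_mono T) (auto simp: PR_def P_def)
    finally show ?thesis .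
  qed
  have "m * (\<Sum>A\<in>PR. T A) \<le> (\<Sum>A\<in>PR. \<Sum>r\<in>{r \<in> R. A \<subseteq> r}. \<Sum>i=1..n. e r i * indicator A (x i))"
    unfolding sum_distrib_left by (intro sum_mono cell)
  also have "\<dots> = (\<Sum>r\<in>R. \<Sum>A\<in>{A \<in> PR. A \<subseteq> r}. \<Sum>i=1..n. e r i * indicator A (x i))"
    using finPR finR by (rule sum.swap_restrict)
  also have "\<dots> = (\<Sum>r\<in>R. \<Sum>i=1..n. e r i * (\<Sum>A\<in>{A \<in> PR. A \<subseteq> r}. 1 * indicator A (x i)))"
    by (intro sum.cong refl) (subst sum.swap, simp add: sum_distrib_left)
  also have "\<dots> \<le> (\<Sum>r\<in>R. \<Sum>i=1..n. e r i * indicator r (x i))"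
  proof (intro sum_mono mult_left_mono e0)
    fix r i
    have disj: "disjoint {A \<in> PR. A \<subseteq> r}"
      using disjoint_gen_partition[of \<C>] by (auto simp: disjoint_def PR_def P_def)
    show "(\<Sum>A\<in>{A \<in> PR. A \<subseteq> r}. 1 * indicator A (x i)) \<le> (indicator r (x i) :: real)"
    proof (cases "x i \<in> \<Union>{A \<in> PR. A \<subseteq> r}")
      case True
      then obtain A where "A \<in> {A \<in> PR. A \<subseteq> r}" "x i \<in> A" by blast
      then show ?thesis
        using sum_indicator_disjoint[OF _ disj, of A "x i" "\<lambda>_. 1"] finPR by auto
    next
      case False
      then show ?thesis by (subst sum_indicator_disjoint_zero) auto
    qed
  qed
  also have "\<dots> \<le> (\<Sum>r\<in>R. \<kappa> * (\<Sum>i=1..n. indicator r (x i)))"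
    unfolding e_def by (intro sum_mono approx)
  also have "\<dots> = \<kappa> * (\<Sum>i=1..n. \<Sum>r\<in>R. indicator r (x i))"
    by (subst sum.swap) (simp add: sum_distrib_left)
  also have "(\<Sum>i=1..n. \<Sum>r\<in>R. indicator r (x i)) \<le> (\<Sum>i=1..n. real M)"
  proof (rule sum_mono)
    fix i
    have "(\<Sum>r\<in>R. indicator r (x i)) = real (card (activation R (x i)))"
      using finR by (simp add: activation_def indicator_def sum.If_cases Int_def)
    also have "\<dots> \<le> M" using M_ge by simp
    finally show "(\<Sum>r\<in>R. indicator r (x i)) \<le> real M" .
  qed
  finally have "m * (\<Sum>A\<in>PR. T A) \<le> \<kappa> * (n * M)"
    using \<kappa> by (simp add: mult_left_mono)
  then have "(\<Sum>A\<in>PR. T A) \<le> n * \<kappa> * (M / m)"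
    using m_pos by (simp add: field_simps)
  then show ?thesis using False by (simp add: redundancy_ratio_def PR_def P_def M_def m_def)
qed

text \<open>In this form the identity survives for a set without sample points, where
  \<open>emp_cond_exp\<close> is 0 / 0 = 0 and both sides vanish.\<close>

lemma emp_cond_exp_times_count:
  "emp_cond_exp n d h A * (\<Sum>i=1..n. indicator A (fst (d i))) = (\<Sum>i=1..n. h (snd (d i)) * indicator A (fst (d i)))"
proof (cases "(\<Sum>i=1..n. indicator A (fst (d i))) = (0::real)")
  case True
  then have "\<forall>i\<in>{1..n}. indicator A (fst (d i)) = (0::real)"
    by (subst (asm) sum_nonneg_eq_0_iff) auto
  then show ?thesis using True by simp
qed (simp add: emp_cond_exp_def)

lemma abs_emp_cond_exp_le:
  assumes y: "\<And>i. i \<in> {1..n} \<Longrightarrow> \<bar>snd (d i)\<bar> \<le> L" and "L \<ge> 0"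
  shows "\<bar>emp_cond_exp n d (\<lambda>y. y) A\<bar> \<le> L"
proof (cases "(\<Sum>i=1..n. indicator A (fst (d i))) = (0::real)")
  case True
  then show ?thesis using \<open>L \<ge> 0\<close> by (simp add: emp_cond_exp_def)
next
  case False
  have nonneg: "(\<Sum>i=1..n. indicator A (fst (d i))) \<ge> (0::real)" by (intro sum_nonneg) auto
  have "\<bar>\<Sum>i=1..n. snd (d i) * indicator A (fst (d i))\<bar> \<le> (\<Sum>i=1..n. \<bar>snd (d i) * indicator A (fst (d i))\<bar>)"
    by (rule sum_abs)
  also have "\<dots> \<le> (\<Sum>i=1..n. L * indicator A (fst (d i)))"
    using y by (intro sum_mono) (auto simp: indicator_def)
  also have "\<dots> = L * (\<Sum>i=1..n. indicator A (fst (d i)))" by (simp add: sum_distrib_left)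
  finally show ?thesis
    using False nonneg by (simp add: emp_cond_exp_def abs_divide field_simps)
qed

text \<open>The mean \<open>b\<close> minimises the squares against \<open>Y\<close>. Against
  \<open>g\<close>, with N points and noise sum Z on the cell, the difference of the squares is N
  (\<theta> - b)^2 + 2 (\<theta> - b) Z; the first term is dropped, and |\<theta> - b| \<le> 2 L
  gives the factor 4 L.\<close>

lemma emp_cell_least_squares:
  fixes \<theta> L :: real and g :: "real ^ 'd \<Rightarrow> real" and d :: "'d::finite data"
  defines "z \<equiv> \<lambda>i. snd (d i) - g (fst (d i))"
  assumes y: "\<And>i. i \<in> {1..n} \<Longrightarrow> \<bar>snd (d i)\<bar> \<le> L" and L: "L \<ge> 0" and \<theta>: "\<bar>\<theta>\<bar> \<le> L"
  shows "(\<Sum>i=1..n. (emp_cond_exp n d (\<lambda>y. y) A - g (fst (d i)))\<^sup>2 * indicator A (fst (d i)))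
    \<le> (\<Sum>i=1..n. (\<theta> - g (fst (d i)))\<^sup>2 * indicator A (fst (d i)))
      + 4 * L * \<bar>\<Sum>i=1..n. z i * indicator A (fst (d i))\<bar>"
proof -
  define b where "b = emp_cond_exp n d (\<lambda>y. y) A"
  define c where "c i = (indicator A (fst (d i)) :: real)" for i
  define N where "N = (\<Sum>i=1..n. c i)"
  define Z where "Z = (\<Sum>i=1..n. z i * c i)"
  have N: "N \<ge> 0" unfolding N_def c_def by (intro sum_nonneg) auto
  have b: "b * N = (\<Sum>i=1..n. snd (d i) * c i)"
    using emp_cond_exp_times_count[of n d "\<lambda>y. y" A] by (simp add: b_def N_def c_def)
  have "(\<Sum>i=1..n. (\<theta> - g (fst (d i)))\<^sup>2 * c i) - (\<Sum>i=1..n. (b - g (fst (d i)))\<^sup>2 * c i) =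
      (\<Sum>i=1..n. (\<theta>\<^sup>2 - b\<^sup>2) * c i + 2 * (\<theta> - b) * (z i * c i) - 2 * (\<theta> - b) * (snd (d i) * c i))"
    unfolding sum_subtractf[symmetric]
    by (intro sum.cong refl) (simp add: z_def power2_eq_square algebra_simps)
  also have "\<dots> = (\<theta>\<^sup>2 - b\<^sup>2) * N + 2 * (\<theta> - b) * Z - 2 * (\<theta> - b) * (b * N)"
    unfolding b by (simp add: sum.distrib sum_subtractf N_def Z_def sum_distrib_left)
  also have "\<dots> = (\<theta> - b)\<^sup>2 * N + 2 * (\<theta> - b) * Z"
    by (simp add: power2_eq_square algebra_simps)
  also have "\<dots> \<ge> - (4 * L * \<bar>Z\<bar>)"
  proof -
    have "\<bar>b\<bar> \<le> L" unfolding b_def by (rule abs_emp_cond_exp_le) (use y L in auto)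
    then have "\<bar>\<theta> - b\<bar> \<le> 2 * L" using \<theta> by linarith
    then have "\<bar>2 * (\<theta> - b)\<bar> \<le> 4 * L" by simp
    then have "\<bar>2 * (\<theta> - b) * Z\<bar> \<le> 4 * L * \<bar>Z\<bar>"
      unfolding abs_mult[of "2 * (\<theta> - b)"] by (intro mult_right_mono) auto
    moreover have "(\<theta> - b)\<^sup>2 * N \<ge> 0" using N by simp
    ultimately show ?thesis by linarith
  qed
  finally show ?thesis by (simp add: b_def c_def Z_def)
qed

text \<open>With y = g + z one has (b - g)^2 = (y - b)^2 + 2 b z - 2 g z - z^2, where
  \<open>b\<close> is the empirical mean on \<open>r\<close>. The sample-dependent \<open>b\<close>
  is a mere factor of the sum of z, so all noise averages involve fixed functions; |b| \<le> L and
  the coefficients 2 and 1 of the other two give \<open>2 * L + 3\<close>.\<close>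

lemma emp_cell_approximation:
  fixes B L \<kappa> v s2 :: real and g :: "real ^ 'd \<Rightarrow> real" and d :: "'d::finite data"
  defines "z \<equiv> \<lambda>i. snd (d i) - g (fst (d i))"
  assumes y: "\<And>i. i \<in> {1..n} \<Longrightarrow> \<bar>snd (d i)\<bar> \<le> L" and L: "L \<ge> 0"
    and var: "emp_cond_var n d r \<le> s2 + \<kappa>"
    and B: "\<bar>\<Sum>i=1..n. z i * indicator r (fst (d i))\<bar> \<le> B"
      "\<bar>\<Sum>i=1..n. g (fst (d i)) * z i * indicator r (fst (d i))\<bar> \<le> B"
      "\<bar>\<Sum>i=1..n. ((z i)\<^sup>2 - v) * indicator r (fst (d i))\<bar> \<le> B"
  shows "(\<Sum>i=1..n. (emp_cond_exp n d (\<lambda>y. y) r - g (fst (d i)))\<^sup>2 * indicator r (fst (d i)))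
    \<le> (\<kappa> + \<bar>s2 - v\<bar>) * (\<Sum>i=1..n. indicator r (fst (d i))) + (2 * L + 3) * B"
proof -
  define b where "b = emp_cond_exp n d (\<lambda>y. y) r"
  define c where "c i = (indicator r (fst (d i)) :: real)" for i
  define N where "N = (\<Sum>i=1..n. c i)"
  define Z1 where "Z1 = (\<Sum>i=1..n. z i * c i)"
  define Z2 where "Z2 = (\<Sum>i=1..n. g (fst (d i)) * z i * c i)"
  define Z3 where "Z3 = (\<Sum>i=1..n. ((z i)\<^sup>2 - v) * c i)"
  have N: "N \<ge> 0" unfolding N_def c_def by (intro sum_nonneg) auto
  have b: "b * N = (\<Sum>i=1..n. snd (d i) * c i)"
    using emp_cond_exp_times_count[of n d "\<lambda>y. y" r] by (simp add: b_def N_def c_def)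
  have V: "emp_cond_var n d r * N = (\<Sum>i=1..n. (snd (d i))\<^sup>2 * c i) - b\<^sup>2 * N"
    using emp_cond_exp_times_count[of n d "\<lambda>y. y\<^sup>2" r]
    by (simp add: emp_cond_var_def b_def[symmetric] N_def c_def left_diff_distrib)
  have "(\<Sum>i=1..n. (b - g (fst (d i)))\<^sup>2 * c i) =
      (\<Sum>i=1..n. (snd (d i))\<^sup>2 * c i + b\<^sup>2 * c i - 2 * b * (snd (d i) * c i)
        - 2 * (g (fst (d i)) * z i * c i) + 2 * b * (z i * c i) - ((z i)\<^sup>2 - v) * c i - v * c i)"
    by (intro sum.cong refl) (simp add: z_def power2_eq_square algebra_simps)
  also have "\<dots> = (\<Sum>i=1..n. (snd (d i))\<^sup>2 * c i) + b\<^sup>2 * N - 2 * b * (b * N) - 2 * Z2 + 2 * b * Z1 - Z3 - v * N"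
    unfolding b by (simp add: sum.distrib sum_subtractf N_def Z1_def Z2_def Z3_def sum_distrib_left)
  also have "\<dots> = emp_cond_var n d r * N - v * N + (2 * b * Z1 - 2 * Z2 - Z3)"
    unfolding V by (simp add: power2_eq_square algebra_simps)
  also have "\<dots> \<le> (\<kappa> + \<bar>s2 - v\<bar>) * N + (2 * L + 3) * B"
  proof -
    have bL: "\<bar>b\<bar> \<le> L" unfolding b_def by (rule abs_emp_cond_exp_le) (use y L in auto)
    have "(emp_cond_var n d r - v) * N \<le> (\<kappa> + \<bar>s2 - v\<bar>) * N"
      using var N by (intro mult_right_mono) linarith+
    moreover have "\<bar>2 * b * Z1\<bar> \<le> 2 * L * B"
      using bL B(1) L unfolding abs_mult[of "2 * b"] by (intro mult_mono) (auto simp: Z1_def c_def abs_mult)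
    moreover have "\<bar>Z2\<bar> \<le> B" "\<bar>Z3\<bar> \<le> B" using B by (simp_all add: Z2_def Z3_def c_def)
    ultimately show ?thesis by (simp add: algebra_simps)
  qed
  finally show ?thesis by (simp add: b_def c_def N_def)
qed

text \<open>
  The traces of sign functions are counted, not those of partitions: the possible groupings of the
  cells of the refinement need not be subexponential in number.
\<close>

lemma card_cell_traces:
  fixes x :: "nat \<Rightarrow> 'x" and \<V> :: "('x \<Rightarrow> real) set"
  assumes fin: "\<And>\<P>'. \<P>' \<in> \<F> \<Longrightarrow> finite \<P>'" and m: "max_cells \<F> \<le> enat m"
    and V: "\<And>v. v \<in> \<V> \<Longrightarrow> \<exists>\<P>'\<in>\<F>. \<exists>\<P>. (\<forall>A\<in>\<P>. A = \<Union>{A' \<in> \<P>'. A' \<subseteq> A}) \<and>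
      (\<forall>A\<in>\<P>. \<forall>y\<in>A. \<forall>y'\<in>A. v y = v y') \<and> (\<forall>y. y \<notin> \<Union>\<P> \<longrightarrow> v y = 0) \<and> range v \<subseteq> {-1, 0, 1}"
  shows "finite ((\<lambda>v. \<lambda>i\<in>{1..n}. v (x i)) ` \<V>)"
    and "card ((\<lambda>v. \<lambda>i\<in>{1..n}. v (x i)) ` \<V>) \<le> growth_number n \<F> * 4 ^ m"
proof -
  define X where "X = x ` {1..n}"
  define tr where "tr \<P> = (\<lambda>A. X \<inter> A) ` \<P> - {{}}" for \<P>
  \<comment> \<open>A sign function is decoded from the traces of the refining cells on which it is
    1 and those on which it is -1. These are two subsets of at most \<open>m\<close> traces, hence
    the factor 4^m.\<close>
  define dec where "dec = (\<lambda>(T, U). \<lambda>i\<in>{1..n}. if x i \<in> \<Union>T then 1 else if x i \<in> \<Union>U then -1 else 0 :: real)"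
  define W where "W = (\<Union>\<tau>\<in>tr ` \<F>. Pow \<tau> \<times> Pow \<tau>)"
  have X: "finite X" by (simp add: X_def)
  have tr_sub: "tr ` \<F> \<subseteq> Pow (Pow X)" by (auto simp: tr_def)
  then have fin_tr: "finite (tr ` \<F>)" using X by (simp add: finite_subset)
  have card_tr: "finite (tr \<P>)" "card (tr \<P>) \<le> m" if "\<P> \<in> \<F>" for \<P>
  proof -
    show "finite (tr \<P>)" using fin[OF that] by (simp add: tr_def)
    have "card (tr \<P>) \<le> card ((\<lambda>A. X \<inter> A) ` \<P>)"
      using fin[OF that] unfolding tr_def by (intro card_mono) auto
    also have "\<dots> \<le> card \<P>" using fin[OF that] by (rule card_image_le)
    also have "card \<P> \<le> m"
    proof -
      have "enat (card \<P>) \<le> max_cells \<F>" unfolding max_cells_def using that by (rule SUP_upper)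
      also note m
      finally show ?thesis by simp
    qed
    finally show "card (tr \<P>) \<le> m" .
  qed
  have sub: "(\<lambda>v. \<lambda>i\<in>{1..n}. v (x i)) ` \<V> \<subseteq> dec ` W"
  proof (rule image_subsetI)
    fix v assume "v \<in> \<V>"
    from V[OF this] obtain \<P>' \<P> where \<P>': "\<P>' \<in> \<F>"
      and *: "\<forall>A\<in>\<P>. A = \<Union>{A' \<in> \<P>'. A' \<subseteq> A}" "\<forall>A\<in>\<P>. \<forall>y\<in>A. \<forall>y'\<in>A. v y = v y'"
        "\<forall>y. y \<notin> \<Union>\<P> \<longrightarrow> v y = 0" and range: "range v \<subseteq> {-1, 0, 1}"
      by (elim bexE exE conjE)
    have ref: "\<exists>A'\<in>\<P>'. A' \<subseteq> A \<and> y \<in> A'" if "A \<in> \<P>" "y \<in> A" for A y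
    proof -
      have "y \<in> \<Union>{A' \<in> \<P>'. A' \<subseteq> A}" using bspec[OF *(1) that(1)] that(2) by (rule subst)
      then show ?thesis by blast
    qed
    have const: "v y = v y'" if "A \<in> \<P>" "y \<in> A" "y' \<in> A" for A y y' using *(2) that by blast
    have zero: "v y = 0" if "y \<notin> \<Union>\<P>" for y using *(3) that by blast
    define lev where "lev s = {T \<in> tr \<P>'. \<exists>A'\<in>\<P>'. T = X \<inter> A' \<and> (\<forall>y\<in>A'. v y = s)}" for s
    have lev: "x i \<in> \<Union>(lev s) \<longleftrightarrow> v (x i) = s" if i: "i \<in> {1..n}" and s: "s \<noteq> 0" for i s
    proof
      assume "x i \<in> \<Union>(lev s)"
      then show "v (x i) = s" by (auto simp: lev_def)
    next
      assume v: "v (x i) = s"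
      then obtain A where A: "A \<in> \<P>" "x i \<in> A" using s zero by blast
      then obtain A' where A': "A' \<in> \<P>'" "A' \<subseteq> A" "x i \<in> A'" using ref[OF A] by blast
      have xX: "x i \<in> X" using i by (simp add: X_def)
      have "\<forall>y\<in>A'. v y = s" using const[OF A(1)] A A' v by blast
      moreover have "X \<inter> A' \<in> tr \<P>'" using A' xX by (auto simp: tr_def)
      ultimately have "X \<inter> A' \<in> lev s" using A' by (simp add: lev_def) blast
      then show "x i \<in> \<Union>(lev s)" using A' xX by blast
    qed
    have "(\<lambda>i\<in>{1..n}. v (x i)) = dec (lev 1, lev (-1))"
    proof
      fix i
      have "v (x i) \<in> {-1, 0, 1}" using range by blast
      then show "(\<lambda>i\<in>{1..n}. v (x i)) i = dec (lev 1, lev (-1)) i"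
        using lev[of i 1] lev[of i "-1"] by (auto simp: dec_def)
    qed
    moreover have "(lev 1, lev (-1)) \<in> W" using \<P>' by (auto simp: W_def lev_def)
    ultimately show "(\<lambda>i\<in>{1..n}. v (x i)) \<in> dec ` W" by blast
  qed
  have finW: "finite W" unfolding W_def using fin_tr card_tr by (intro finite_UN_I[OF fin_tr]) auto
  then show "finite ((\<lambda>v. \<lambda>i\<in>{1..n}. v (x i)) ` \<V>)" using sub finite_subset by blast
  have "card ((\<lambda>v. \<lambda>i\<in>{1..n}. v (x i)) ` \<V>) \<le> card (dec ` W)"
    using sub finW by (intro card_mono) auto
  also have "\<dots> \<le> card W" using finW by (rule card_image_le)
  also have "\<dots> \<le> (\<Sum>\<tau>\<in>tr ` \<F>. card (Pow \<tau> \<times> Pow \<tau>))"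
    unfolding W_def using fin_tr by (rule card_UN_le)
  also have "\<dots> \<le> (\<Sum>\<tau>\<in>tr ` \<F>. 4 ^ m)"
  proof (rule sum_mono)
    fix \<tau> assume "\<tau> \<in> tr ` \<F>"
    then have \<tau>: "finite \<tau>" "card \<tau> \<le> m" using card_tr by auto
    then have "card (Pow \<tau> \<times> Pow \<tau>) = 4 ^ card \<tau>"
      by (simp add: card_cartesian_product card_Pow flip: power_mult_distrib)
    also have "\<dots> \<le> 4 ^ m" using \<tau> by (intro power_increasing) auto
    finally show "card (Pow \<tau> \<times> Pow \<tau>) \<le> 4 ^ m" .
  qed
  also have "\<dots> = trace_count X \<F> * 4 ^ m"
    by (simp add: trace_count_def tr_def)
  also have "trace_count X \<F> \<le> growth_number n \<F>"
    unfolding growth_number_def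
  proof (rule Max_ge)
    show "trace_count X \<F> \<in> {trace_count (x ` {1..n}) \<F> |x. True}" by (auto simp: X_def)
    \<comment> \<open>The maximum in \<open>growth_number\<close> is over a finite set: n points
      have at most 2^(2^n) families of subsets.\<close>
    have "{trace_count (x ` {1..n}) \<F> |x :: nat \<Rightarrow> 'x. True} \<subseteq> {..2 ^ (2 ^ n)}"
    proof
      fix k assume "k \<in> {trace_count (x ` {1..n}) \<F> |x :: nat \<Rightarrow> 'x. True}"
      then obtain y :: "nat \<Rightarrow> 'x" where k: "k = trace_count (y ` {1..n}) \<F>" by blast
      have "trace_count (y ` {1..n}) \<F> \<le> card (Pow (Pow (y ` {1..n})))"
        unfolding trace_count_def by (intro card_mono) auto
      also have "\<dots> = 2 ^ (2 ^ card (y ` {1..n}))" by (simp add: card_Pow)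
      also have "\<dots> \<le> 2 ^ (2 ^ n)"
        using card_image_le[of "{1..n}" y] by (intro power_increasing) auto
      finally show "k \<in> {..2 ^ (2 ^ n)}" by (simp add: k)
    qed
    then show "finite {trace_count (x ` {1..n}) \<F> |x :: nat \<Rightarrow> 'x. True}"
      by (rule finite_subset) simp
  qed
  finally show "card ((\<lambda>v. \<lambda>i\<in>{1..n}. v (x i)) ` \<V>) \<le> growth_number n \<F> * 4 ^ m"
    by simp
qed

definition emp_dev :: "'a measure \<Rightarrow> nat \<Rightarrow> (nat \<Rightarrow> 'a) \<Rightarrow> ('a \<Rightarrow> real) \<Rightarrow> real" where
  "emp_dev P n d h = (\<Sum>i=1..n. h (d i)) / n - (\<integral>x. h x \<partial>P)"

text \<open>The absolute values make this, for disjoint cells, the largest deviation of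
  \<open>w\<close> times a function that is 1 or -1 on each cell and 0 elsewhere; the sign of the
  deviation of the cell is a maximiser.\<close>

definition cell_dev ::
  "((real ^ 'd) \<times> real) measure \<Rightarrow> nat \<Rightarrow> 'd::finite data \<Rightarrow> (real ^ 'd) set set \<Rightarrow>
   ((real ^ 'd) \<times> real \<Rightarrow> real) \<Rightarrow> real" where
  "cell_dev P n d \<P> w = (\<Sum>A\<in>\<P>. \<bar>emp_dev P n d (\<lambda>z. w z * indicator A (fst z))\<bar>)"

text \<open>A cell is the section of the measurable relation in
  \<open>data_dependent_collection\<close> at the sample and one of its points.\<close>

lemma data_dependent_cells_measurable:
  fixes \<C> :: "'d::finite data \<Rightarrow> (real ^ 'd) set set"
  assumes \<C>: "data_dependent_collection S n \<C>" and d: "d \<in> data_space n S"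
    and A: "A \<in> gen_partition (\<C> d)"
  shows "A \<in> sets borel"
proof -
  let ?D = "PiM {1..n} (\<lambda>_. restrict_space borel S)"
  let ?B = "borel :: (real ^ 'd) measure"
  define Same where "Same = {(d, x, x'). d \<in> data_space n S \<and> (\<exists>A\<in>gen_partition (\<C> d). x \<in> A \<and> x' \<in> A)}"
  have Same: "Same \<in> sets (?D \<Otimes>\<^sub>M (?B \<Otimes>\<^sub>M ?B))"
    using \<C> by (simp add: data_dependent_collection_def Same_def)
  obtain x where x: "x \<in> A" using A by (auto simp: gen_partition_def)
  have "Pair x -` (Pair d -` Same) \<in> sets ?B"
    by (rule sets_Pair1) (rule sets_Pair1[OF Same])
  also have "Pair x -` (Pair d -` Same) = A"
    using A x d disjoint_gen_partition[of "\<C> d"] by (auto simp: Same_def disjoint_def)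
  finally show ?thesis .
qed

text \<open>The worst signs are selected without enumerating cells: lying in a common cell is
  jointly measurable, so the deviation of the cell around \<open>x\<close> is a measurable function
  of the sample and of \<open>x\<close>, and so is its sign. The weighted deviation for these signs
  is \<open>n\<close> times \<open>cell_dev\<close>.\<close>

lemma cell_dev_tail:
  fixes P :: "((real ^ 'd::finite) \<times> real) measure" and \<C> :: "'d data \<Rightarrow> (real ^ 'd) set set"
    and c t :: real
  assumes P: "prob_space P" and sets_P: "sets P = sets (restrict_space borel S)" and n: "n > 0"
    and \<C>: "data_dependent_collection S n \<C>"
    and fin: "\<And>\<P>'. \<P>' \<in> \<F> \<Longrightarrow> finite \<P>'" and m: "max_cells \<F> \<le> enat m"
    and ref: "refinement \<F> ((\<lambda>d. gen_partition (\<C> d)) ` data_space n S)"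
    and w[measurable]: "w \<in> borel_measurable P"
    and wc: "\<And>x. x \<in> space P \<Longrightarrow> \<bar>w x\<bar> \<le> c" and c: "c > 0" and t: "t > 0"
    and large: "4 \<le> exp (n * t\<^sup>2 / (8 * c\<^sup>2))"
  shows "\<exists>G\<in>sets (PiM {1..n} (\<lambda>_. P)).
    measure (PiM {1..n} (\<lambda>_. P)) G
      \<ge> 1 - 2 * (growth_number n \<F> * 4 ^ m)\<^sup>2 * exp (- n * t\<^sup>2 / (32 * c\<^sup>2)) \<and>
    (\<forall>d\<in>G. cell_dev P n d (gen_partition (\<C> d)) w < t)"
proof -
  interpret P: prob_space P by fact
  define D where "D = PiM {1..n} (\<lambda>_. P)"
  interpret D: prob_space D unfolding D_def by (rule prob_space_PiM) (rule P)
  let ?B = "borel :: (real ^ 'd) measure"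
  have space_P: "space P = S" using sets_eq_imp_space_eq[OF sets_P] by (simp add: space_restrict_space)
  have space_D: "space D = data_space n S" by (simp add: D_def space_PiM space_P data_space_def)
  have fst_meas[measurable]: "fst \<in> P \<rightarrow>\<^sub>M ?B"
  proof -
    have "fst \<in> restrict_space borel S \<rightarrow>\<^sub>M ?B"
      by (intro measurable_restrict_space1 borel_measurable_continuous_onI continuous_intros)
    then show ?thesis using measurable_cong_sets[OF sets_P refl, of ?B] by blast
  qed
  define Same where "Same = {(d, x, x'). d \<in> data_space n S \<and> (\<exists>A\<in>gen_partition (\<C> d). x \<in> A \<and> x' \<in> A)}"
  have [measurable]: "Same \<in> sets (D \<Otimes>\<^sub>M (?B \<Otimes>\<^sub>M ?B))"
  proof -
    have "sets D = sets (PiM {1..n} (\<lambda>_. restrict_space borel S))"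
      unfolding D_def by (intro sets_PiM_cong refl) (simp add: sets_P)
    then have "sets (D \<Otimes>\<^sub>M (?B \<Otimes>\<^sub>M ?B)) = sets (PiM {1..n} (\<lambda>_. restrict_space borel S) \<Otimes>\<^sub>M (?B \<Otimes>\<^sub>M ?B))"
      by (intro sets_pair_measure_cong refl)
    then show ?thesis using \<C> by (simp add: data_dependent_collection_def Same_def)
  qed
  have finC: "finite (gen_partition (\<C> d))" if "d \<in> space D" for d
    using \<C> that by (intro finite_gen_partition) (auto simp: data_dependent_collection_def space_D)
  define same where "same d x x' = indicat_real Same (d, x, x')" for d x x'
  have same_eq: "same d y x = indicator A y" "same d x y = indicator A y"
    if "d \<in> space D" "A \<in> gen_partition (\<C> d)" "x \<in> A" for d x y A
    using that disjoint_gen_partition[of "\<C> d"]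
    by (auto simp: same_def Same_def space_D indicator_def disjoint_def)
  have same_zero: "same d x x = 0" if "x \<notin> \<Union>(gen_partition (\<C> d))" for d x
    using that by (auto simp: same_def Same_def)
  \<comment> \<open>On a cell, \<open>u d\<close> is constant and equals the deviation of that cell.
    Off all cells the factor \<open>same d x x\<close> in \<open>f0\<close> gives 0.\<close>
  define u where "u d x = emp_dev P n d (\<lambda>z. w z * same d (fst z) x)" for d x
  define f0 where "f0 d x = sgn (u d x) * same d x x" for d x
  define f where "f d z = f0 d (fst z)" for d and z :: "(real ^ 'd) \<times> real"
  have f_meas: "case_prod f \<in> borel_measurable (D \<Otimes>\<^sub>M P)"
  proof -
    have 1: "(\<lambda>(d, z). (\<Sum>i=1..n. w (d i) * same d (fst (d i)) (fst z))) \<in> borel_measurable (D \<Otimes>\<^sub>M P)"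
    proof -
      have "(\<lambda>(d, z). w (d i) * same d (fst (d i)) (fst z)) \<in> borel_measurable (D \<Otimes>\<^sub>M P)" if "i \<in> {1..n}" for i
      proof -
        have [measurable]: "(\<lambda>d. d i) \<in> D \<rightarrow>\<^sub>M P" unfolding D_def using that by (rule measurable_component_singleton)
        show ?thesis unfolding same_def by measurable
      qed
      then show ?thesis by (simp add: case_prod_beta')
    qed
    have 2: "(\<lambda>(d, z). (\<integral>z'. w z' * same d (fst z') (fst z) \<partial>P)) \<in> borel_measurable (D \<Otimes>\<^sub>M P)"
      unfolding same_def by measurable
    show ?thesis unfolding f_def f0_def u_def emp_dev_def using 1 2
      by (simp add: case_prod_beta' same_def) measurable
  qed
  have u_eq: "u d x = emp_dev P n d (\<lambda>z. w z * indicator A (fst z))"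
    if "d \<in> space D" "A \<in> gen_partition (\<C> d)" "x \<in> A" for d x A
    unfolding u_def using same_eq[OF that] by simp
  have f0_eq: "f0 d x = sgn (emp_dev P n d (\<lambda>z. w z * indicator A (fst z)))"
    if "d \<in> space D" "A \<in> gen_partition (\<C> d)" "x \<in> A" for d x A
    using u_eq[OF that] same_eq(1)[OF that, of x] that by (simp add: f0_def)
  have f0_zero: "f0 d x = 0" if "x \<notin> \<Union>(gen_partition (\<C> d))" for d x
    using same_zero[OF that] by (simp add: f0_def)
  have dev_eq: "(\<Sum>i=1..n. w (d i) * f d (d i)) - n * (\<integral>z. w z * f d z \<partial>P) =
      n * cell_dev P n d (gen_partition (\<C> d)) w" if d: "d \<in> space D" for d
  proof -
    define \<P> where "\<P> = gen_partition (\<C> d)"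
    define s where "s A = sgn (emp_dev P n d (\<lambda>z. w z * indicator A (fst z)))" for A
    have f_sum: "f d z = (\<Sum>A\<in>\<P>. s A * indicator A (fst z))" for z
    proof (cases "fst z \<in> \<Union>\<P>")
      case True
      then obtain A where A: "A \<in> \<P>" "fst z \<in> A" by blast
      then show ?thesis
        using f0_eq[OF d, of A "fst z"] sum_indicator_disjoint[of \<P> A "fst z" s] finC[OF d] disjoint_gen_partition[of "\<C> d"]
        by (simp add: f_def s_def \<P>_def)
    next
      case False
      then show ?thesis using f0_zero[of "fst z" d]
        by (subst sum_indicator_disjoint_zero) (auto simp: f_def \<P>_def)
    qed
    have A_meas: "A \<in> sets ?B" if "A \<in> \<P>" for A
      using data_dependent_cells_measurable[OF \<C>] d that by (simp add: space_D \<P>_def)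
    have "(\<integral>z. w z * f d z \<partial>P) = (\<integral>z. (\<Sum>A\<in>\<P>. s A * (w z * indicator A (fst z))) \<partial>P)"
      by (simp add: f_sum sum_distrib_left mult_ac)
    also have "\<dots> = (\<Sum>A\<in>\<P>. \<integral>z. s A * (w z * indicator A (fst z)) \<partial>P)"
    proof (rule Bochner_Integration.integral_sum)
      fix A assume "A \<in> \<P>"
      note A_meas[OF this, measurable]
      have "integrable P (\<lambda>z. w z * indicator A (fst z))"
        using wc c by (intro P.integrable_const_bound[of _ c] AE_I2) (auto simp: indicator_def less_imp_le)
      then show "integrable P (\<lambda>z. s A * (w z * indicator A (fst z)))" by simp
    qed
    also have "\<dots> = (\<Sum>A\<in>\<P>. s A * (\<integral>z. w z * indicator A (fst z) \<partial>P))" by simp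
    finally have int: "(\<integral>z. w z * f d z \<partial>P) = (\<Sum>A\<in>\<P>. s A * (\<integral>z. w z * indicator A (fst z) \<partial>P))" .
    have emp: "(\<Sum>i=1..n. w (d i) * f d (d i)) = (\<Sum>A\<in>\<P>. s A * (\<Sum>i=1..n. w (d i) * indicator A (fst (d i))))"
      unfolding f_sum sum_distrib_left by (subst sum.swap) (simp add: mult_ac)
    have nemp: "n * emp_dev P n d h = (\<Sum>i=1..n. h (d i)) - n * (\<integral>z. h z \<partial>P)" for h
      using n by (simp add: emp_dev_def right_diff_distrib)
    have lin: "(\<Sum>A\<in>\<P>. s A * k A) - n * (\<Sum>A\<in>\<P>. s A * l A) = (\<Sum>A\<in>\<P>. s A * (k A - n * l A))"
      for k l :: "(real ^ 'd) set \<Rightarrow> real"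
      by (simp add: sum_distrib_left right_diff_distrib sum_subtractf mult_ac)
    have "(\<Sum>i=1..n. w (d i) * f d (d i)) - n * (\<integral>z. w z * f d z \<partial>P) =
        (\<Sum>A\<in>\<P>. s A * (n * emp_dev P n d (\<lambda>z. w z * indicator A (fst z))))"
      unfolding int emp nemp by (rule lin)
    also have "\<dots> = (\<Sum>A\<in>\<P>. n * \<bar>emp_dev P n d (\<lambda>z. w z * indicator A (fst z))\<bar>)"
      by (intro sum.cong refl) (simp add: s_def abs_sgn mult_ac)
    finally show ?thesis by (simp add: cell_dev_def \<P>_def sum_distrib_left)
  qed
  have traces: "finite ((\<lambda>d. \<lambda>i\<in>{1..n}. f d (x i)) ` space D) \<and>
      card ((\<lambda>d. \<lambda>i\<in>{1..n}. f d (x i)) ` space D) \<le> growth_number n \<F> * 4 ^ m" for x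
  proof -
    have V: "\<exists>\<P>'\<in>\<F>. \<exists>\<P>. (\<forall>A\<in>\<P>. A = \<Union>{A' \<in> \<P>'. A' \<subseteq> A}) \<and>
      (\<forall>A\<in>\<P>. \<forall>y\<in>A. \<forall>y'\<in>A. v y = v y') \<and> (\<forall>y. y \<notin> \<Union>\<P> \<longrightarrow> v y = 0) \<and> range v \<subseteq> {-1, 0, 1}"
      if v: "v \<in> f0 ` space D" for v
    proof -
      obtain d where d: "d \<in> space D" and v: "v = f0 d" using v by auto
      obtain \<P>' where \<P>': "\<P>' \<in> \<F>" "\<forall>A\<in>gen_partition (\<C> d). A = \<Union>{A' \<in> \<P>'. A' \<subseteq> A}"
        using ref d unfolding refinement_def space_D by blast
      have "range v \<subseteq> {-1, 0, 1}"
        by (auto simp: v f0_def same_def sgn_if indicator_def split: if_splits)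
      then show ?thesis using \<P>' f0_eq[OF d] f0_zero by (fastforce simp: v intro!: bexI[of _ \<P>'] exI[of _ "gen_partition (\<C> d)"])
    qed
    have "(\<lambda>d. \<lambda>i\<in>{1..n}. f d (x i)) ` space D = (\<lambda>v. \<lambda>i\<in>{1..n}. v (fst (x i))) ` (f0 ` space D)"
      by (simp add: image_image f_def)
    then show ?thesis
      using card_cell_traces[of \<F> m "f0 ` space D" "\<lambda>i. fst (x i)", OF fin m V] by simp
  qed
  have f1: "\<bar>f d x\<bar> \<le> 1" for d x
    by (auto simp: f_def f0_def same_def sgn_if indicator_def)
  define bad where "bad = {d \<in> space D. (\<Sum>i=1..n. w (d i) * f d (d i)) - n * (\<integral>z. w z * f d z \<partial>P) \<ge> n * t}"
  note ghost = ghost_sample_deviation[OF P n f_meas[unfolded D_def] f1 w wc c t traces[unfolded D_def] large, folded D_def, folded bad_def]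
  have "measure D (space D - bad) \<ge> 1 - 2 * (growth_number n \<F> * 4 ^ m)\<^sup>2 * exp (- n * t\<^sup>2 / (32 * c\<^sup>2))"
    using ghost by (subst D.prob_compl) auto
  moreover have "cell_dev P n d (gen_partition (\<C> d)) w < t" if "d \<in> space D - bad" for d
    using that dev_eq[of d] n by (auto simp: bad_def not_le)
  ultimately show ?thesis using ghost(1)
    by (intro bexI[of _ "space D - bad"]) (auto simp: D_def)
qed

text \<open>The values \<open>b A\<close> may depend on the sample, so the integrand is no fixed
  function. Expanding (b A - g)^2 on each cell separates these values, bounded by \<open>L\<close>,
  from the deviations of 1, g and g^2. Off the cells the estimator is 0 and the squared error at
  most L^2.\<close>

lemma partition_risk_le:
  fixes P :: "((real ^ 'd::finite) \<times> real) measure" and g :: "real ^ 'd \<Rightarrow> real" and L :: real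
  assumes P: "prob_space P" and fst_meas[measurable]: "fst \<in> P \<rightarrow>\<^sub>M borel"
    and g[measurable]: "g \<in> borel_measurable borel" and gL: "\<And>x. \<bar>g x\<bar> \<le> L"
    and fin: "finite \<P>" and disj: "disjoint \<P>" and meas: "\<And>A. A \<in> \<P> \<Longrightarrow> A \<in> sets borel"
    and bL: "\<And>A. A \<in> \<P> \<Longrightarrow> \<bar>b A\<bar> \<le> L"
  shows "(\<integral>z. ((\<Sum>A\<in>\<P>. b A * indicator A (fst z)) - g (fst z))\<^sup>2 \<partial>P)
    \<le> L\<^sup>2 * measure P {z \<in> space P. fst z \<notin> \<Union>\<P>}
      + (\<Sum>A\<in>\<P>. \<Sum>i=1..n. (b A - g (fst (d i)))\<^sup>2 * indicator A (fst (d i))) / n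
      + L\<^sup>2 * cell_dev P n d \<P> (\<lambda>_. 1) + 2 * L * cell_dev P n d \<P> (\<lambda>z. g (fst z))
      + cell_dev P n d \<P> (\<lambda>z. (g (fst z))\<^sup>2)"
proof -
  interpret P: prob_space P by fact
  have L: "L \<ge> 0" using gL[of 0] by linarith
  define U where "U = {z \<in> space P. fst z \<notin> \<Union>\<P>}"
  have [measurable]: "\<Union>\<P> \<in> sets borel" using fin meas by (intro sets.finite_Union) auto
  have [measurable]: "U \<in> sets P" unfolding U_def by measurable
  have g2: "(g x)\<^sup>2 \<le> L\<^sup>2" for x using gL[of x] L by (simp add: abs_le_square_iff[symmetric])
  have ints: "integrable P (\<lambda>z. 1 * indicat_real A (fst z))" "integrable P (\<lambda>z. g (fst z) * indicator A (fst z))"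
    "integrable P (\<lambda>z. (g (fst z))\<^sup>2 * indicator A (fst z))" if "A \<in> \<P>" for A
  proof -
    note meas[OF that, measurable]
    show "integrable P (\<lambda>z. 1 * indicat_real A (fst z))"
      by (intro P.integrable_const_bound[of _ 1] AE_I2) auto
    show "integrable P (\<lambda>z. g (fst z) * indicator A (fst z))"
      using gL L by (intro P.integrable_const_bound[of _ L] AE_I2) (auto simp: indicator_def)
    show "integrable P (\<lambda>z. (g (fst z))\<^sup>2 * indicator A (fst z))"
      using g2 L by (intro P.integrable_const_bound[of _ "L\<^sup>2"] AE_I2) (auto simp: indicator_def)
  qed
  have expand: "(b A - g (fst z))\<^sup>2 * indicator A (fst z) = (b A)\<^sup>2 * (1 * indicator A (fst z))
      - 2 * b A * (g (fst z) * indicator A (fst z)) + (g (fst z))\<^sup>2 * indicator A (fst z)"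
    for A and z :: "(real ^ 'd) \<times> real"
    by (simp add: power2_eq_square algebra_simps)
  have cell_int: "integrable P (\<lambda>z. (b A - g (fst z))\<^sup>2 * indicator A (fst z))" if "A \<in> \<P>" for A
    unfolding expand by (intro Bochner_Integration.integrable_add Bochner_Integration.integrable_diff integrable_mult_right ints[OF that])
  have cell: "(\<integral>z. (b A - g (fst z))\<^sup>2 * indicator A (fst z) \<partial>P)
     \<le> (\<Sum>i=1..n. (b A - g (fst (d i)))\<^sup>2 * indicator A (fst (d i))) / n
      + (L\<^sup>2 * \<bar>emp_dev P n d (\<lambda>z. 1 * indicator A (fst z))\<bar>
      + 2 * L * \<bar>emp_dev P n d (\<lambda>z. g (fst z) * indicator A (fst z))\<bar>
      + \<bar>emp_dev P n d (\<lambda>z. (g (fst z))\<^sup>2 * indicator A (fst z))\<bar>)" if A: "A \<in> \<P>" for A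
  proof -
    define e1 where "e1 = emp_dev P n d (\<lambda>z. 1 * indicator A (fst z))"
    define e2 where "e2 = emp_dev P n d (\<lambda>z. g (fst z) * indicator A (fst z))"
    define e3 where "e3 = emp_dev P n d (\<lambda>z. (g (fst z))\<^sup>2 * indicator A (fst z))"
    have "(\<integral>z. (b A - g (fst z))\<^sup>2 * indicator A (fst z) \<partial>P) =
        (b A)\<^sup>2 * (\<integral>z. 1 * indicator A (fst z) \<partial>P) - 2 * b A * (\<integral>z. g (fst z) * indicator A (fst z) \<partial>P)
        + (\<integral>z. (g (fst z))\<^sup>2 * indicator A (fst z) \<partial>P)"
      unfolding expand
      by (subst Bochner_Integration.integral_add Bochner_Integration.integral_diff;
          (intro ints[OF A] Bochner_Integration.integrable_add Bochner_Integration.integrable_diff integrable_mult_right)?)+ simp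
    moreover have "(\<Sum>i=1..n. (b A - g (fst (d i)))\<^sup>2 * indicator A (fst (d i))) / n =
        (b A)\<^sup>2 * ((\<Sum>i=1..n. 1 * indicator A (fst (d i))) / n)
        - 2 * b A * ((\<Sum>i=1..n. g (fst (d i)) * indicator A (fst (d i))) / n)
        + (\<Sum>i=1..n. (g (fst (d i)))\<^sup>2 * indicator A (fst (d i))) / n"
      unfolding expand sum.distrib sum_subtractf sum_distrib_left[symmetric]
      by (simp add: add_divide_distrib diff_divide_distrib)
    ultimately have eq: "(\<integral>z. (b A - g (fst z))\<^sup>2 * indicator A (fst z) \<partial>P) =
        (\<Sum>i=1..n. (b A - g (fst (d i)))\<^sup>2 * indicator A (fst (d i))) / n
        - ((b A)\<^sup>2 * e1 - 2 * b A * e2 + e3)"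
      unfolding e1_def e2_def e3_def emp_dev_def by (simp add: algebra_simps)
    have "\<bar>(b A)\<^sup>2 * e1\<bar> \<le> L\<^sup>2 * \<bar>e1\<bar>"
      using bL[OF A] L by (auto simp: abs_mult abs_le_square_iff[symmetric] intro!: mult_right_mono)
    moreover have "\<bar>2 * b A * e2\<bar> \<le> 2 * L * \<bar>e2\<bar>"
      using bL[OF A] by (auto simp: abs_mult intro!: mult_right_mono)
    ultimately show ?thesis unfolding eq e1_def[symmetric] e2_def[symmetric] e3_def[symmetric]
      by linarith
  qed
  have "(\<integral>z. ((\<Sum>A\<in>\<P>. b A * indicator A (fst z)) - g (fst z))\<^sup>2 \<partial>P)
      \<le> (\<integral>z. L\<^sup>2 * indicator U z + (\<Sum>A\<in>\<P>. (b A - g (fst z))\<^sup>2 * indicator A (fst z)) \<partial>P)"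
  proof (rule integral_mono')
    show "integrable P (\<lambda>z. L\<^sup>2 * indicator U z + (\<Sum>A\<in>\<P>. (b A - g (fst z))\<^sup>2 * indicator A (fst z)))"
      using cell_int by (intro Bochner_Integration.integrable_add integrable_mult_right Bochner_Integration.integrable_sum)
        (auto simp: P.emeasure_eq_measure)
    fix z assume z: "z \<in> space P"
    show "0 \<le> L\<^sup>2 * indicator U z + (\<Sum>A\<in>\<P>. (b A - g (fst z))\<^sup>2 * indicator A (fst z))"
      by (intro add_nonneg_nonneg sum_nonneg) auto
    show "((\<Sum>A\<in>\<P>. b A * indicator A (fst z)) - g (fst z))\<^sup>2
        \<le> L\<^sup>2 * indicator U z + (\<Sum>A\<in>\<P>. (b A - g (fst z))\<^sup>2 * indicator A (fst z))"
    proof (cases "fst z \<in> \<Union>\<P>")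
      case True
      then obtain A where A: "A \<in> \<P>" "fst z \<in> A" by blast
      show ?thesis
        using sum_indicator_disjoint[OF fin disj A, of b] sum_indicator_disjoint[OF fin disj A, of "\<lambda>A. (b A - g (fst z))\<^sup>2"]
        by simp
    next
      case False
      then show ?thesis
        using z g2[of "fst z"] sum_indicator_disjoint_zero[of "fst z" \<P> b] sum_indicator_disjoint_zero[of "fst z" \<P> "\<lambda>A. (b A - g (fst z))\<^sup>2"]
        by (simp add: U_def)
    qed
  qed
  also have "\<dots> = L\<^sup>2 * measure P U + (\<Sum>A\<in>\<P>. \<integral>z. (b A - g (fst z))\<^sup>2 * indicator A (fst z) \<partial>P)"
    using cell_int by (subst Bochner_Integration.integral_add)
      (auto simp: P.emeasure_eq_measure Bochner_Integration.integral_sum intro!: Bochner_Integration.integrable_sum)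
  also have "\<dots> \<le> L\<^sup>2 * measure P U + (\<Sum>A\<in>\<P>. (\<Sum>i=1..n. (b A - g (fst (d i)))\<^sup>2 * indicator A (fst (d i))) / n
      + (L\<^sup>2 * \<bar>emp_dev P n d (\<lambda>z. 1 * indicator A (fst z))\<bar>
      + 2 * L * \<bar>emp_dev P n d (\<lambda>z. g (fst z) * indicator A (fst z))\<bar>
      + \<bar>emp_dev P n d (\<lambda>z. (g (fst z))\<^sup>2 * indicator A (fst z))\<bar>))"
    by (intro add_left_mono sum_mono cell)
  finally show ?thesis
    by (simp add: cell_dev_def sum.distrib sum_distrib_left sum_divide_distrib U_def)
qed

section \<open>Deviations over a Donsker class\<close>

text \<open>Weak convergence is tested with a continuous cut-off of the sup norm, whose limit
  integral is below \<open>\<eta>\<close> for a large level because the limit takes finite norms. An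
  outer expectation below \<open>\<eta>\<close> provides an integrable majorant, and Markov's
  inequality for this majorant yields a measurable event although the supremum may not be
  measurable.\<close>

lemma donsker_deviation:
  fixes P :: "'a measure"
  assumes P: "prob_space P" and \<B>: "donsker_sets P \<B>" and \<eta>: "\<eta> > 0"
  shows "\<exists>K. \<forall>\<^sub>F n in sequentially. \<exists>G\<in>sets (PiM UNIV (\<lambda>_::nat. P)).
    measure (PiM UNIV (\<lambda>_::nat. P)) G \<ge> 1 - \<eta> \<and>
    (\<forall>z\<in>G. \<forall>B\<in>\<B>. \<bar>(\<Sum>i=1..n. indicator B (z i)) - n * measure P B\<bar> \<le> K * sqrt n)"
proof -
  define U where "U = PiM UNIV (\<lambda>_::nat. P)"
  interpret U: prob_space U unfolding U_def by (rule prob_space_PiM) (rule P)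
  define F :: "('a \<Rightarrow> real) set" where "F = indicator ` \<B>"
  interpret ms: Metric_space "ell_infty F" "sup_dist F" by (rule Metric_space_ell_infty)
  define T where "T = ms.mtopology"
  have top: "topspace T = ell_infty F" by (simp add: T_def)
  obtain \<mu> where \<mu>: "tight_borel_prob T \<mu>" and HJ: "HJ_converges U T (empirical_process P F) \<mu>"
    and \<B>_sets: "\<B> \<subseteq> sets P"
    using \<B> by (auto simp: donsker_sets_def donsker_class_def F_def T_def U_def)
  interpret \<mu>: prob_space \<mu> using \<mu> by (simp add: tight_borel_prob_def)
  have space_\<mu>: "space \<mu> = ell_infty F" and sets_\<mu>: "sets \<mu> = sigma_sets (ell_infty F) {U. openin T U}"
    using \<mu> by (auto simp: tight_borel_prob_def top)
  define o0 :: "('a \<Rightarrow> real) \<Rightarrow> real" where "o0 = (\<lambda>f\<in>F. 0)"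
  have o0: "o0 \<in> ell_infty F"
    by (auto simp: o0_def ell_infty_def bounded_iff intro!: exI[of _ 0])
  define N where "N z = sup_dist F z o0" for z
  have N_ge: "\<bar>z f\<bar> \<le> N z" if z: "z \<in> ell_infty F" and f: "f \<in> F" for z f
  proof -
    obtain b where b: "\<And>i. i \<in> F \<Longrightarrow> \<bar>z i\<bar> \<le> b"
      using z by (auto simp: ell_infty_def bounded_iff)
    have bdd: "bdd_above (insert 0 ((\<lambda>i. \<bar>z i - o0 i\<bar>) ` F))"
      using b by (auto intro!: bdd_aboveI[of _ b] simp: o0_def)
    have "\<bar>z f - o0 f\<bar> \<le> N z"
      unfolding N_def sup_dist_def using z o0 f bdd by (auto intro!: cSup_upper)
    then show ?thesis using f by (simp add: o0_def)
  qed
  have N_cont: "continuous_map T euclideanreal N"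
  proof -
    have "openin T {z \<in> ell_infty F. N z \<in> V}" if V: "open V" for V :: "real set"
      unfolding T_def ms.openin_mtopology
    proof safe
      fix z assume z: "z \<in> ell_infty F" "N z \<in> V"
      then obtain r where r: "r > 0" "ball (N z) r \<subseteq> V"
        using V by (meson open_contains_ball)
      have "ms.mball z r \<subseteq> {z \<in> ell_infty F. N z \<in> V}"
      proof
        fix y assume y: "y \<in> ms.mball z r"
        then have y': "y \<in> ell_infty F" "sup_dist F z y < r" by auto
        have "\<bar>sup_dist F z o0 - sup_dist F o0 y\<bar> \<le> sup_dist F z y"
          by (rule ms.mdist_reverse_triangle) (use z o0 y' in auto)
        then have "dist (N z) (N y) < r"
          using y' ms.commute[of o0 y] by (simp add: N_def dist_real_def)
        then show "y \<in> {z \<in> ell_infty F. N z \<in> V}" using r y' by auto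
      qed
      then show "\<exists>r>0. ms.mball z r \<subseteq> {z \<in> ell_infty F. N z \<in> V}" using r by blast
    qed
    then show ?thesis by (auto simp: continuous_map_def top)
  qed
  \<comment> \<open>Vanishes for norms up to \<open>k\<close> and is 1 from \<open>k + 1\<close>
    on.\<close>
  define h where "h k z = min 1 (max 0 (N z - real k))" for k :: nat and z
  have h_cont: "continuous_map T euclideanreal (h k)" for k
  proof -
    have "continuous_map euclideanreal euclideanreal (\<lambda>x. min 1 (max 0 (x - real k)))"
      by (auto intro!: continuous_intros simp: continuous_map_iff_continuous2)
    from continuous_map_compose[OF N_cont this] show ?thesis
      by (simp add: h_def[abs_def] o_def)
  qed
  have h01: "0 \<le> h k z" "h k z \<le> 1" for k z by (auto simp: h_def)
  have h_meas[measurable]: "h k \<in> borel_measurable \<mu>" for k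
  proof (rule borel_measurableI)
    fix S :: "real set" assume "open S"
    then have "openin T {z \<in> topspace T. h k z \<in> S}"
      using h_cont[of k] by (auto simp: continuous_map_def)
    also have "{z \<in> topspace T. h k z \<in> S} = h k -` S \<inter> space \<mu>"
      by (auto simp: top space_\<mu>)
    finally show "h k -` S \<inter> space \<mu> \<in> sets \<mu>" unfolding sets_\<mu> by (intro sigma_sets.Basic) auto
  qed
  have "(\<lambda>k. \<integral>z. h k z \<partial>\<mu>) \<longlonglongrightarrow> (\<integral>z. 0 \<partial>\<mu>)"
  proof (rule integral_dominated_convergence[where w = "\<lambda>_. 1"])
    show "AE z in \<mu>. (\<lambda>k. h k z) \<longlonglongrightarrow> 0"
    proof (rule AE_I2)
      fix z
      obtain k0 :: nat where "N z \<le> k0" using real_arch_simple by blast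
      then have "\<forall>\<^sub>F k in sequentially. h k z = 0"
        by (intro eventually_sequentiallyI[of k0]) (auto simp: h_def)
      then show "(\<lambda>k. h k z) \<longlonglongrightarrow> 0" by (rule tendsto_eventually)
    qed
  qed (use h01 in auto)
  then have "\<forall>\<^sub>F k in sequentially. (\<integral>z. h k z \<partial>\<mu>) < \<eta>"
    using \<eta> by (intro order_tendstoD(2)) auto
  then obtain k where k: "(\<integral>z. h k z \<partial>\<mu>) < \<eta>"
    by (auto simp: eventually_sequentially)
  have "bounded (h k ` topspace T)"
    using h01 by (auto simp: bounded_iff intro!: exI[of _ 1])
  with HJ h_cont[of k] have "(\<lambda>n. outer_expectation U (\<lambda>\<omega>. h k (empirical_process P F n \<omega>))) \<longlonglongrightarrow> (\<integral>z. h k z \<partial>\<mu>)"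
    by (simp add: HJ_converges_def)
  then have "\<forall>\<^sub>F n in sequentially. outer_expectation U (\<lambda>\<omega>. h k (empirical_process P F n \<omega>)) < \<eta>"
    using k by (intro order_tendstoD(2))
  then have "\<forall>\<^sub>F n in sequentially. \<exists>G\<in>sets U. measure U G \<ge> 1 - \<eta> \<and>
    (\<forall>z\<in>G. \<forall>B\<in>\<B>. \<bar>(\<Sum>i=1..n. indicator B (z i)) - n * measure P B\<bar> \<le> (k + 1) * sqrt n)"
    using eventually_gt_at_top[of 0]
  proof eventually_elim
    case (elim n)
    let ?Z = "empirical_process P F n"
    have Z: "?Z \<omega> \<in> ell_infty F" if "\<omega> \<in> space U" for \<omega>
      using HJ that by (auto simp: HJ_converges_def top)
    let ?V = "{integral\<^sup>L U V | V. integrable U V \<and> (\<forall>\<omega>\<in>space U. h k (?Z \<omega>) \<le> V \<omega>)}"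
    \<comment> \<open>The constant 1 is a majorant, so the infimum is over a nonempty set and some
      majorant has integral below \<open>\<eta>\<close>.\<close>
    have "(\<integral>\<omega>. 1 \<partial>U) \<in> ?V" using h01(2) by (auto intro!: exI[of _ "\<lambda>_. 1"])
    then have "\<exists>v\<in>?V. v < \<eta>"
      using elim cInf_lessD[of ?V \<eta>] unfolding outer_expectation_def by blast
    then obtain V where V: "integrable U V" "\<And>\<omega>. \<omega> \<in> space U \<Longrightarrow> h k (?Z \<omega>) \<le> V \<omega>" "integral\<^sup>L U V < \<eta>"
      by blast
    have [measurable]: "V \<in> borel_measurable U" using V(1) by simp
    define G where "G = {\<omega> \<in> space U. V \<omega> < 1}"
    have G[measurable]: "G \<in> sets U" unfolding G_def by measurable
    have "measure U {\<omega> \<in> space U. V \<omega> \<ge> 1} \<le> integral\<^sup>L U V / 1"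
      using V(1) order_trans[OF h01(1) V(2)]
      by (intro integral_Markov_inequality_measure[where A = "{}"]) auto
    also have "{\<omega> \<in> space U. V \<omega> \<ge> 1} = space U - G" by (auto simp: G_def)
    finally have "measure U G \<ge> 1 - \<eta>" using V(3) U.prob_compl[OF G] by simp
    moreover have "\<bar>(\<Sum>i=1..n. indicator B (z i)) - n * measure P B\<bar> \<le> (k + 1) * sqrt n"
      if z: "z \<in> G" and B: "B \<in> \<B>" for z B
    proof -
      have z': "z \<in> space U" using z by (simp add: G_def)
      have "h k (?Z z) < 1" using V(2)[OF z'] z by (simp add: G_def)
      then have "N (?Z z) \<le> k + 1" by (auto simp: h_def min_def max_def split: if_splits)
      moreover have F: "indicator B \<in> F" using B by (auto simp: F_def)
      ultimately have "\<bar>?Z z (indicator B)\<bar> \<le> k + 1" using N_ge[OF Z[OF z'] F] by linarith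
      moreover have "B \<in> sets P" using B \<B>_sets by auto
      ultimately have 1: "\<bar>sqrt n * ((\<Sum>i=1..n. indicator B (z i)) / n - measure P B)\<bar> \<le> k + 1"
        using F by (simp add: empirical_process_def)
      have "(\<Sum>i=1..n. indicator B (z i)) - n * measure P B =
          sqrt n * (sqrt n * ((\<Sum>i=1..n. indicator B (z i)) / n - measure P B))"
        using elim by (simp add: right_diff_distrib flip: mult.assoc)
      then have "\<bar>(\<Sum>i=1..n. indicator B (z i)) - n * measure P B\<bar> =
          sqrt n * \<bar>sqrt n * ((\<Sum>i=1..n. indicator B (z i)) / n - measure P B)\<bar>"
        by (simp add: abs_mult)
      also have "\<dots> \<le> sqrt n * (k + 1)" using 1 by (intro mult_left_mono) auto
      finally show ?thesis by (simp add: mult.commute)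
    qed
    ultimately show ?case using G by blast
  qed
  then show ?thesis unfolding U_def by blast
qed

text \<open>The weight is rescaled affinely into [0, 1] and the resampling bound is applied twice:
  with the weight \<open>a\<close>, and with the constant weight 1, where the expression reduces to
  the plain deviation and carries the Donsker bound over to the finite sample. The remaining term,
  the deviation of the sum of \<open>a\<close>, involves no supremum and is handled by Hoeffding's
  inequality.\<close>

lemma donsker_weighted_deviation:
  fixes P :: "'a measure" and w :: "'a \<Rightarrow> real"
  assumes P: "prob_space P" and \<B>: "donsker_sets P \<B>" and \<eta>: "\<eta> > 0"
    and w[measurable]: "w \<in> borel_measurable P" and wc: "\<And>x. x \<in> space P \<Longrightarrow> \<bar>w x\<bar> \<le> c"
  shows "\<exists>K. \<forall>\<^sub>F n in sequentially. \<exists>G\<in>sets (PiM {1..n} (\<lambda>_. P)).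
    measure (PiM {1..n} (\<lambda>_. P)) G \<ge> 1 - \<eta> \<and>
    (\<forall>d\<in>G. \<forall>B\<in>\<B>. \<bar>(\<Sum>i=1..n. w (d i) * indicator B (d i)) - n * (\<integral>x. w x * indicator B x \<partial>P)\<bar> \<le> K * sqrt n)"
proof -
  interpret P: prob_space P by fact
  have \<B>_sets: "\<B> \<subseteq> sets P" using \<B> by (simp add: donsker_sets_def)
  define c' where "c' = \<bar>c\<bar> + 1"
  have c': "c' > 0" "\<And>x. x \<in> space P \<Longrightarrow> \<bar>w x\<bar> \<le> c'" using wc by (force simp: c'_def)+
  define a where "a x = (w x + c') / (2 * c')" for x
  have a[measurable]: "a \<in> borel_measurable P" unfolding a_def by measurable
  have a01: "0 \<le> a x \<and> a x \<le> 1" if "x \<in> space P" for x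
    using c'(2)[OF that] c'(1) by (auto simp: a_def field_simps abs_le_iff)
  have w_eq: "w x = 2 * c' * a x - c'" for x using c'(1) by (simp add: a_def field_simps)
  define p where "p = (\<integral>x. a x \<partial>P)"
  have p01: "\<bar>p\<bar> \<le> 1"
  proof -
    have "0 \<le> p" unfolding p_def using a01 by (intro Bochner_Integration.integral_nonneg_AE AE_I2) auto
    moreover have "p \<le> (\<integral>x. 1 \<partial>P)"
      unfolding p_def using a01 by (intro integral_mono' ) auto
    ultimately show ?thesis by (simp add: P.prob_space)
  qed
  \<comment> \<open>Chosen so that 2 exp (- C^2 / 2) = 2 \<eta> / (6 + \<eta>) \<le> \<eta> /
    3.\<close>
  define C where "C = sqrt (2 * ln (6 / \<eta> + 1))"
  have C: "C \<ge> 0" "2 * exp (- C\<^sup>2 / 2) \<le> \<eta> / 3"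
  proof -
    have "ln (6 / \<eta> + 1) \<ge> 0" using \<eta> by (intro ln_ge_zero) simp
    then show "C \<ge> 0" "2 * exp (- C\<^sup>2 / 2) \<le> \<eta> / 3"
      using \<eta> by (auto simp: C_def exp_minus add_pos_pos field_simps)
  qed
  \<comment> \<open>Resampling doubles the failure probability: \<eta> / 6 becomes \<eta> / 3, the
    share of each of the three events.\<close>
  obtain K where K: "\<forall>\<^sub>F n in sequentially. \<exists>G\<in>sets (PiM UNIV (\<lambda>_::nat. P)).
    measure (PiM UNIV (\<lambda>_::nat. P)) G \<ge> 1 - \<eta> / 6 \<and>
    (\<forall>z\<in>G. \<forall>B\<in>\<B>. \<bar>(\<Sum>i=1..n. indicator B (z i)) - n * measure P B\<bar> \<le> K * sqrt n)"
    using donsker_deviation[OF P \<B>, of "\<eta> / 6"] \<eta> by auto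
  \<comment> \<open>With A and S the deviations for \<open>a\<close> and for 1 on a set, and V that
    of the sum of \<open>a\<close>, resampling gives |A| \<le> 2 (K + 2) sqrt n + |S| + |V|, and the
    deviation for \<open>w\<close> is c' (2 A - S).\<close>
  define K' where "K' = c' * (2 * (3 * (K + 2) + C) + (K + 2))"
  have "\<forall>\<^sub>F n in sequentially. \<exists>G\<in>sets (PiM {1..n} (\<lambda>_. P)).
    measure (PiM {1..n} (\<lambda>_. P)) G \<ge> 1 - \<eta> \<and>
    (\<forall>d\<in>G. \<forall>B\<in>\<B>. \<bar>(\<Sum>i=1..n. w (d i) * indicator B (d i)) - n * (\<integral>x. w x * indicator B x \<partial>P)\<bar> \<le> K' * sqrt n)"
    using K eventually_gt_at_top[of 0]
  proof eventually_elim
    case (elim n)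
    define D where "D = PiM {1..n} (\<lambda>_. P)"
    interpret D: prob_space D unfolding D_def by (rule prob_space_PiM) (rule P)
    obtain G0 where G0: "G0 \<in> sets (PiM UNIV (\<lambda>_::nat. P))" "measure (PiM UNIV (\<lambda>_::nat. P)) G0 \<ge> 1 - \<eta> / 6"
      and dev: "\<And>z B. z \<in> G0 \<Longrightarrow> B \<in> \<B> \<Longrightarrow> \<bar>(\<Sum>i=1..n. indicator B (z i)) - n * measure P B\<bar> \<le> K * sqrt n"
      using elim(1) by blast
    obtain G1 where G1: "G1 \<in> sets D" "measure D G1 \<ge> 1 - \<eta> / 3"
      and dev1: "\<And>d B. d \<in> G1 \<Longrightarrow> B \<in> \<B> \<Longrightarrow>
       \<bar>((\<Sum>i=1..n. a (d i) * indicator B (d i)) - n * (\<integral>x. a x * indicator B x \<partial>P)) / 2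
       + p * ((\<Sum>i=1..n. indicator B (d i)) - n * measure P B) / 2
       - measure P B * ((\<Sum>i=1..n. a (d i)) - n * p) / 2\<bar> \<le> (K + 2) * sqrt n"
      using resampled_deviation[OF P a a01 \<B>_sets elim(2) G0 dev] by (auto simp: D_def p_def)
    obtain G2 where G2: "G2 \<in> sets D" "measure D G2 \<ge> 1 - \<eta> / 3"
      and dev2: "\<And>d B. d \<in> G2 \<Longrightarrow> B \<in> \<B> \<Longrightarrow>
       \<bar>(\<Sum>i=1..n. indicator B (d i)) - n * measure P B\<bar> \<le> (K + 2) * sqrt n"
    proof -
      have "\<exists>G'\<in>sets (PiM {1..n} (\<lambda>_. P)). measure (PiM {1..n} (\<lambda>_. P)) G' \<ge> 1 - 2 * (\<eta> / 6) \<and>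
        (\<forall>d\<in>G'. \<forall>B\<in>\<B>. \<bar>((\<Sum>i=1..n. (1::real) * indicator B (d i)) - n * (\<integral>x. 1 * indicator B x \<partial>P)) / 2
       + (\<integral>x. 1 \<partial>P) * ((\<Sum>i=1..n. indicator B (d i)) - n * measure P B) / 2
       - measure P B * ((\<Sum>i=1..n. 1) - n * (\<integral>x. 1 \<partial>P)) / 2\<bar> \<le> (K + 2) * sqrt n)"
        by (rule resampled_deviation[OF P _ _ \<B>_sets elim(2) G0 dev]) auto
      then obtain G2 where G2: "G2 \<in> sets D" "measure D G2 \<ge> 1 - \<eta> / 3"
        and *: "\<forall>d\<in>G2. \<forall>B\<in>\<B>. \<bar>((\<Sum>i=1..n. (1::real) * indicator B (d i)) - n * (\<integral>x. 1 * indicator B x \<partial>P)) / 2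
       + (\<integral>x. 1 \<partial>P) * ((\<Sum>i=1..n. indicator B (d i)) - n * measure P B) / 2
       - measure P B * ((\<Sum>i=1..n. 1) - n * (\<integral>x. 1 \<partial>P)) / 2\<bar> \<le> (K + 2) * sqrt n"
        by (auto simp: D_def)
      have "\<bar>(\<Sum>i=1..n. indicator B (d i)) - n * measure P B\<bar> \<le> (K + 2) * sqrt n" if "d \<in> G2" "B \<in> \<B>" for d B
        using *[rule_format, OF that] \<B>_sets that(2) by (auto simp: P.prob_space)
      with G2 that show thesis by blast
    qed
    define bad where "bad = {d \<in> space D. \<bar>(\<Sum>i=1..n. a (d i)) - (\<Sum>i=1..n. \<integral>x. a x \<partial>P)\<bar> \<ge> C * sqrt n}"
    have bad_meas: "bad \<in> sets D" unfolding bad_def D_def by measurable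
    have "measure D bad \<le> 2 * exp (- (C * sqrt n)\<^sup>2 / (2 * card {1..n} * (1::real)\<^sup>2))"
      unfolding bad_def D_def
      by (rule Hoeffding_PiM) (use a01 elim(2) C(1) P in auto)
    also have "\<dots> = 2 * exp (- C\<^sup>2 / 2)" using elim(2) by (simp add: power_mult_distrib)
    finally have bad_le: "measure D bad \<le> \<eta> / 3" using C(2) by linarith
    define G where "G = G1 \<inter> G2 - bad"
    have G: "G \<in> sets D" using G1 G2 bad_meas by (auto simp: G_def)
    have "space D - G \<subseteq> (space D - G1) \<union> (space D - G2) \<union> bad" by (auto simp: G_def)
    then have "measure D (space D - G) \<le> measure D ((space D - G1) \<union> (space D - G2) \<union> bad)"
      using G1 G2 bad_meas by (intro D.finite_measure_mono) auto
    also have "\<dots> \<le> measure D ((space D - G1) \<union> (space D - G2)) + measure D bad"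
      using G1 G2 bad_meas by (intro measure_Un_le) auto
    also have "measure D ((space D - G1) \<union> (space D - G2)) \<le> measure D (space D - G1) + measure D (space D - G2)"
      using G1 G2 by (intro measure_Un_le) auto
    finally have "measure D G \<ge> 1 - \<eta>"
      using G1 G2 bad_le D.prob_compl[of G1] D.prob_compl[of G2] D.prob_compl[OF G] by simp
    moreover have "\<bar>(\<Sum>i=1..n. w (d i) * indicator B (d i)) - n * (\<integral>x. w x * indicator B x \<partial>P)\<bar> \<le> K' * sqrt n"
      if d: "d \<in> G" and B: "B \<in> \<B>" for d B
    proof -
      have [measurable]: "B \<in> sets P" using B \<B>_sets by auto
      define A where "A = (\<Sum>i=1..n. a (d i) * indicator B (d i)) - n * (\<integral>x. a x * indicator B x \<partial>P)"
      define S where "S = (\<Sum>i=1..n. indicator B (d i)) - n * measure P B"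
      define V where "V = (\<Sum>i=1..n. a (d i)) - n * p"
      have dD: "d \<in> space D" using d G1(1) sets.sets_into_space by (auto simp: G_def)
      have 1: "\<bar>A / 2 + p * S / 2 - measure P B * V / 2\<bar> \<le> (K + 2) * sqrt n"
        using dev1[of d B] d B by (simp add: G_def A_def S_def V_def)
      have 2: "\<bar>S\<bar> \<le> (K + 2) * sqrt n" using dev2[of d B] d B by (simp add: G_def S_def)
      have 3: "\<bar>V\<bar> \<le> C * sqrt n" using d dD by (auto simp: G_def bad_def V_def p_def not_le)
      have "\<bar>p * S\<bar> \<le> 1 * \<bar>S\<bar>" unfolding abs_mult using p01 by (intro mult_right_mono) auto
      moreover have "\<bar>measure P B * V\<bar> \<le> 1 * \<bar>V\<bar>" unfolding abs_mult by (intro mult_right_mono) auto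
      ultimately have A: "\<bar>A\<bar> \<le> 3 * ((K + 2) * sqrt n) + C * sqrt n" using 1 2 3 by linarith
      have int_a: "integrable P (\<lambda>x. a x * indicator B x)"
        using a01 by (intro P.integrable_const_bound[of _ 1] AE_I2) (auto simp: indicator_def)
      have "(\<integral>x. w x * indicator B x \<partial>P) = (\<integral>x. 2 * c' * (a x * indicator B x) - c' * indicator B x \<partial>P)"
        by (simp add: w_eq algebra_simps)
      also have "\<dots> = 2 * c' * (\<integral>x. a x * indicator B x \<partial>P) - c' * measure P B"
        using int_a by (subst Bochner_Integration.integral_diff) (auto simp: P.emeasure_eq_measure)
      finally have int: "(\<integral>x. w x * indicator B x \<partial>P) = 2 * c' * (\<integral>x. a x * indicator B x \<partial>P) - c' * measure P B" .
      have "(\<Sum>i=1..n. w (d i) * indicator B (d i)) = (\<Sum>i=1..n. 2 * c' * (a (d i) * indicator B (d i)) - c' * indicator B (d i))"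
        by (simp add: w_eq algebra_simps)
      also have "\<dots> = 2 * c' * (\<Sum>i=1..n. a (d i) * indicator B (d i)) - c' * (\<Sum>i=1..n. indicator B (d i))"
        by (simp only: sum_subtractf sum_distrib_left)
      finally have "(\<Sum>i=1..n. w (d i) * indicator B (d i)) - n * (\<integral>x. w x * indicator B x \<partial>P) = c' * (2 * A - S)"
        unfolding int by (simp add: A_def S_def algebra_simps)
      then have "\<bar>(\<Sum>i=1..n. w (d i) * indicator B (d i)) - n * (\<integral>x. w x * indicator B x \<partial>P)\<bar> = c' * \<bar>2 * A - S\<bar>"
        using c' by (simp add: abs_mult)
      also have "\<dots> \<le> c' * (2 * (3 * ((K + 2) * sqrt n) + C * sqrt n) + (K + 2) * sqrt n)"
      proof (rule mult_left_mono)
        have lin: "\<bar>2 * A - S\<bar> \<le> 2 * q + s" if "\<bar>A\<bar> \<le> q" "\<bar>S\<bar> \<le> s" for q s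
          using that by linarith
        show "\<bar>2 * A - S\<bar> \<le> 2 * (3 * ((K + 2) * sqrt n) + C * sqrt n) + (K + 2) * sqrt n"
          using A 2 by (rule lin)
      qed (use c' in simp)
      also have "\<dots> = K' * sqrt n" by (simp add: K'_def algebra_simps)
      finally show ?thesis .
    qed
    ultimately show ?case using G unfolding D_def by blast
  qed
  then show ?thesis by blast
qed

section \<open>Events of large inner probability\<close>

text \<open>The measurable event inside frees \<open>R\<close> from measurability. The failure
  probability is an argument because a conjunction adds the failure probabilities.\<close>

definition likely :: "'w measure \<Rightarrow> real \<Rightarrow> (nat \<Rightarrow> 'w \<Rightarrow> bool) \<Rightarrow> bool" where
  "likely M \<eta> R \<longleftrightarrow>
     (\<forall>\<^sub>F n in sequentially. \<exists>E\<in>sets M. measure M E \<ge> 1 - \<eta> \<and> (\<forall>\<omega>\<in>E. R n \<omega>))"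

lemma likely_conj:
  assumes M: "prob_space M" and R: "likely M a R" and R': "likely M b R'"
  shows "likely M (a + b) (\<lambda>n \<omega>. R n \<omega> \<and> R' n \<omega>)"
  using R R' unfolding likely_def
proof eventually_elim
  case (elim n)
  interpret prob_space M by fact
  from elim obtain E E' where E: "E \<in> events" "prob E \<ge> 1 - a" "\<forall>\<omega>\<in>E. R n \<omega>"
    and E': "E' \<in> events" "prob E' \<ge> 1 - b" "\<forall>\<omega>\<in>E'. R' n \<omega>" by blast
  have "prob (space M - (E \<inter> E')) \<le> prob ((space M - E) \<union> (space M - E'))"
    using E E' by (intro finite_measure_mono) auto
  also have "\<dots> \<le> prob (space M - E) + prob (space M - E')"
    using E E' by (intro measure_Un_le) auto
  finally have "prob (E \<inter> E') \<ge> 1 - (a + b)"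
    using E E' prob_compl[of "E \<inter> E'"] prob_compl[of E] prob_compl[of E'] by auto
  moreover have "\<forall>\<omega>\<in>E \<inter> E'. R n \<omega> \<and> R' n \<omega>" using E(3) E'(3) by blast
  ultimately show ?case using E(1) E'(1) by blast
qed

lemma likely_mono:
  assumes R: "likely M a R" and "a \<le> b"
    and imp: "\<forall>\<^sub>F n in sequentially. \<forall>\<omega>\<in>space M. R n \<omega> \<longrightarrow> R' n \<omega>"
  shows "likely M b R'"
  using R[unfolded likely_def] imp unfolding likely_def
proof eventually_elim
  case (elim n)
  then obtain E where E: "E \<in> sets M" "measure M E \<ge> 1 - a" "\<forall>\<omega>\<in>E. R n \<omega>" by blast
  then have "\<forall>\<omega>\<in>E. R' n \<omega>" using elim(2) sets.sets_into_space by blast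
  moreover have "measure M E \<ge> 1 - b" using E(2) \<open>a \<le> b\<close> by linarith
  ultimately show ?case using E(1) by blast
qed

lemma likely_AE:
  assumes M: "prob_space M" and AE: "AE \<omega> in M. \<forall>n\<ge>1. R n \<omega>"
  shows "likely M 0 R"
proof -
  interpret prob_space M by fact
  obtain N where N: "{\<omega> \<in> space M. \<not> (\<forall>n\<ge>1. R n \<omega>)} \<subseteq> N" "emeasure M N = 0" "N \<in> events"
    using AE by (rule AE_E)
  have "prob (space M - N) = 1"
    using N(2,3) by (subst prob_compl) (auto simp: measure_def)
  then show ?thesis
    unfolding likely_def
  proof (intro eventually_sequentiallyI[of 1] bexI[of _ "space M - N"] conjI ballI)
    fix n :: nat and \<omega> assume "n \<ge> 1" "\<omega> \<in> space M - N"
    then show "R n \<omega>" using N(1) by blast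
  qed (use N(3) in auto)
qed

text \<open>The outer measure is attained by a measurable hull of the failures; its complement is
  the required event.\<close>

lemma likely_outer_measure:
  assumes M: "prob_space M" and "\<eta> > 0"
    and outer: "\<forall>\<^sub>F n in sequentially. outer_measure_of M {\<omega> \<in> space M. \<not> R n \<omega>} < ennreal \<eta>"
  shows "likely M \<eta> R"
  using outer unfolding likely_def
proof eventually_elim
  case (elim n)
  interpret prob_space M by fact
  obtain E where E: "E \<in> sets M" "{\<omega> \<in> space M. \<not> R n \<omega>} \<subseteq> E"
    "outer_measure_of M {\<omega> \<in> space M. \<not> R n \<omega>} = emeasure M E"
    using outer_measure_of_attain[of "{\<omega> \<in> space M. \<not> R n \<omega>}" M] by blast
  have "ennreal (prob E) < ennreal \<eta>" using elim E by (simp add: emeasure_eq_measure)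
  then have "prob E < \<eta>" using \<open>\<eta> > 0\<close> by (simp add: ennreal_less_iff)
  then have "prob (space M - E) \<ge> 1 - \<eta>" using E(1) by (simp add: prob_compl)
  moreover have "\<forall>\<omega>\<in>space M - E. R n \<omega>" using E(2) by blast
  ultimately show ?case using E(1) by blast
qed

lemma likely_little_oP:
  assumes M: "prob_space M" and U: "little_oP M U V" and "e > 0" "\<eta> > 0"
  shows "likely M \<eta> (\<lambda>n \<omega>. \<bar>U n \<omega> / V n \<omega>\<bar> \<le> e)"
proof (rule likely_outer_measure[OF M \<open>\<eta> > 0\<close>])
  have "(\<lambda>n. outer_measure_of M {\<omega> \<in> space M. \<bar>U n \<omega> / V n \<omega>\<bar> > e}) \<longlonglongrightarrow> 0"
    using U \<open>e > 0\<close> by (simp add: little_oP_def)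
  then show "\<forall>\<^sub>F n in sequentially. outer_measure_of M {\<omega> \<in> space M. \<not> \<bar>U n \<omega> / V n \<omega>\<bar> \<le> e} < ennreal \<eta>"
    using order_tendstoD(2)[of _ 0 _ "ennreal \<eta>"] \<open>\<eta> > 0\<close> by (simp add: not_le)
qed

lemma likely_big_OP:
  assumes M: "prob_space M" and U: "big_OP M U a" and "\<eta> > 0"
  obtains K where "likely M \<eta> (\<lambda>n \<omega>. \<bar>U n \<omega>\<bar> \<le> K * a n)"
proof -
  obtain K where "\<forall>\<^sub>F n in sequentially. outer_measure_of M {\<omega> \<in> space M. \<bar>U n \<omega>\<bar> > K * a n} < ennreal \<eta>"
    using U[unfolded big_OP_def, rule_format, OF \<open>\<eta> > 0\<close>] by (elim exE)
  then have "likely M \<eta> (\<lambda>n \<omega>. \<bar>U n \<omega>\<bar> \<le> K * a n)"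
    by (intro likely_outer_measure[OF M \<open>\<eta> > 0\<close>]) (simp only: not_le)
  then show thesis by (rule that)
qed

lemma little_oP_if_likely:
  assumes M: "prob_space M"
    and likely: "\<And>e \<eta>. e > 0 \<Longrightarrow> \<eta> > 0 \<Longrightarrow> likely M \<eta> (\<lambda>n \<omega>. \<bar>U n \<omega> / V n \<omega>\<bar> \<le> e)"
  shows "little_oP M U V"
  unfolding little_oP_def
proof (intro allI impI order_tendstoI)
  interpret prob_space M by fact
  fix e :: real and a :: ennreal assume "e > 0" "a > 0"
  \<comment> \<open>The cap 1 keeps \<open>\<eta>\<close> real when \<open>a\<close> is infinite;
    halving makes the inequality strict.\<close>
  define \<eta> where "\<eta> = enn2real (min a 1) / 2"
  have min: "min a 1 < top" "min a 1 > 0"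
    using \<open>a > 0\<close> le_less_trans[OF min.cobounded2 ennreal_one_less_top] by auto
  have \<eta>: "\<eta> > 0" using min by (simp add: \<eta>_def enn2real_positive_iff)
  have "ennreal \<eta> < ennreal (2 * \<eta>)" using \<eta> by (simp add: ennreal_less_iff)
  also have "\<dots> = min a 1" using min by (simp add: \<eta>_def ennreal_enn2real)
  also have "\<dots> \<le> a" by simp
  finally have \<eta>a: "ennreal \<eta> < a" .
  show "\<forall>\<^sub>F n in sequentially. outer_measure_of M {\<omega> \<in> space M. e < \<bar>U n \<omega> / V n \<omega>\<bar>} < a"
    using likely[OF \<open>e > 0\<close> \<eta>] unfolding likely_def
  proof eventually_elim
    case (elim n)
    then obtain E where E: "E \<in> sets M" "prob E \<ge> 1 - \<eta>" "\<forall>\<omega>\<in>E. \<bar>U n \<omega> / V n \<omega>\<bar> \<le> e" by blast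
    have "outer_measure_of M {\<omega> \<in> space M. e < \<bar>U n \<omega> / V n \<omega>\<bar>} \<le> outer_measure_of M (space M - E)"
    proof (rule outer_measure_of_mono, rule subsetI)
      fix \<omega> assume "\<omega> \<in> {\<omega> \<in> space M. e < \<bar>U n \<omega> / V n \<omega>\<bar>}"
      then show "\<omega> \<in> space M - E" using E(3)[rule_format, of \<omega>] by (auto simp: not_le[symmetric])
    qed
    also have "\<dots> = ennreal (prob (space M - E))" using E by (simp add: emeasure_eq_measure)
    also have "\<dots> \<le> ennreal \<eta>" using E by (intro ennreal_leI) (simp add: prob_compl)
    also have "\<dots> < a" by (rule \<eta>a)
    finally show ?case .
  qed
qed simp

text \<open>Good events are constructed in the space of samples and pulled back along the sample,
  whose law is \<open>N n\<close>.\<close>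

lemma likely_sample:
  assumes D: "\<And>n. n \<ge> 1 \<Longrightarrow> D n \<in> M \<rightarrow>\<^sub>M N n" "\<And>n. n \<ge> 1 \<Longrightarrow> distr M (N n) (D n) = N n"
    and good: "\<forall>\<^sub>F n in sequentially. \<exists>G\<in>sets (N n). measure (N n) G \<ge> 1 - \<eta> \<and> (\<forall>d\<in>G. R n d)"
  shows "likely M \<eta> (\<lambda>n \<omega>. R n (D n \<omega>))"
  using good eventually_ge_at_top[of 1] unfolding likely_def
proof eventually_elim
  case (elim n)
  then obtain G where G: "G \<in> sets (N n)" "measure (N n) G \<ge> 1 - \<eta>" "\<forall>d\<in>G. R n d" by blast
  have "measure (N n) G = measure (distr M (N n) (D n)) G" by (subst D(2)[OF elim(2)]) (rule refl)
  also have "\<dots> = measure M (D n -` G \<inter> space M)" by (rule measure_distr[OF D(1)[OF elim(2)] G(1)])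
  finally have "measure M (D n -` G \<inter> space M) \<ge> 1 - \<eta>" using G by simp
  moreover have "\<forall>\<omega>\<in>D n -` G \<inter> space M. R n (D n \<omega>)" using G(3) by blast
  ultimately show ?case using measurable_sets[OF D(1)[OF elim(2)] G(1)] by blast
qed

text \<open>
  Observations outside of \<open>S\<close> are replaced by a fixed point of \<open>S\<close>, since hypotheses on samples are
  only available on \<open>S\<close>.
\<close>

lemma restricted_sample_law:
  fixes W :: "nat \<Rightarrow> 'w \<Rightarrow> 'a::topological_space" and S :: "'a set"
  assumes M: "prob_space M" and indep: "prob_space.indep_vars M (\<lambda>_. borel) W {1..}"
    and law: "\<forall>i\<ge>1. distr M borel (W i) = Q"
    and S: "S \<in> sets borel" and QS: "measure Q S = 1" and s0: "s0 \<in> S"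
  defines "P \<equiv> restrict_space Q S"
    and "D \<equiv> \<lambda>n \<omega>. \<lambda>i\<in>{1..n}. if W i \<omega> \<in> S then W i \<omega> else s0"
  shows "prob_space P" "sets P = sets (restrict_space borel S)" "space P = S"
    and "AE \<omega> in M. \<forall>i\<ge>1. W i \<omega> \<in> S"
    and "D n \<in> M \<rightarrow>\<^sub>M PiM {1..n} (\<lambda>_. P)"
    and "n \<ge> 1 \<Longrightarrow> distr M (PiM {1..n} (\<lambda>_. P)) (D n) = PiM {1..n} (\<lambda>_. P)"
proof -
  interpret M: prob_space M by fact
  have dist: "distr M borel (W i) = Q" if "i \<ge> 1" for i using law that by blast
  have W: "W i \<in> borel_measurable M" if "i \<ge> 1" for i
    using indep that by (auto simp: M.indep_vars_def)
  have Q: "prob_space Q" using M.prob_space_distr[OF W[of 1]] dist[of 1] by simp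
  interpret Q: prob_space Q by fact
  have sets_Q: "sets Q = sets borel" 
    using sets_distr[of M borel "W 1"] unfolding dist[OF order_refl] .
  have space_Q: "space Q = UNIV" using sets_eq_imp_space_eq[OF sets_Q] by simp
  note S[measurable]
  have S_Q: "S \<in> sets Q" using S sets_Q by simp
  show sets_P: "sets P = sets (restrict_space borel S)"
    unfolding P_def by (intro sets_restrict_space_cong sets_Q)
  show space_P: "space P = S" by (simp add: P_def space_restrict_space space_Q)
  show P: "prob_space P"
    unfolding P_def by (rule prob_space_restrict_space) (use S_Q QS in \<open>auto simp: Q.emeasure_eq_measure\<close>)
  have AE_Q: "AE x in Q. x \<in> S" using QS S_Q Q.AE_in_set_eq_1 by blast
  have "AE \<omega> in M. W i \<omega> \<in> S" if "i \<ge> 1" for i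
  proof -
    have "AE x in distr M borel (W i). x \<in> S" unfolding dist[OF that] by (rule AE_Q)
    then show ?thesis using W[OF that] by (subst (asm) AE_distr_iff) auto
  qed
  then show "AE \<omega> in M. \<forall>i\<ge>1. W i \<omega> \<in> S"
    by (subst AE_all_countable) (auto intro: AE_mp)
  define \<rho> where "\<rho> x = (if x \<in> S then x else s0)" for x
  have \<rho>: "\<rho> \<in> borel \<rightarrow>\<^sub>M P"
  proof -
    have "\<rho> \<in> borel \<rightarrow>\<^sub>M restrict_space borel S"
      unfolding \<rho>_def by (intro measurable_restrict_space2) (use s0 in auto)
    then show ?thesis using measurable_cong_sets[OF refl sets_P, of borel] by blast
  qed
  have distr_\<rho>: "distr M P (\<lambda>\<omega>. \<rho> (W i \<omega>)) = P" if i: "i \<ge> 1" for i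
  proof -
    have "distr M P (\<lambda>\<omega>. \<rho> (W i \<omega>)) = distr (distr M borel (W i)) P \<rho>"
      using distr_distr[OF \<rho> W[OF i]] by (simp add: o_def)
    also have "\<dots> = distr Q P \<rho>" by (simp add: dist[OF i])
    also have "\<dots> = P"
    proof (rule measure_eqI)
      fix A assume "A \<in> sets (distr Q P \<rho>)"
      then have A: "A \<in> sets P" by simp
      have AS: "A \<subseteq> S" using sets.sets_into_space[OF A] space_P by simp
      have \<rho>Q: "\<rho> \<in> Q \<rightarrow>\<^sub>M P" using \<rho> measurable_cong_sets[OF sets_Q refl, of P] by blast
      have A_Q: "A \<in> sets Q" using A S_Q by (auto simp: P_def sets_restrict_space)
      have "emeasure (distr Q P \<rho>) A = emeasure Q (\<rho> -` A \<inter> space Q)"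
        by (rule emeasure_distr[OF \<rho>Q A])
      \<comment> \<open>The substitution only changes points of a null set.\<close>
      also have "\<dots> = emeasure Q A"
        using AE_Q measurable_sets[OF \<rho>Q A] A_Q
        by (intro emeasure_eq_AE) (auto simp: \<rho>_def space_Q elim!: eventually_mono)
      also have "\<dots> = emeasure P A"
        unfolding P_def using AS S_Q by (subst emeasure_restrict_space) (auto simp: space_Q)
      finally show "emeasure (distr Q P \<rho>) A = emeasure P A" .
    qed simp
    finally show ?thesis .
  qed
  have D_eq: "D n \<omega> = (\<lambda>i\<in>{1..n}. \<rho> (W i \<omega>))" for n \<omega> by (simp add: D_def \<rho>_def)
  have V: "(\<lambda>\<omega>. \<rho> (W i \<omega>)) \<in> M \<rightarrow>\<^sub>M P" if "i \<ge> 1" for i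
    using measurable_compose[OF W[OF that] \<rho>] .
  show "D n \<in> M \<rightarrow>\<^sub>M PiM {1..n} (\<lambda>_. P)"
    unfolding D_eq[abs_def] by (rule measurable_restrict) (use V in auto)
  assume n: "n \<ge> 1"
  have "M.indep_vars (\<lambda>_. P) (\<lambda>i \<omega>. \<rho> (W i \<omega>)) {1..}"
    by (rule M.indep_vars_compose2[OF indep]) (rule \<rho>)
  then have "M.indep_vars (\<lambda>_. P) (\<lambda>i \<omega>. \<rho> (W i \<omega>)) {1..n}"
    by (rule M.indep_vars_subset) auto
  then have "distr M (PiM {1..n} (\<lambda>_. P)) (\<lambda>\<omega>. \<lambda>i\<in>{1..n}. \<rho> (W i \<omega>)) =
      PiM {1..n} (\<lambda>i. distr M P (\<lambda>\<omega>. \<rho> (W i \<omega>)))"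
    using n V by (subst (asm) M.indep_vars_iff_distr_eq_PiM') auto
  also have "\<dots> = PiM {1..n} (\<lambda>_. P)" by (intro PiM_cong refl distr_\<rho>) auto
  finally show "distr M (PiM {1..n} (\<lambda>_. P)) (D n) = PiM {1..n} (\<lambda>_. P)"
    by (simp add: D_eq[abs_def])
qed

text \<open>Where gstar (X) > L, the bound on \<open>Y\<close> forces \<open>Z\<close> < 0; but
  \<open>Z\<close> is centred and independent of \<open>X\<close>, so its integral over this event
  is 0 and the event is null. The other claims are factorised expectations, using that the variance
  of the centred \<open>Z\<close> is the mean of its square.\<close>

lemma regression_model_moments:
  fixes M :: "'w measure" and X :: "'w \<Rightarrow> 'x::topological_space" and Y Z :: "'w \<Rightarrow> real"
    and gstar :: "'x \<Rightarrow> real" and \<sigma> L :: real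
  assumes M: "prob_space M" and X[measurable]: "X \<in> borel_measurable M"
    and Z[measurable]: "Z \<in> borel_measurable M"
    and gstar[measurable]: "gstar \<in> borel_measurable borel"
    and model: "\<forall>\<omega>\<in>space M. Y \<omega> = gstar (X \<omega>) + Z \<omega>"
    and Z1: "integrable M Z" "prob_space.expectation M Z = 0"
    and Z2: "integrable M (\<lambda>\<omega>. (Z \<omega>)\<^sup>2)" "prob_space.variance M Z = \<sigma>\<^sup>2"
    and indep: "prob_space.indep_set M {X -` A \<inter> space M | A. A \<in> sets borel}
           {Z -` A \<inter> space M | A. A \<in> sets borel}"
    and YL: "AE \<omega> in M. \<bar>Y \<omega>\<bar> \<le> L"
  shows "AE \<omega> in M. \<bar>gstar (X \<omega>)\<bar> \<le> L"
    and "\<And>h. h \<in> borel_measurable borel \<Longrightarrow> (\<And>x. \<bar>h x\<bar> \<le> c) \<Longrightarrow> (\<integral>\<omega>. Z \<omega> * h (X \<omega>) \<partial>M) = 0"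
    and "\<And>h. h \<in> borel_measurable borel \<Longrightarrow> (\<And>x. \<bar>h x\<bar> \<le> c) \<Longrightarrow> (\<integral>\<omega>. ((Z \<omega>)\<^sup>2 - \<sigma>\<^sup>2) * h (X \<omega>) \<partial>M) = 0"
proof -
  interpret M: prob_space M by fact
  have Y: "Y \<omega> = gstar (X \<omega>) + Z \<omega>" if "\<omega> \<in> space M" for \<omega> using model that by blast
  have stable: "Int_stable {f -` A \<inter> space M | A. A \<in> sets borel}" for f :: "'w \<Rightarrow> 'b::topological_space"
  proof (rule Int_stableI, clarsimp)
    fix A B :: "'b set" assume "A \<in> sets borel" "B \<in> sets borel"
    then show "\<exists>C. f -` A \<inter> space M \<inter> (f -` B \<inter> space M) = f -` C \<inter> space M \<and> C \<in> sets borel"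
      by (intro exI[of _ "A \<inter> B"]) auto
  qed
  have prod: "(\<integral>\<omega>. k (Z \<omega>) * h (X \<omega>) \<partial>M) = (\<integral>\<omega>. k (Z \<omega>) \<partial>M) * (\<integral>\<omega>. h (X \<omega>) \<partial>M)"
    if h: "h \<in> borel_measurable borel" "\<And>x. \<bar>h x\<bar> \<le> c" and k: "k \<in> borel_measurable borel" "integrable M (\<lambda>\<omega>. k (Z \<omega>))"
    for h :: "'x \<Rightarrow> real" and c and k :: "real \<Rightarrow> real"
  proof -
    note h(1)[measurable]
    have hX: "\<exists>B. (h \<circ> X) -` A \<inter> space M = X -` B \<inter> space M \<and> B \<in> sets borel" if "A \<in> sets borel" for A
      using measurable_sets[OF h(1) that] by (intro exI[of _ "h -` A"]) (auto simp: vimage_comp)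
    have kZ: "\<exists>B. (k \<circ> Z) -` A \<inter> space M = Z -` B \<inter> space M \<and> B \<in> sets borel" if "A \<in> sets borel" for A
      using measurable_sets[OF k(1) that] by (intro exI[of _ "k -` A"]) (auto simp: vimage_comp)
    have "M.indep_set {(h \<circ> X) -` A \<inter> space M | A. A \<in> sets borel} {(k \<circ> Z) -` A \<inter> space M | A. A \<in> sets borel}"
    proof (rule M.indep_setI)
      fix a b assume "a \<in> {(h \<circ> X) -` A \<inter> space M | A. A \<in> sets borel}" "b \<in> {(k \<circ> Z) -` A \<inter> space M | A. A \<in> sets borel}"
      then have "a \<in> {X -` A \<inter> space M | A. A \<in> sets borel}" "b \<in> {Z -` A \<inter> space M | A. A \<in> sets borel}"
        using hX kZ by auto
      then show "M.prob (a \<inter> b) = M.prob a * M.prob b" by (rule M.indep_setD[OF indep])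
    qed (use k(1) in auto)
    then have "M.indep_var borel (h \<circ> X) borel (k \<circ> Z)"
      unfolding M.indep_var_eq using M.indep_set_sigma_sets[OF _ stable stable] k(1) by simp
    moreover have "integrable M (h \<circ> X)"
      using h(2) by (intro M.integrable_const_bound[of _ c] AE_I2) (auto simp: o_def)
    ultimately show ?thesis
      using M.indep_var_lebesgue_integral[of "h \<circ> X" "k \<circ> Z"] k(2) by (simp add: o_def mult.commute)
  qed
  show zero: "(\<integral>\<omega>. Z \<omega> * h (X \<omega>) \<partial>M) = 0"
    if h: "h \<in> borel_measurable borel" "\<And>x. \<bar>h x\<bar> \<le> c" for h c
    using prod[OF h, of "\<lambda>x. x"] Z1 by simp
  show "(\<integral>\<omega>. ((Z \<omega>)\<^sup>2 - \<sigma>\<^sup>2) * h (X \<omega>) \<partial>M) = 0"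
    if h: "h \<in> borel_measurable borel" "\<And>x. \<bar>h x\<bar> \<le> c" for h c
    using prod[OF h, of "\<lambda>x. x\<^sup>2 - \<sigma>\<^sup>2"] Z1 Z2 by (simp add: M.prob_space)
  \<comment> \<open>The factor \<open>s\<close> serves both tails; a nonnegative function with
    integral 0 vanishes almost everywhere.\<close>
  have half: "AE \<omega> in M. X \<omega> \<notin> A"
    if [measurable]: "A \<in> sets borel" and neg: "AE \<omega> in M. X \<omega> \<in> A \<longrightarrow> s * Z \<omega> > 0" for A and s :: real
  proof -
    have "(\<integral>\<omega>. s * Z \<omega> * indicator A (X \<omega>) \<partial>M) = 0"
      using zero[of "indicator A" 1] by (simp add: mult.assoc)
    moreover have "AE \<omega> in M. 0 \<le> s * Z \<omega> * indicator A (X \<omega>)"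
      using neg by eventually_elim (auto simp: indicator_def)
    moreover have "integrable M (\<lambda>\<omega>. s * Z \<omega> * indicator A (X \<omega>))"
      using Z1(1) by (intro Bochner_Integration.integrable_bound[OF integrable_mult_right[OF Z1(1), of s]] AE_I2)
        (auto simp: indicator_def)
    ultimately have "AE \<omega> in M. s * Z \<omega> * indicator A (X \<omega>) = 0"
      by (subst (asm) integral_nonneg_eq_0_iff_AE) auto
    with neg show ?thesis by eventually_elim (auto simp: indicator_def)
  qed
  have "AE \<omega> in M. X \<omega> \<notin> {x. gstar x > L}"
  proof (rule half[of _ "-1"])
    show "AE \<omega> in M. X \<omega> \<in> {x. gstar x > L} \<longrightarrow> - 1 * Z \<omega> > 0"
      using YL AE_space by eventually_elim (auto simp: Y abs_le_iff)
  qed measurable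
  moreover have "AE \<omega> in M. X \<omega> \<notin> {x. gstar x < - L}"
  proof (rule half[of _ 1])
    show "AE \<omega> in M. X \<omega> \<in> {x. gstar x < - L} \<longrightarrow> 1 * Z \<omega> > 0"
      using YL AE_space by eventually_elim (auto simp: Y abs_le_iff)
  qed measurable
  ultimately show "AE \<omega> in M. \<bar>gstar (X \<omega>)\<bar> \<le> L"
    by eventually_elim auto
qed

section \<open>Consistency\<close>

text \<open>Each entry of the minimum cancels one error rate: the inverse square cancels b^2, the
  power of \<open>n\<close> cancels the rate of the deviations. For b = 0 the first product is 0, in
  accordance with the convention.\<close>

lemma redundancy_bound_properties:
  assumes "n \<ge> 1"
  shows "redundancy_bound \<alpha> n b > 0" "b\<^sup>2 * redundancy_bound \<alpha> n b \<le> 1"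
    "real n powr (\<alpha> - 1/2) * redundancy_bound \<alpha> n b \<le> 1"
proof -
  have n: "real n > 0" using assms by simp
  show "redundancy_bound \<alpha> n b > 0" using n by (simp add: redundancy_bound_def)
  show "b\<^sup>2 * redundancy_bound \<alpha> n b \<le> 1"
  proof (cases "b = 0")
    case False
    then have "b\<^sup>2 * redundancy_bound \<alpha> n b \<le> b\<^sup>2 * (1 / b\<^sup>2)"
      by (intro mult_left_mono) (auto simp: redundancy_bound_def)
    then show ?thesis using False by simp
  qed simp
  have "redundancy_bound \<alpha> n b \<le> real n powr (1/2 - \<alpha>)"
    by (simp add: redundancy_bound_def)
  then have "real n powr (\<alpha> - 1/2) * redundancy_bound \<alpha> n b \<le> real n powr (\<alpha> - 1/2) * real n powr (1/2 - \<alpha>)"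
    by (intro mult_left_mono) auto
  also have "\<dots> = 1" using n by (simp flip: powr_add)
  finally show "real n powr (\<alpha> - 1/2) * redundancy_bound \<alpha> n b \<le> 1" .
qed

lemma redundancy_ratio_nonneg: "redundancy_ratio \<C> \<ge> 0"
  by (simp add: redundancy_ratio_def)

text \<open>The factor in brackets is the error rate on covering sets, which the double counting
  multiplies by the ratio; this is where the redundancy condition takes effect.\<close>

lemma redundancy_ratio_scaled_le:
  assumes "n \<ge> 1" and ratio: "\<bar>redundancy_ratio R / redundancy_bound \<alpha> n b\<bar> \<le> \<delta>"
    and "c \<ge> 0" "k \<ge> 0" "\<delta> \<ge> 0"
  shows "(c * b\<^sup>2 + k * real n powr (\<alpha> - 1/2)) * redundancy_ratio R \<le> \<delta> * (c + k)"
proof -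
  define q where "q = real n powr (\<alpha> - 1/2)"
  define B where "B = redundancy_bound \<alpha> n b"
  note B = redundancy_bound_properties[OF \<open>n \<ge> 1\<close>, where \<alpha> = \<alpha> and b = b, folded B_def q_def]
  have "redundancy_ratio R \<le> \<delta> * B"
    using ratio B(1) redundancy_ratio_nonneg[of R] by (simp add: B_def[symmetric] field_simps)
  then have "(c * b\<^sup>2 + k * q) * redundancy_ratio R \<le> (c * b\<^sup>2 + k * q) * (\<delta> * B)"
    using assms by (intro mult_left_mono) (auto simp: q_def)
  also have "\<dots> = \<delta> * (c * (b\<^sup>2 * B) + k * (q * B))" by (simp add: algebra_simps)
  also have "\<dots> \<le> \<delta> * (c * 1 + k * 1)"
    using assms B by (intro mult_left_mono add_mono) auto
  finally show ?thesis by (simp add: q_def)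
qed

lemma abs_emp_mean_le:
  assumes y: "\<And>i. i \<in> {1..n} \<Longrightarrow> \<bar>snd (d i)\<bar> \<le> L" and "n \<ge> 1"
  shows "\<bar>emp_mean n d\<bar> \<le> L"
proof -
  have "\<bar>\<Sum>i=1..n. snd (d i)\<bar> \<le> (\<Sum>i=1..n. \<bar>snd (d i)\<bar>)" by (rule sum_abs)
  also have "\<dots> \<le> n * L" using sum_bounded_above[of "{1..n}" "\<lambda>i. \<bar>snd (d i)\<bar>" L] y by simp
  finally show ?thesis using \<open>n \<ge> 1\<close> by (simp add: emp_mean_def abs_divide field_simps)
qed

text \<open>The deterministic part of the argument, for one sample. A significant set has excess
  variance at most \<beta>^2 (2 L)^2, an insignificant one at most \<epsilon>^2; the noise and the
  error of the variance estimator add \<open>k\<close> times n^(\<alpha> - 1/2). Both kinds of sets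
  pay \<open>k\<close>, hence the 2 in the constant.\<close>

lemma suitable_cells_bound:
  fixes d :: "'d::finite data" and g :: "real ^ 'd \<Rightarrow> real" and s2 v L K K2 \<alpha> \<beta> \<epsilon> \<delta> :: real
    and n :: nat and \<C> :: "(real ^ 'd) set set"
  defines "z \<equiv> \<lambda>i. snd (d i) - g (fst (d i))"
  defines "Cs \<equiv> significant_sets n d s2 \<beta> \<C>" and "Ci \<equiv> insignificant_sets n d s2 \<beta> \<epsilon> \<C>"
  assumes n: "n \<ge> 1" and fin: "finite \<C>" and L: "L \<ge> 0"
    and y: "\<And>i. i \<in> {1..n} \<Longrightarrow> \<bar>snd (d i)\<bar> \<le> L"
    and cov: "\<And>r. r \<in> \<C> \<Longrightarrow> emp_prob n d r > real n powr (-\<alpha>)"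
    and split: "\<C> = Cs \<union> Ci"
    and dev: "\<And>r. r \<in> \<C> \<Longrightarrow> \<bar>\<Sum>i=1..n. z i * indicator r (fst (d i))\<bar> \<le> K * sqrt n"
      "\<And>r. r \<in> \<C> \<Longrightarrow> \<bar>\<Sum>i=1..n. g (fst (d i)) * z i * indicator r (fst (d i))\<bar> \<le> K * sqrt n"
      "\<And>r. r \<in> \<C> \<Longrightarrow> \<bar>\<Sum>i=1..n. ((z i)\<^sup>2 - v) * indicator r (fst (d i))\<bar> \<le> K * sqrt n"
    and s2: "\<bar>s2 - v\<bar> \<le> K2 * real n powr (\<alpha> - 1/2)"
    and ratios: "\<bar>redundancy_ratio Cs / redundancy_bound \<alpha> n \<beta>\<bar> \<le> \<delta>"
      "\<bar>redundancy_ratio Ci / redundancy_bound \<alpha> n \<epsilon>\<bar> \<le> \<delta>"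
    and K: "K \<ge> 0" "K2 \<ge> 0" and \<delta>: "\<delta> \<ge> 0"
  shows "(\<Sum>A\<in>gen_partition \<C>. \<Sum>i=1..n. (emp_cond_exp n d (\<lambda>y. y) A - g (fst (d i)))\<^sup>2 * indicator A (fst (d i)))
    \<le> n * (\<delta> * (4 * L\<^sup>2 + 1 + 2 * (K2 + (2 * L + 3) * K)))
      + 4 * L * (\<Sum>A\<in>gen_partition \<C>. \<bar>\<Sum>i=1..n. z i * indicator A (fst (d i))\<bar>)"
proof -
  define P where "P = gen_partition \<C>"
  define q where "q = real n powr (\<alpha> - 1/2)"
  define k where "k = K2 + (2 * L + 3) * K"
  define E where "E r = emp_cond_exp n d (\<lambda>y. y) r" for r
  define SA where "SA A = (\<Sum>i=1..n. (E A - g (fst (d i)))\<^sup>2 * indicator A (fst (d i)))" for A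
  define Z where "Z A = \<bar>\<Sum>i=1..n. z i * indicator A (fst (d i))\<bar>" for A
  \<comment> \<open>The least squares comparison costs 4 L Z A. Subtracting it once per cell keeps
    it out of the double counting, where it would be multiplied by the redundancy ratio.\<close>
  define T where "T A = max 0 (SA A - 4 * L * Z A)" for A
  have finP: "finite P" unfolding P_def by (rule finite_gen_partition) (rule fin)
  have k: "k \<ge> 0" using K L by (simp add: k_def)
  have EL: "\<bar>E r\<bar> \<le> L" for r unfolding E_def by (rule abs_emp_cond_exp_le) (use y L in auto)
  have q: "q \<ge> 0" by (simp add: q_def)
  \<comment> \<open>By coverage \<open>r\<close> holds more than n^(1 - \<alpha>) points, so sqrt n
    is at most n^(\<alpha> - 1/2) per point of \<open>r\<close>.\<close>
  have count: "sqrt n \<le> q * (\<Sum>i=1..n. indicator r (fst (d i)))" if "r \<in> \<C>" for r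
  proof -
    have "sqrt n = real n powr (1/2)" by (simp add: powr_half_sqrt)
    also have "\<dots> = real n powr ((\<alpha> - 1/2) + (1 + - \<alpha>))" by simp
    also have "\<dots> = q * (real n powr 1 * real n powr (- \<alpha>))"
      by (simp only: powr_add q_def)
    also have "\<dots> \<le> q * (real n * emp_prob n d r)"
      using cov[OF that] q n by (intro mult_left_mono) auto
    also have "real n * emp_prob n d r = (\<Sum>i=1..n. indicator r (fst (d i)))"
      using n by (simp add: emp_prob_def)
    finally show ?thesis .
  qed
  have approx: "(\<Sum>i=1..n. (E r - g (fst (d i)))\<^sup>2 * indicator r (fst (d i)))
      \<le> (\<kappa> + k * q) * (\<Sum>i=1..n. indicator r (fst (d i)))"
    if r: "r \<in> \<C>" and var: "emp_cond_var n d r \<le> s2 + \<kappa>" for r \<kappa>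
  proof -
    define N where "N = (\<Sum>i=1..n. indicator r (fst (d i)) :: real)"
    have N: "N \<ge> 0" unfolding N_def by (intro sum_nonneg) auto
    have "(\<Sum>i=1..n. (E r - g (fst (d i)))\<^sup>2 * indicator r (fst (d i)))
        \<le> (\<kappa> + \<bar>s2 - v\<bar>) * N + (2 * L + 3) * (K * sqrt n)"
      unfolding E_def N_def
      by (rule emp_cell_approximation[OF y L var]) (use dev[OF r] in \<open>auto simp: z_def\<close>)
    also have "\<dots> \<le> (\<kappa> + K2 * q) * N + (2 * L + 3) * (K * (q * N))"
      using s2 N K L count[OF r] by (intro add_mono mult_right_mono mult_left_mono) (auto simp: q_def N_def)
    also have "\<dots> = (\<kappa> + k * q) * N" by (simp add: k_def algebra_simps)
    finally show ?thesis by (simp add: N_def)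
  qed
  have T_le: "T A \<le> (\<Sum>i=1..n. (E r - g (fst (d i)))\<^sup>2 * indicator A (fst (d i)))" for A r
  proof -
    have "SA A \<le> (\<Sum>i=1..n. (E r - g (fst (d i)))\<^sup>2 * indicator A (fst (d i))) + 4 * L * Z A"
      unfolding SA_def Z_def z_def E_def[of A] by (rule emp_cell_least_squares[OF y L EL])
    moreover have "0 \<le> (\<Sum>i=1..n. (E r - g (fst (d i)))\<^sup>2 * indicator A (fst (d i)))"
      by (intro sum_nonneg) auto
    ultimately show ?thesis by (simp add: T_def)
  qed
  have T0: "T A \<ge> 0" for A by (simp add: T_def)
  \<comment> \<open>The empty set has empirical probability 0, so coverage excludes it.\<close>
  have ne: "{} \<notin> \<C>"
    using cov[of "{}"] n by (auto simp: emp_prob_def)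
  have cover: "(\<Sum>A\<in>{A \<in> P. A \<subseteq> \<Union>R}. T A) \<le> n * (\<delta> * (c + k))"
    if R: "R \<subseteq> \<C>" and var: "\<And>r. r \<in> R \<Longrightarrow> emp_cond_var n d r \<le> s2 + c * b\<^sup>2" and c: "c \<ge> 0"
      and ratio: "\<bar>redundancy_ratio R / redundancy_bound \<alpha> n b\<bar> \<le> \<delta>" for R c b
  proof -
    have "(\<Sum>A\<in>{A \<in> P. A \<subseteq> \<Union>R}. T A) \<le> n * (c * b\<^sup>2 + k * q) * redundancy_ratio R"
      unfolding P_def
    proof (rule covering_approximation[OF fin R, where x = "\<lambda>i. fst (d i)" and u = "\<lambda>i. g (fst (d i))" and \<theta> = E])
      show "{} \<notin> R" using ne R by blast
      show "0 \<le> c * b\<^sup>2 + k * q" using c k q by simp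
      show "(\<Sum>i=1..n. (E r - g (fst (d i)))\<^sup>2 * indicator r (fst (d i)))
          \<le> (c * b\<^sup>2 + k * q) * (\<Sum>i=1..n. indicator r (fst (d i)))" if "r \<in> R" for r
        using that R var[OF that] by (intro approx) auto
    qed (rule T0 T_le)+
    also have "\<dots> \<le> n * (\<delta> * (c + k))"
      using redundancy_ratio_scaled_le[OF n ratio c k \<delta>] by (simp add: q_def mult_left_mono mult.assoc)
    finally show ?thesis .
  qed
  have cover_s: "(\<Sum>A\<in>{A \<in> P. A \<subseteq> \<Union>Cs}. T A) \<le> n * (\<delta> * (4 * L\<^sup>2 + k))"
  proof (rule cover)
    fix r assume "r \<in> Cs"
    then have r: "sqrt (max (emp_cond_var n d r - s2) 0) \<le> \<beta> * \<bar>E r - emp_mean n d\<bar>"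
      by (simp add: Cs_def significant_sets_def E_def)
    have "emp_cond_var n d r - s2 \<le> max (emp_cond_var n d r - s2) 0" by simp
    also have "\<dots> = (sqrt (max (emp_cond_var n d r - s2) 0))\<^sup>2" by simp
    also have "\<dots> \<le> (\<beta> * \<bar>E r - emp_mean n d\<bar>)\<^sup>2" using r by (intro power_mono) auto
    also have "\<dots> = \<beta>\<^sup>2 * \<bar>E r - emp_mean n d\<bar>\<^sup>2" by (simp add: power_mult_distrib)
    also have "\<dots> \<le> \<beta>\<^sup>2 * (2 * L)\<^sup>2"
    proof (intro mult_left_mono power_mono)
      have "\<bar>emp_mean n d\<bar> \<le> L" by (rule abs_emp_mean_le) (use y n in auto)
      then show "\<bar>E r - emp_mean n d\<bar> \<le> 2 * L" using EL[of r] by linarith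
    qed auto
    finally show "emp_cond_var n d r \<le> s2 + 4 * L\<^sup>2 * \<beta>\<^sup>2" by (simp add: power_mult_distrib mult_ac)
  qed (use ratios in \<open>auto simp: Cs_def significant_sets_def\<close>)
  have cover_i: "(\<Sum>A\<in>{A \<in> P. A \<subseteq> \<Union>Ci}. T A) \<le> n * (\<delta> * (1 + k))"
  proof (rule cover)
    fix r assume "r \<in> Ci"
    then have r: "sqrt (max (emp_cond_var n d r - s2) 0) \<le> \<epsilon>"
      by (simp add: Ci_def insignificant_sets_def)
    have "emp_cond_var n d r - s2 \<le> max (emp_cond_var n d r - s2) 0" by simp
    also have "\<dots> = (sqrt (max (emp_cond_var n d r - s2) 0))\<^sup>2" by simp
    also have "\<dots> \<le> \<epsilon>\<^sup>2" using r by (intro power_mono) auto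
    finally show "emp_cond_var n d r \<le> s2 + 1 * \<epsilon>\<^sup>2" by simp
  qed (use ratios in \<open>auto simp: Ci_def insignificant_sets_def\<close>)
  \<comment> \<open>A cell may lie in sets of both kinds and be counted twice, which is harmless
    since \<open>T\<close> is nonnegative.\<close>
  have "P \<subseteq> {A \<in> P. A \<subseteq> \<Union>Cs} \<union> {A \<in> P. A \<subseteq> \<Union>Ci}"
  proof
    fix A assume A: "A \<in> P"
    then obtain x where x: "x \<in> A" using gen_partition_nonempty[of A \<C>] by (auto simp: P_def)
    then obtain r where r: "r \<in> \<C>" "x \<in> r" using A Union_gen_partition[of \<C>] by (auto simp: P_def)
    have "A \<subseteq> r" using gen_partition_subset_iff[of A \<C> x r] A x r by (simp add: P_def)
    moreover have "r \<in> Cs \<or> r \<in> Ci" using split r by blast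
    ultimately show "A \<in> {A \<in> P. A \<subseteq> \<Union>Cs} \<union> {A \<in> P. A \<subseteq> \<Union>Ci}" using A by auto
  qed
  then have "(\<Sum>A\<in>P. T A) \<le> (\<Sum>A\<in>{A \<in> P. A \<subseteq> \<Union>Cs} \<union> {A \<in> P. A \<subseteq> \<Union>Ci}. T A)"
    using finP by (intro sum_mono2) (auto simp: T_def)
  also have "\<dots> \<le> (\<Sum>A\<in>{A \<in> P. A \<subseteq> \<Union>Cs}. T A) + (\<Sum>A\<in>{A \<in> P. A \<subseteq> \<Union>Ci}. T A)"
    using finP by (subst sum_Un) (auto intro!: sum_nonneg simp: T_def)
  also have "\<dots> \<le> n * (\<delta> * (4 * L\<^sup>2 + k)) + n * (\<delta> * (1 + k))"
    using cover_s cover_i by (rule add_mono)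
  finally have T_sum: "(\<Sum>A\<in>P. T A) \<le> n * (\<delta> * (4 * L\<^sup>2 + 1 + 2 * k))" by (simp add: algebra_simps)
  have "(\<Sum>A\<in>P. SA A) \<le> (\<Sum>A\<in>P. T A + 4 * L * Z A)"
    by (intro sum_mono) (auto simp: T_def)
  also have "\<dots> = (\<Sum>A\<in>P. T A) + 4 * L * (\<Sum>A\<in>P. Z A)"
    by (simp add: sum.distrib sum_distrib_left)
  finally show ?thesis using T_sum by (simp add: SA_def Z_def P_def E_def k_def)
qed

text \<open>With \<tau> = \<gamma> / 8, eventually G n \<le> exp (\<tau> n) and, as 4 \<le> exp 2,
  4^(m n) \<le> exp (2 \<tau> n). The square is at most exp (6 \<tau> n) = exp (3 \<gamma> n / 4),
  which leaves exp (- \<gamma> n / 4).\<close>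

lemma subexponential_complexity:
  fixes G :: "nat \<Rightarrow> nat" and m :: "nat \<Rightarrow> enat" and \<gamma> \<eta> :: real
  assumes m: "(\<lambda>n. ereal_of_enat (m n) / ereal (real n)) \<longlonglongrightarrow> 0"
    and G: "(\<lambda>n. ln (real (G n))) \<in> o(\<lambda>n. real n)" and \<gamma>: "\<gamma> > 0" and \<eta>: "\<eta> > 0"
  shows "\<forall>\<^sub>F n in sequentially. m n \<le> enat (the_enat (m n)) \<and>
    2 * (G n * 4 ^ the_enat (m n))\<^sup>2 * exp (- \<gamma> * n) \<le> \<eta>"
proof -
  define \<tau> where "\<tau> = \<gamma> / 8"
  have \<tau>: "\<tau> > 0" using \<gamma> by (simp add: \<tau>_def)
  have 1: "\<forall>\<^sub>F n in sequentially. ereal_of_enat (m n) / ereal (real n) < ereal \<tau>"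
    using m \<tau> by (intro order_tendstoD(2)) auto
  have 2: "\<forall>\<^sub>F n in sequentially. norm (ln (real (G n))) \<le> \<tau> * norm (real n)"
    using G \<tau> by (rule landau_o.smallD)
  have "(\<lambda>n. 2 * exp (- (\<gamma> / 4) * real n)) \<longlonglongrightarrow> 2 * 0"
  proof (intro tendsto_mult tendsto_const)
    have "filterlim (\<lambda>n. (\<gamma> / 4) * real n) at_top sequentially"
      using \<gamma> by (intro filterlim_tendsto_pos_mult_at_top[OF tendsto_const] filterlim_real_sequentially) auto
    then have "filterlim (\<lambda>n. - ((\<gamma> / 4) * real n)) at_bot sequentially"
      by (simp add: filterlim_uminus_at_bot)
    then show "(\<lambda>n. exp (- (\<gamma> / 4) * real n)) \<longlonglongrightarrow> 0"
      using filterlim_compose[OF exp_at_bot] by simp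
  qed
  then have 3: "\<forall>\<^sub>F n in sequentially. 2 * exp (- (\<gamma> / 4) * real n) < \<eta>"
    using \<eta> by (intro order_tendstoD(2)) auto
  show ?thesis
    using 1 2 3 eventually_gt_at_top[of 0]
  proof eventually_elim
    case (elim n)
    \<comment> \<open>An infinite number of cells would make the quotient infinite, so
      \<open>the_enat\<close> is meaningful here.\<close>
    obtain k where k: "m n = enat k"
    proof (cases "m n")
      case infinity
      then show ?thesis using elim by simp
    qed (use that in auto)
    have km: "real k \<le> \<tau> * n"
      using elim k by (simp add: field_simps)
    have G_le: "real (G n) \<le> exp (\<tau> * n)"
    proof (cases "G n = 0")
      case False
      then have "real (G n) = exp (ln (real (G n)))" by simp
      also have "\<dots> \<le> exp (\<tau> * n)" using elim(2) by simp
      finally show ?thesis .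
    qed simp
    have "(4::real) = exp (ln 4)" by simp
    also have "\<dots> \<le> exp 2"
    proof -
      have "(1 + 1 :: real) ^ 2 \<le> exp 1 ^ 2" by (intro power_mono exp_ge_add_one_self) auto
      then show ?thesis by (simp flip: exp_of_nat_mult)
    qed
    finally have "(4::real) ^ k \<le> exp 2 ^ k" by (intro power_mono) auto
    also have "\<dots> = exp (2 * k)" by (simp add: mult.commute flip: exp_of_nat_mult)
    also have "\<dots> \<le> exp (2 * (\<tau> * n))" using km by simp
    finally have "real (G n) * 4 ^ k \<le> exp (\<tau> * n) * exp (2 * (\<tau> * n))"
      using G_le by (intro mult_mono) auto
    also have "\<dots> = exp (3 * (\<tau> * n))" by (simp flip: exp_add)
    finally have "(real (G n) * 4 ^ k)\<^sup>2 \<le> (exp (3 * (\<tau> * n)))\<^sup>2"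
      by (intro power_mono) auto
    also have "\<dots> = exp (6 * (\<tau> * n))" by (simp add: power2_eq_square flip: exp_add)
    finally have "2 * (real (G n) * 4 ^ k)\<^sup>2 * exp (- \<gamma> * n) \<le> 2 * exp (6 * (\<tau> * n)) * exp (- \<gamma> * n)"
      by (intro mult_right_mono mult_left_mono) auto
    also have "\<dots> = 2 * exp (- (\<gamma> / 4) * n)"
      by (simp add: \<tau>_def mult.assoc flip: exp_add)
    also have "\<dots> \<le> \<eta>" using elim(3) by simp
    finally show ?case using k by simp
  qed
qed

theorem theorem2p1:
  fixes M :: "'w measure"
    and X :: "'w \<Rightarrow> real ^ 'd::finite" and Y Z :: "'w \<Rightarrow> real"
    and gstar :: "real ^ 'd \<Rightarrow> real" and \<sigma> L \<alpha> :: real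
    and Q :: "((real ^ 'd) \<times> real) measure" and S :: "((real ^ 'd) \<times> real) set"
    and Xs :: "nat \<Rightarrow> 'w \<Rightarrow> real ^ 'd" and Ys :: "nat \<Rightarrow> 'w \<Rightarrow> real"
    and D :: "nat \<Rightarrow> 'w \<Rightarrow> 'd data"
    and s2 :: "nat \<Rightarrow> 'd data \<Rightarrow> real"
    and \<C> :: "nat \<Rightarrow> 'd data \<Rightarrow> (real ^ 'd) set set"
    and \<F> :: "nat \<Rightarrow> (real ^ 'd) set set set"
    and \<B> :: "((real ^ 'd) \<times> real) set set"
  assumes "prob_space M"
    and "X \<in> borel_measurable M" and "Y \<in> borel_measurable M" and "Z \<in> borel_measurable M"
    and "Q = distr M borel (\<lambda>\<omega>. (X \<omega>, Y \<omega>))"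
    and "gstar \<in> borel_measurable borel"
    and "\<forall>\<omega>\<in>space M. Y \<omega> = gstar (X \<omega>) + Z \<omega>"
    and "integrable M Z" and "prob_space.expectation M Z = 0"
    and "integrable M (\<lambda>\<omega>. (Z \<omega>)\<^sup>2)" and "prob_space.variance M Z = \<sigma>\<^sup>2"
    and "prob_space.indep_set M {X -` A \<inter> space M | A. A \<in> sets borel}
           {Z -` A \<inter> space M | A. A \<in> sets borel}"
    and "L > 0" and "S = UNIV \<times> {-L..L}" and "measure Q S = 1"
    and "prob_space.indep_vars M (\<lambda>_. borel) (\<lambda>i \<omega>. (Xs i \<omega>, Ys i \<omega>)) {1..}"
    and "\<forall>i\<ge>1. distr M borel (\<lambda>\<omega>. (Xs i \<omega>, Ys i \<omega>)) = Q"
    and "D = (\<lambda>n \<omega>. \<lambda>i\<in>{1..n}. (Xs i \<omega>, Ys i \<omega>))"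
    and "0 \<le> \<alpha>" and "\<alpha> < 1/2"
    and "alpha_suitable M S D (\<sigma>\<^sup>2) \<alpha> s2 \<C>"
    and "big_OP M (\<lambda>n \<omega>. x_marginal Q (- \<Union>(\<C> n (D n \<omega>)))) (\<lambda>n. real n powr (\<alpha> - 1/2))"
    and "\<forall>n\<ge>1. \<forall>P\<in>\<F> n. finite P \<and> disjoint P"
    and "\<forall>n\<ge>1. refinement (\<F> n) ((\<lambda>d. gen_partition (\<C> n d)) ` data_space n S)"
    and "(\<lambda>n. ereal_of_enat (max_cells (\<F> n)) / ereal (real n)) \<longlonglongrightarrow> 0"
    and "(\<lambda>n. ln (real (growth_number n (\<F> n)))) \<in> o(\<lambda>n. real n)"
    and "donsker_sets (restrict_space Q S) \<B>"
    and "\<forall>n\<ge>1. \<forall>d\<in>data_space n S. \<forall>r\<in>\<C> n d. (r \<times> UNIV) \<inter> S \<in> \<B>"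
    and "big_OP M (\<lambda>n \<omega>. \<bar>s2 n (D n \<omega>) - \<sigma>\<^sup>2\<bar>) (\<lambda>n. real n powr (\<alpha> - 1/2))"
  shows "little_oP M
           (\<lambda>n \<omega>. excess_risk Q gstar (partition_estimator n (D n \<omega>) (\<C> n (D n \<omega>))))
           (\<lambda>_ _. 1)"
proof -
  note M = assms(1)
  interpret M: prob_space M by fact
  note X[measurable] = assms(2) and Y[measurable] = assms(3) and Z[measurable] = assms(4)
  note Q_def = assms(5) and gstar[measurable] = assms(6) and Y_eq = assms(7)
  note L = assms(13) and S_def = assms(14) and suitable = assms(21)

  \<comment> \<open>Sample and law restricted to \<open>S\<close>\<close>
  define W where "W i \<omega> = (Xs i \<omega>, Ys i \<omega>)" for i \<omega>
  have D_eq: "D n \<omega> = (\<lambda>i\<in>{1..n}. W i \<omega>)" for n \<omega> by (simp add: assms(18) W_def)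
  have indep: "M.indep_vars (\<lambda>_. borel) W {1..}" using assms(16) by (simp add: W_def[abs_def])
  have dist: "\<forall>i\<ge>1. distr M borel (W i) = Q" using assms(17) by (simp add: W_def[abs_def])
  have [measurable]: "fst \<in> borel_measurable (borel :: ((real ^ 'd) \<times> real) measure)"
    "snd \<in> borel_measurable (borel :: ((real ^ 'd) \<times> real) measure)"
    by (intro borel_measurable_continuous_onI continuous_intros)+
  have XY[measurable]: "(\<lambda>\<omega>. (X \<omega>, Y \<omega>)) \<in> borel_measurable M" by (rule borel_measurable_Pair[OF X Y])
  have prob_Q: "prob_space Q" unfolding Q_def by (rule M.prob_space_distr[OF XY])
  interpret Q: prob_space Q by fact
  have sets_Q: "sets Q = sets borel" and space_Q: "space Q = UNIV" by (simp_all add: Q_def)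
  have S_borel[measurable]: "S \<in> sets borel"
    unfolding S_def by (intro borel_closed closed_Times) auto
  have s0: "(0, 0) \<in> S" using L by (simp add: S_def)
  define P where "P = restrict_space Q S"
  \<comment> \<open>Agrees with \<open>D n\<close> almost surely and lies in
    \<open>data_space n S\<close> everywhere, where the hypotheses on \<open>\<C>\<close>
    apply.\<close>
  define D' where "D' n \<omega> = (\<lambda>i\<in>{1..n}. if W i \<omega> \<in> S then W i \<omega> else (0, 0))" for n \<omega>
  note law = restricted_sample_law[OF M indep dist S_borel assms(15) s0, folded P_def]
  have D'_meas: "D' n \<in> M \<rightarrow>\<^sub>M PiM {1..n} (\<lambda>_. P)" for n
    using law(5)[of n] unfolding D'_def[abs_def] .
  have D'_law: "distr M (PiM {1..n} (\<lambda>_. P)) (D' n) = PiM {1..n} (\<lambda>_. P)" if "n \<ge> 1" for n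
    using law(6)[OF that] unfolding D'_def[abs_def] .
  note P = law(1) and sets_P = law(2) and space_P = law(3)
  interpret P: prob_space P by (rule P)
  have P_meas: "h \<in> P \<rightarrow>\<^sub>M N" if "h \<in> borel \<rightarrow>\<^sub>M N" for h and N :: "'n measure"
    using measurable_restrict_space1[OF that, of S] measurable_cong_sets[OF sets_P refl, of N] by blast
  have fst_P: "fst \<in> P \<rightarrow>\<^sub>M borel" by (rule P_meas) measurable
  have D'_space: "D' n \<omega> \<in> data_space n S" for n \<omega>
    using s0 by (auto simp: D'_def data_space_def)
  have D'_AE: "AE \<omega> in M. \<forall>n\<ge>1. D n \<omega> = D' n \<omega>"
    using law(4) by eventually_elim (auto simp: D_eq D'_def fun_eq_iff)
  have AE_XY: "AE \<omega> in M. (X \<omega>, Y \<omega>) \<in> S"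
  proof -
    have "AE z in Q. z \<in> S" using assms(15) Q.AE_in_set_eq_1[of S] S_borel sets_Q by simp
    then show ?thesis unfolding Q_def by (subst (asm) AE_distr_iff) auto
  qed
  then have YL: "AE \<omega> in M. \<bar>Y \<omega>\<bar> \<le> L" by eventually_elim (auto simp: S_def)
  have Y_eq': "Y \<omega> = gstar (X \<omega>) + Z \<omega>" if "\<omega> \<in> space M" for \<omega> using Y_eq that by blast

  \<comment> \<open>Truncated regression function, noise and excess risk\<close>
  note moments = regression_model_moments[OF M X Z gstar Y_eq assms(8,9,10,11,12) YL]
  \<comment> \<open>Bounded everywhere, and equal to \<open>gstar\<close> at \<open>X\<close> almost
    surely.\<close>
  define g where "g x = max (- L) (min L (gstar x))" for x
  have g[measurable]: "g \<in> borel_measurable borel" unfolding g_def by measurable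
  have gL: "\<bar>g x\<bar> \<le> L" for x using L by (auto simp: g_def)
  have g2L: "(g x)\<^sup>2 \<le> L\<^sup>2" for x using gL[of x] L by (simp add: abs_le_square_iff[symmetric])
  have AE_g: "AE \<omega> in M. gstar (X \<omega>) = g (X \<omega>)" using moments(1) by eventually_elim (auto simp: g_def)
  \<comment> \<open>The noise as a function of the observation, so that noise sums are empirical
    sums under \<open>P\<close>.\<close>
  define z where "z v = snd v - g (fst v)" for v :: "(real ^ 'd) \<times> real"
  have z[measurable]: "z \<in> borel_measurable borel" unfolding z_def by measurable
  have AE_z: "AE \<omega> in M. z (X \<omega>, Y \<omega>) = Z \<omega>"
    using AE_g AE_space by eventually_elim (simp add: z_def Y_eq')
  have zL: "\<bar>z v\<bar> \<le> 2 * L" if "v \<in> S" for v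
    using that gL[of "fst v"] by (auto simp: z_def S_def abs_le_iff)
  have int_P: "(\<integral>v. h v \<partial>P) = (\<integral>\<omega>. h (X \<omega>, Y \<omega>) \<partial>M)"
    if [measurable]: "h \<in> borel_measurable borel" for h :: "_ \<Rightarrow> real"
  proof -
    have "(\<integral>v. h v \<partial>P) = (\<integral>v. indicator S v *\<^sub>R h v \<partial>Q)"
      unfolding P_def using sets_Q S_borel by (intro integral_restrict_space) (simp add: space_Q)
    also have "\<dots> = (\<integral>\<omega>. indicator S (X \<omega>, Y \<omega>) *\<^sub>R h (X \<omega>, Y \<omega>) \<partial>M)"
      unfolding Q_def by (rule integral_distr) measurable
    also have "\<dots> = (\<integral>\<omega>. h (X \<omega>, Y \<omega>) \<partial>M)"
      using AE_XY by (intro integral_cong_AE) (auto elim!: eventually_mono)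
    finally show ?thesis .
  qed
  have moment_z: "(\<integral>v. z v * h (fst v) \<partial>P) = 0"
    if h[measurable]: "h \<in> borel_measurable borel" and hc: "\<And>x. \<bar>h x\<bar> \<le> c" for h c
  proof -
    have "(\<integral>v. z v * h (fst v) \<partial>P) = (\<integral>\<omega>. z (X \<omega>, Y \<omega>) * h (X \<omega>) \<partial>M)" by (subst int_P) simp_all
    also have "\<dots> = (\<integral>\<omega>. Z \<omega> * h (X \<omega>) \<partial>M)"
      using AE_z by (intro integral_cong_AE) (auto elim!: eventually_mono)
    also have "\<dots> = 0" by (rule moments(2)[OF h hc])
    finally show ?thesis .
  qed
  have moment_z2: "(\<integral>v. ((z v)\<^sup>2 - \<sigma>\<^sup>2) * h (fst v) \<partial>P) = 0"
    if h[measurable]: "h \<in> borel_measurable borel" and hc: "\<And>x. \<bar>h x\<bar> \<le> c" for h c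
  proof -
    have "(\<integral>v. ((z v)\<^sup>2 - \<sigma>\<^sup>2) * h (fst v) \<partial>P) = (\<integral>\<omega>. ((z (X \<omega>, Y \<omega>))\<^sup>2 - \<sigma>\<^sup>2) * h (X \<omega>) \<partial>M)" by (subst int_P) simp_all
    also have "\<dots> = (\<integral>\<omega>. ((Z \<omega>)\<^sup>2 - \<sigma>\<^sup>2) * h (X \<omega>) \<partial>M)"
      using AE_z by (intro integral_cong_AE) (auto elim!: eventually_mono)
    also have "\<dots> = 0" by (rule moments(3)[OF h hc])
    finally show ?thesis .
  qed
  \<comment> \<open>The mixed term 2 Z (h - g)(X) has mean 0, since \<open>h - g\<close> is a
    bounded function of \<open>X\<close>.\<close>
  have excess: "excess_risk Q gstar h = (\<integral>v. (h (fst v) - g (fst v))\<^sup>2 \<partial>P)"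
    if h[measurable]: "h \<in> borel_measurable borel" and hL: "\<And>x. \<bar>h x\<bar> \<le> L" for h
  proof -
    have risk_M: "risk Q k = (\<integral>\<omega>. (k (X \<omega>) - Y \<omega>)\<^sup>2 \<partial>M)"
      if [measurable]: "k \<in> borel_measurable borel" for k
      unfolding risk_def Q_def by (subst integral_distr) simp_all
    define u where "u x = h x - g x" for x
    have u[measurable]: "u \<in> borel_measurable borel" unfolding u_def by measurable
    have uL: "\<bar>u x\<bar> \<le> 2 * L" for x using hL[of x] gL[of x] by (simp add: u_def abs_le_iff)
    have u2L: "(u x)\<^sup>2 \<le> (2 * L)\<^sup>2" for x
      using uL[of x] L by (intro abs_le_square_iff[THEN iffD1]) simp
    have int_u2: "integrable M (\<lambda>\<omega>. (u (X \<omega>))\<^sup>2)"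
      using u2L by (intro M.integrable_const_bound[of _ "(2 * L)\<^sup>2"] AE_I2) auto
    have int_Zu: "integrable M (\<lambda>\<omega>. Z \<omega> * u (X \<omega>))"
    proof (rule Bochner_Integration.integrable_bound)
      show "integrable M (\<lambda>\<omega>. 2 * L * Z \<omega>)" using assms(8) by simp
      show "AE \<omega> in M. norm (Z \<omega> * u (X \<omega>)) \<le> norm (2 * L * Z \<omega>)"
      proof (rule AE_I2)
        fix \<omega>
        have "\<bar>Z \<omega>\<bar> * \<bar>u (X \<omega>)\<bar> \<le> \<bar>Z \<omega>\<bar> * (2 * L)" by (intro mult_left_mono uL) auto
        then show "norm (Z \<omega> * u (X \<omega>)) \<le> norm (2 * L * Z \<omega>)"
          using L by (simp add: abs_mult mult_ac)
      qed
    qed measurable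
    have "risk Q h = (\<integral>\<omega>. (u (X \<omega>))\<^sup>2 - 2 * (Z \<omega> * u (X \<omega>)) + (Z \<omega>)\<^sup>2 \<partial>M)"
      unfolding risk_M[OF h] using AE_g AE_space
      by (intro integral_cong_AE)
        (auto elim!: eventually_elim2 simp: Y_eq' u_def power2_eq_square algebra_simps)
    also have "\<dots> = (\<integral>\<omega>. (u (X \<omega>))\<^sup>2 \<partial>M) - 2 * (\<integral>\<omega>. Z \<omega> * u (X \<omega>) \<partial>M) + (\<integral>\<omega>. (Z \<omega>)\<^sup>2 \<partial>M)"
      using int_u2 int_Zu assms(10) by simp
    also have "(\<integral>\<omega>. Z \<omega> * u (X \<omega>) \<partial>M) = 0" by (rule moments(2)[OF u uL])
    also have "(\<integral>\<omega>. (Z \<omega>)\<^sup>2 \<partial>M) = risk Q gstar"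
      unfolding risk_M[OF gstar] by (intro Bochner_Integration.integral_cong) (auto simp: Y_eq')
    also have "(\<integral>\<omega>. (u (X \<omega>))\<^sup>2 \<partial>M) = (\<integral>v. (u (fst v))\<^sup>2 \<partial>P)" by (subst int_P) simp_all
    finally show ?thesis by (simp add: excess_risk_def u_def)
  qed

  \<comment> \<open>Probability bounds for cells and covering sets\<close>
  have ddc: "data_dependent_collection S n (\<C> n)" if "n \<ge> 1" for n
    using suitable that by (simp add: alpha_suitable_def)
  let ?cell = "\<lambda>w n \<omega>. cell_dev P n (D' n \<omega>) (gen_partition (\<C> n (D' n \<omega>))) w"
  let ?dev = "\<lambda>w K (n :: nat) \<omega>. \<forall>B\<in>\<B>. \<bar>(\<Sum>i=1..n. w (D' n \<omega> i) * indicator B (D' n \<omega> i))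
    - n * (\<integral>v. w v * indicator B v \<partial>P)\<bar> \<le> K * sqrt n"
  have likely_cells: "likely M \<eta> (\<lambda>n \<omega>. ?cell w n \<omega> < t)"
    if w[measurable]: "w \<in> borel_measurable borel" and wc: "\<forall>v\<in>S. \<bar>w v\<bar> \<le> c"
      and c: "c > 0" and t: "t > 0" and \<eta>: "\<eta> > 0" for w c t \<eta>
  proof (rule likely_sample[where N = "\<lambda>n. PiM {1..n} (\<lambda>_. P)"])
    \<comment> \<open>The rate in the exponent of \<open>cell_dev_tail\<close>; four times it is the
      rate in \<open>large\<close>, and x \<le> exp x reduces that condition to 4 \<le> 4 \<gamma>
      n.\<close>
    define \<gamma> where "\<gamma> = t\<^sup>2 / (32 * c\<^sup>2)"
    have \<gamma>: "\<gamma> > 0" using c t by (simp add: \<gamma>_def)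
    obtain n0 :: nat where n0: "4 / (4 * \<gamma>) \<le> n0" using real_arch_simple by blast
    have "\<forall>\<^sub>F n in sequentially. n \<ge> max 1 n0" by (rule eventually_ge_at_top)
    then show "\<forall>\<^sub>F n in sequentially. \<exists>G\<in>sets (PiM {1..n} (\<lambda>_. P)).
        1 - \<eta> \<le> measure (PiM {1..n} (\<lambda>_. P)) G \<and>
        (\<forall>d\<in>G. cell_dev P n d (gen_partition (\<C> n d)) w < t)"
      using subexponential_complexity[OF assms(25,26) \<gamma> \<eta>]
    proof eventually_elim
      case (elim n)
      then have n: "n \<ge> 1" "n0 \<le> n" by auto
      have "4 \<le> 4 * \<gamma> * n"
        using n0 n(2) \<gamma> by (simp add: field_simps) (meson mult_left_mono of_nat_mono order_trans less_imp_le)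
      also have "\<dots> \<le> exp (4 * \<gamma> * n)" using exp_ge_add_one_self[of "4 * \<gamma> * n"] by linarith
      also have "4 * \<gamma> * n = n * t\<^sup>2 / (8 * c\<^sup>2)" by (simp add: \<gamma>_def)
      finally have large: "4 \<le> exp (n * t\<^sup>2 / (8 * c\<^sup>2))" .
      have fin: "finite \<P>'" if "\<P>' \<in> \<F> n" for \<P>' using assms(23) n(1) that by blast
      have "\<exists>G\<in>sets (PiM {1..n} (\<lambda>_. P)). measure (PiM {1..n} (\<lambda>_. P)) G
          \<ge> 1 - 2 * (growth_number n (\<F> n) * 4 ^ the_enat (max_cells (\<F> n)))\<^sup>2 * exp (- real n * t\<^sup>2 / (32 * c\<^sup>2)) \<and>
          (\<forall>d\<in>G. cell_dev P n d (gen_partition (\<C> n d)) w < t)"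
        by (rule cell_dev_tail[OF P sets_P _ ddc[OF n(1)] fin _ _ P_meas[OF w] _ c t large])
          (use n elim wc space_P assms(24) in auto)
      moreover have "- real n * t\<^sup>2 / (32 * c\<^sup>2) = - \<gamma> * n" by (simp add: \<gamma>_def)
      ultimately obtain G where G: "G \<in> sets (PiM {1..n} (\<lambda>_. P))" "measure (PiM {1..n} (\<lambda>_. P)) G
          \<ge> 1 - 2 * (growth_number n (\<F> n) * 4 ^ the_enat (max_cells (\<F> n)))\<^sup>2 * exp (- \<gamma> * n)"
          "\<forall>d\<in>G. cell_dev P n d (gen_partition (\<C> n d)) w < t" by auto
      then show ?case using elim(2) by (intro bexI[of _ G]) auto
    qed
  qed (rule D'_meas, rule D'_law)
  have likely_dev: "\<exists>K\<ge>0. likely M \<eta> (\<lambda>n \<omega>. ?dev w K n \<omega>)"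
    if w[measurable]: "w \<in> borel_measurable borel" and wc: "\<forall>v\<in>S. \<bar>w v\<bar> \<le> c"
      and \<eta>: "\<eta> > 0" for w c \<eta>
  proof -
    have "donsker_sets P \<B>" using assms(27) by (simp add: P_def)
    then obtain K where K: "\<forall>\<^sub>F n in sequentially. \<exists>G\<in>sets (PiM {1..n} (\<lambda>_. P)).
      measure (PiM {1..n} (\<lambda>_. P)) G \<ge> 1 - \<eta> \<and>
      (\<forall>d\<in>G. \<forall>B\<in>\<B>. \<bar>(\<Sum>i=1..n. w (d i) * indicator B (d i)) - n * (\<integral>x. w x * indicator B x \<partial>P)\<bar> \<le> K * sqrt n)"
      using donsker_weighted_deviation[OF P _ \<eta> P_meas[OF w], of \<B> c] wc space_P by auto
    have lk: "likely M \<eta> (\<lambda>n \<omega>. ?dev w K n \<omega>)"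
      by (rule likely_sample[where N = "\<lambda>n. PiM {1..n} (\<lambda>_. P)", OF D'_meas D'_law K])
    have max: "K * sqrt n \<le> max K 0 * sqrt n" for n :: nat by (intro mult_right_mono) auto
    have "likely M \<eta> (\<lambda>n \<omega>. ?dev w (max K 0) n \<omega>)"
    proof (rule likely_mono[OF lk order_refl always_eventually], intro allI ballI impI)
      fix n \<omega> B
      assume "?dev w K n \<omega>" and "B \<in> \<B>"
      then have "\<bar>(\<Sum>i=1..n. w (D' n \<omega> i) * indicator B (D' n \<omega> i)) - n * (\<integral>v. w v * indicator B v \<partial>P)\<bar> \<le> K * sqrt n"
        by (rule bspec)
      also note max
      finally show "\<bar>(\<Sum>i=1..n. w (D' n \<omega> i) * indicator B (D' n \<omega> i)) - n * (\<integral>v. w v * indicator B v \<partial>P)\<bar> \<le> max K 0 * sqrt n" .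
    qed
    then show ?thesis by (intro exI[of _ "max K 0"]) auto
  qed
  \<comment> \<open>On observations in \<open>S\<close> the trace of the cylinder is decided by
    \<open>r\<close> alone. That \<open>r\<close> is Borel follows from the section at y = 0, which
    belongs to [-L, L].\<close>
  have \<B>_cyl: "r \<in> sets borel" "(\<Sum>i=1..n. w (d i) * indicator ((r \<times> UNIV) \<inter> S) (d i)) = (\<Sum>i=1..n. w (d i) * indicator r (fst (d i)))"
    "(\<integral>v. w v * indicator ((r \<times> UNIV) \<inter> S) v \<partial>P) = (\<integral>v. w v * indicator r (fst v) \<partial>P)"
    if B: "(r \<times> UNIV) \<inter> S \<in> \<B>" and d: "d \<in> data_space n S" for r d n and w :: "(real ^ 'd) \<times> real \<Rightarrow> real"
  proof -
    have "(r \<times> UNIV) \<inter> S \<in> sets P" using assms(27) B by (auto simp: donsker_sets_def P_def)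
    then have [measurable]: "(r \<times> UNIV) \<inter> S \<in> sets borel"
      using S_borel by (auto simp: sets_P sets_restrict_space)
    have [measurable]: "(\<lambda>x. (x, 0 :: real)) \<in> borel_measurable (borel :: (real ^ 'd) measure)"
      by (intro borel_measurable_continuous_onI continuous_intros)
    have "(\<lambda>x. (x, 0 :: real)) -` ((r \<times> UNIV) \<inter> S) \<inter> space borel \<in> sets borel"
      by (rule measurable_sets) measurable
    also have "(\<lambda>x. (x, 0 :: real)) -` ((r \<times> UNIV) \<inter> S) \<inter> space borel = r"
      using L by (auto simp: S_def)
    finally show "r \<in> sets borel" .
    have "d i \<in> S" if "i \<in> {1..n}" for i using d that by (auto simp: data_space_def)
    then show "(\<Sum>i=1..n. w (d i) * indicator ((r \<times> UNIV) \<inter> S) (d i)) = (\<Sum>i=1..n. w (d i) * indicator r (fst (d i)))"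
      by (intro sum.cong refl) (auto simp: indicator_def mem_Times_iff)
    show "(\<integral>v. w v * indicator ((r \<times> UNIV) \<inter> S) v \<partial>P) = (\<integral>v. w v * indicator r (fst v) \<partial>P)"
      by (intro Bochner_Integration.integral_cong refl) (auto simp: indicator_def mem_Times_iff space_P)
  qed
  obtain \<beta> \<epsilon> :: "nat \<Rightarrow> 'w \<Rightarrow> real" where
      signif: "AE \<omega> in M. \<forall>n\<ge>1. \<C> n (D n \<omega>) =
            significant_sets n (D n \<omega>) (s2 n (D n \<omega>)) (\<beta> n \<omega>) (\<C> n (D n \<omega>)) \<union>
            insignificant_sets n (D n \<omega>) (s2 n (D n \<omega>)) (\<beta> n \<omega>) (\<epsilon> n \<omega>) (\<C> n (D n \<omega>))"
    and ratio_s: "little_oP M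
          (\<lambda>n \<omega>. redundancy_ratio
             (significant_sets n (D n \<omega>) (s2 n (D n \<omega>)) (\<beta> n \<omega>) (\<C> n (D n \<omega>))))
          (\<lambda>n \<omega>. redundancy_bound \<alpha> n (\<beta> n \<omega>))"
    and ratio_i: "little_oP M
          (\<lambda>n \<omega>. redundancy_ratio
             (insignificant_sets n (D n \<omega>) (s2 n (D n \<omega>)) (\<beta> n \<omega>) (\<epsilon> n \<omega>) (\<C> n (D n \<omega>))))
          (\<lambda>n \<omega>. redundancy_bound \<alpha> n (\<epsilon> n \<omega>))"
    using suitable unfolding alpha_suitable_def by (elim conjE exE)
  let ?sig = "\<lambda>n \<omega>. significant_sets n (D n \<omega>) (s2 n (D n \<omega>)) (\<beta> n \<omega>) (\<C> n (D n \<omega>))"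
  let ?ins = "\<lambda>n \<omega>. insignificant_sets n (D n \<omega>) (s2 n (D n \<omega>)) (\<beta> n \<omega>) (\<epsilon> n \<omega>) (\<C> n (D n \<omega>))"
  let ?base = "\<lambda>n \<omega>. D n \<omega> = D' n \<omega> \<and>
    (\<forall>r\<in>\<C> n (D n \<omega>). emp_prob n (D n \<omega>) r > real n powr (-\<alpha>)) \<and>
    \<C> n (D n \<omega>) = ?sig n \<omega> \<union> ?ins n \<omega>"
  have cover: "AE \<omega> in M. \<forall>n\<ge>1. \<forall>r\<in>\<C> n (D n \<omega>). emp_prob n (D n \<omega>) r > real n powr (-\<alpha>)"
    using suitable unfolding alpha_suitable_def by (elim conjE)

  \<comment> \<open>Choice of constants and exceptional events\<close>
  show ?thesis
  proof (rule little_oP_if_likely[OF M])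
    fix e \<eta>0 :: real assume e: "e > 0" and \<eta>0: "\<eta>0 > 0"
    \<comment> \<open>Eleven events with failure probability \<open>\<eta>\<close>: four for the
      cells, three for the noise over the Donsker class, one for the uncovered mass, one for the
      variance estimator and two for the redundancy ratios; the almost sure conditions cost
      nothing.\<close>
    define \<eta> where "\<eta> = \<eta>0 / 11"
    have \<eta>: "\<eta> > 0" using \<eta>0 by (simp add: \<eta>_def)
    \<comment> \<open>The final bound contains the cell deviations of 1, g, g^2 and the noise with
      factors L^2, 2 L, 1 and 4 L, whose sum is L^2 + 6 L + 1. Together they get a quarter of
      \<open>e\<close>, like the redundancy term and the uncovered mass.\<close>
    define t where "t = e / (4 * (L\<^sup>2 + 6 * L + 1))"
    have t_den: "L\<^sup>2 + 6 * L + 1 > 0" using L by (simp add: add_pos_pos)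
    have t: "t > 0" using e t_den by (simp add: t_def)
    have t_sum: "(L\<^sup>2 + 6 * L + 1) * t = e / 4"
    proof -
      have "q * (e / (4 * q)) = e / 4" if "q > 0" for q using that by simp
      from this[OF t_den] show ?thesis by (simp only: t_def)
    qed
    have sq_bd: "\<forall>v\<in>S. \<bar>(z v)\<^sup>2 - \<sigma>\<^sup>2\<bar> \<le> (2 * L)\<^sup>2 + \<sigma>\<^sup>2"
    proof
      fix v assume "v \<in> S"
      have "(z v)\<^sup>2 \<le> (2 * L)\<^sup>2" using zL[OF \<open>v \<in> S\<close>] L by (intro abs_le_square_iff[THEN iffD1]) simp
      moreover have "(z v)\<^sup>2 \<ge> 0" "\<sigma>\<^sup>2 \<ge> 0" "(2 * L)\<^sup>2 \<ge> 0" by simp_all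
      ultimately show "\<bar>(z v)\<^sup>2 - \<sigma>\<^sup>2\<bar> \<le> (2 * L)\<^sup>2 + \<sigma>\<^sup>2" by linarith
    qed
    have gz_bd: "\<forall>v\<in>S. \<bar>g (fst v) * z v\<bar> \<le> L * (2 * L)"
      unfolding abs_mult using gL zL L by (intro ballI mult_mono) auto
    have z_bd: "\<forall>v\<in>S. \<bar>z v\<bar> \<le> 2 * L" using zL by blast
    have gz_meas: "(\<lambda>v. g (fst v) * z v) \<in> borel_measurable borel" by measurable
    have sq_meas: "(\<lambda>v. (z v)\<^sup>2 - \<sigma>\<^sup>2) \<in> borel_measurable borel" by measurable
    obtain Ka where Ka: "Ka \<ge> 0" and devs_a: "likely M \<eta> (\<lambda>n \<omega>. ?dev z Ka n \<omega>)"
      using likely_dev[OF z z_bd \<eta>] by blast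
    obtain Kb where Kb: "Kb \<ge> 0" and devs_b: "likely M \<eta> (\<lambda>n \<omega>. ?dev (\<lambda>v. g (fst v) * z v) Kb n \<omega>)"
      using likely_dev[OF gz_meas gz_bd \<eta>] by blast
    obtain Kc where Kc: "Kc \<ge> 0" and devs_c: "likely M \<eta> (\<lambda>n \<omega>. ?dev (\<lambda>v. (z v)\<^sup>2 - \<sigma>\<^sup>2) Kc n \<omega>)"
      using likely_dev[OF sq_meas sq_bd \<eta>] by blast
    define K where "K = Ka + Kb + Kc"
    have K: "K \<ge> 0" "Ka \<le> K" "Kb \<le> K" "Kc \<le> K" using Ka Kb Kc by (auto simp: K_def)
    obtain K1 where K1: "likely M \<eta> (\<lambda>n \<omega>. \<bar>x_marginal Q (- \<Union>(\<C> n (D n \<omega>)))\<bar> \<le> K1 * real n powr (\<alpha> - 1/2))"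
      by (rule likely_big_OP[OF M assms(22) \<eta>])
    obtain K2' where K2': "likely M \<eta> (\<lambda>n \<omega>. \<bar>\<bar>s2 n (D n \<omega>) - \<sigma>\<^sup>2\<bar>\<bar> \<le> K2' * real n powr (\<alpha> - 1/2))"
      by (rule likely_big_OP[OF M assms(29) \<eta>])
    define K2 where "K2 = max K2' 0"
    have K2: "K2 \<ge> 0" by (simp add: K2_def)
    define A0 where "A0 = 4 * L\<^sup>2 + 1 + 2 * (K2 + (2 * L + 3) * K)"
    have A0: "A0 > 0"
    proof -
      have "0 \<le> 2 * (K2 + (2 * L + 3) * K)" using K K2 L by simp
      then show ?thesis unfolding A0_def by (intro add_pos_nonneg add_nonneg_pos) auto
    qed
    \<comment> \<open>\<open>\<delta>\<close> may depend on \<open>K\<close> and \<open>K2\<close>: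
      these were fixed through \<open>\<eta>\<close> before, and the ratio condition holds for every
      \<open>\<delta>\<close>.\<close>
    define \<delta> where "\<delta> = e / (4 * A0)"
    have \<delta>: "\<delta> > 0" using e A0 by (simp add: \<delta>_def)
    have \<delta>A0: "\<delta> * A0 = e / 4" using A0 by (simp add: \<delta>_def)
    have powr_small: "\<forall>\<^sub>F n in sequentially. L\<^sup>2 * (K1 * real n powr (\<alpha> - 1/2)) < e / 4"
    proof -
      have "(\<lambda>n. real n powr (\<alpha> - 1/2)) \<longlonglongrightarrow> 0"
        using assms(20) by (intro tendsto_neg_powr filterlim_real_sequentially) auto
      then have "(\<lambda>n. L\<^sup>2 * (K1 * real n powr (\<alpha> - 1/2))) \<longlonglongrightarrow> L\<^sup>2 * (K1 * 0)"
        by (intro tendsto_intros)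
      then show ?thesis using e by (intro order_tendstoD(2)[where y = 0]) auto
    qed
    have base: "likely M 0 (\<lambda>n \<omega>. ?base n \<omega>)"
    proof (rule likely_AE[OF M])
      show "AE \<omega> in M. \<forall>n\<ge>1. ?base n \<omega>"
        using D'_AE cover signif
      proof eventually_elim
        case (elim \<omega>)
        note elim' = elim[THEN spec, THEN mp]
        show ?case by (intro allI impI conjI; rule elim'; assumption)
      qed
    qed
    have cells1: "likely M \<eta> (\<lambda>n \<omega>. ?cell (\<lambda>_. 1) n \<omega> < t)"
      by (rule likely_cells[of _ 1]) (use t \<eta> in auto)
    have cells2: "likely M \<eta> (\<lambda>n \<omega>. ?cell (\<lambda>v. g (fst v)) n \<omega> < t)"
      by (rule likely_cells[of _ L]) (use gL L t \<eta> in auto)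
    have cells3: "likely M \<eta> (\<lambda>n \<omega>. ?cell (\<lambda>v. (g (fst v))\<^sup>2) n \<omega> < t)"
      by (rule likely_cells[of _ "L\<^sup>2"]) (use g2L L t \<eta> in auto)
    have cells4: "likely M \<eta> (\<lambda>n \<omega>. ?cell z n \<omega> < t)"
      by (rule likely_cells[OF z z_bd]) (use L t \<eta> in auto)
    note all = likely_conj[OF M base likely_conj[OF M cells1 likely_conj[OF M cells2 likely_conj[OF M cells3
      likely_conj[OF M cells4 likely_conj[OF M devs_a likely_conj[OF M devs_b likely_conj[OF M devs_c
      likely_conj[OF M K1 likely_conj[OF M K2' likely_conj[OF M likely_little_oP[OF M ratio_s \<delta> \<eta>]
      likely_little_oP[OF M ratio_i \<delta> \<eta>]]]]]]]]]]]]
    show "likely M \<eta>0 (\<lambda>n \<omega>. \<bar>excess_risk Q gstar (partition_estimator n (D n \<omega>) (\<C> n (D n \<omega>))) / 1\<bar> \<le> e)"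
    proof (rule likely_mono[OF all])
      show "\<forall>\<^sub>F n in sequentially. \<forall>\<omega>\<in>space M.
        ?base n \<omega> \<and>
        ?cell (\<lambda>_. 1) n \<omega> < t \<and>
        ?cell (\<lambda>v. g (fst v)) n \<omega> < t \<and>
        ?cell (\<lambda>v. (g (fst v))\<^sup>2) n \<omega> < t \<and>
        ?cell z n \<omega> < t \<and>
        ?dev z Ka n \<omega> \<and>
        ?dev (\<lambda>v. g (fst v) * z v) Kb n \<omega> \<and>
        ?dev (\<lambda>v. (z v)\<^sup>2 - \<sigma>\<^sup>2) Kc n \<omega> \<and>
        \<bar>x_marginal Q (- \<Union>(\<C> n (D n \<omega>)))\<bar> \<le> K1 * real n powr (\<alpha> - 1/2) \<and>
        \<bar>\<bar>s2 n (D n \<omega>) - \<sigma>\<^sup>2\<bar>\<bar> \<le> K2' * real n powr (\<alpha> - 1/2) \<and>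
        \<bar>redundancy_ratio (?sig n \<omega>) / redundancy_bound \<alpha> n (\<beta> n \<omega>)\<bar> \<le> \<delta> \<and>
        \<bar>redundancy_ratio (?ins n \<omega>) / redundancy_bound \<alpha> n (\<epsilon> n \<omega>)\<bar> \<le> \<delta> \<longrightarrow>
        \<bar>excess_risk Q gstar (partition_estimator n (D n \<omega>) (\<C> n (D n \<omega>))) / 1\<bar> \<le> e"
        using powr_small eventually_ge_at_top[of 1]
      proof (eventually_elim, intro ballI impI, elim conjE)
        fix n \<omega>
        assume small: "L\<^sup>2 * (K1 * real n powr (\<alpha> - 1/2)) < e / 4" and n: "1 \<le> n"
          and \<omega>: "\<omega> \<in> space M" and DD': "D n \<omega> = D' n \<omega>"
          and cov: "\<forall>r\<in>\<C> n (D n \<omega>). emp_prob n (D n \<omega>) r > real n powr (-\<alpha>)"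
          and split: "\<C> n (D n \<omega>) = ?sig n \<omega> \<union> ?ins n \<omega>"
          and cells: "?cell (\<lambda>_. 1) n \<omega> < t"
            "?cell (\<lambda>v. g (fst v)) n \<omega> < t"
            "?cell (\<lambda>v. (g (fst v))\<^sup>2) n \<omega> < t"
            "?cell z n \<omega> < t"
          and dev: "?dev z Ka n \<omega>"
            "?dev (\<lambda>v. g (fst v) * z v) Kb n \<omega>"
            "?dev (\<lambda>v. (z v)\<^sup>2 - \<sigma>\<^sup>2) Kc n \<omega>"
          and marg: "\<bar>x_marginal Q (- \<Union>(\<C> n (D n \<omega>)))\<bar> \<le> K1 * real n powr (\<alpha> - 1/2)"
          and s2: "\<bar>\<bar>s2 n (D n \<omega>) - \<sigma>\<^sup>2\<bar>\<bar> \<le> K2' * real n powr (\<alpha> - 1/2)"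
          and ratios: "\<bar>redundancy_ratio (?sig n \<omega>) / redundancy_bound \<alpha> n (\<beta> n \<omega>)\<bar> \<le> \<delta>"
            "\<bar>redundancy_ratio (?ins n \<omega>) / redundancy_bound \<alpha> n (\<epsilon> n \<omega>)\<bar> \<le> \<delta>"

        \<comment> \<open>Deterministic estimate on the good event\<close>
        define d where "d = D n \<omega>"
        define Cd where "Cd = \<C> n d"
        define \<P> where "\<P> = gen_partition Cd"
        define b where "b A = emp_cond_exp n d (\<lambda>y. y) A" for A
        have d: "d \<in> data_space n S" using D'_space[of n \<omega>] DD' by (simp add: d_def)
        have finC: "finite Cd" using ddc[OF n] d by (simp add: data_dependent_collection_def Cd_def)
        have fin: "finite \<P>" unfolding \<P>_def by (rule finite_gen_partition[OF finC])
        have disj: "disjoint \<P>" unfolding \<P>_def by (rule disjoint_gen_partition)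
        have meas: "A \<in> sets borel" if "A \<in> \<P>" for A
          using data_dependent_cells_measurable[OF ddc[OF n] d] that by (simp add: \<P>_def Cd_def)
        have y: "\<bar>snd (d i)\<bar> \<le> L" if "i \<in> {1..n}" for i
        proof -
          have "d i \<in> S" using d that by (auto simp: data_space_def)
          then show ?thesis by (auto simp: S_def)
        qed
        have bL: "\<bar>b A\<bar> \<le> L" for A unfolding b_def by (rule abs_emp_cond_exp_le) (use y L in auto)
        define h where "h x = (\<Sum>A\<in>\<P>. b A * indicator A x)" for x
        \<comment> \<open>A cell without sample points has \<open>b A\<close> = 0 / 0 = 0, so the
          sum may be taken over all cells.\<close>
        have est: "partition_estimator n d Cd = h"
        proof
          fix x
          have "b A = 0" if "\<not> emp_prob n d A > 0" for A
          proof -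
            have "emp_prob n d A \<ge> 0" unfolding emp_prob_def by (intro divide_nonneg_nonneg sum_nonneg) auto
            then have "emp_prob n d A = 0" using that by simp
            then have "(\<Sum>i=1..n. indicator A (fst (d i))) = (0::real)" using n by (simp add: emp_prob_def)
            then show ?thesis by (simp add: b_def emp_cond_exp_def)
          qed
          then show "partition_estimator n d Cd x = h x"
            unfolding partition_estimator_def h_def \<P>_def[symmetric] b_def[symmetric] using fin
            by (intro sum.mono_neutral_left) auto
        qed
        have h[measurable]: "h \<in> borel_measurable borel"
          unfolding h_def using meas by (intro borel_measurable_sum borel_measurable_times) auto
        have hL: "\<bar>h x\<bar> \<le> L" for x
        proof (cases "x \<in> \<Union>\<P>")
          case True
          then obtain A where "A \<in> \<P>" "x \<in> A" by blast
          then show ?thesis using sum_indicator_disjoint[OF fin disj, of A x b] bL by (simp add: h_def)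
        next
          case False
          then show ?thesis using L by (simp add: h_def sum_indicator_disjoint_zero)
        qed
        have ex: "excess_risk Q gstar (partition_estimator n (D n \<omega>) (\<C> n (D n \<omega>))) =
            (\<integral>v. (h (fst v) - g (fst v))\<^sup>2 \<partial>P)"
          using excess[OF h hL] est by (simp add: d_def Cd_def)
        have cyl: "(r \<times> UNIV) \<inter> S \<in> \<B>" if "r \<in> Cd" for r
          using assms(28) n d that by (auto simp: Cd_def)
        have DD: "D' n \<omega> = d" using DD' by (simp add: d_def)
        have ind_bd: "\<bar>indicator r x :: real\<bar> \<le> 1" for r :: "(real ^ 'd) set" and x by (simp add: indicator_def)
        \<comment> \<open>The weights have mean 0 on the cylinder over \<open>r\<close>, so the
          deviation is the sum itself.\<close>
        have dev_r: "\<bar>\<Sum>i=1..n. w (d i) * indicator r (fst (d i))\<bar> \<le> K * sqrt n"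
          if r: "r \<in> Cd" and wdev: "?dev w K' n \<omega>" and "K' \<le> K"
            and zero: "(\<integral>v. w v * indicator r (fst v) \<partial>P) = 0" for w K' r
        proof -
          have "\<bar>\<Sum>i=1..n. w (d i) * indicator r (fst (d i))\<bar> \<le> K' * sqrt n"
            using wdev[rule_format, OF cyl[OF r]] zero
            unfolding DD \<B>_cyl(2,3)[OF cyl[OF r] d, of w] by simp
          also have "\<dots> \<le> K * sqrt n" using \<open>K' \<le> K\<close> by (intro mult_right_mono) auto
          finally show ?thesis .
        qed
        have ind_meas: "(indicator r :: _ \<Rightarrow> real) \<in> borel_measurable borel" if "r \<in> Cd" for r
          using \<B>_cyl(1)[OF cyl[OF that] d] by measurable
        have z_dev: "\<bar>\<Sum>i=1..n. (snd (d i) - g (fst (d i))) * indicator r (fst (d i))\<bar> \<le> K * sqrt n" if r: "r \<in> Cd" for r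
          using dev_r[OF r dev(1) K(2) moment_z[OF ind_meas[OF r] ind_bd]] by (simp add: z_def)
        have z2_dev: "\<bar>\<Sum>i=1..n. ((snd (d i) - g (fst (d i)))\<^sup>2 - \<sigma>\<^sup>2) * indicator r (fst (d i))\<bar> \<le> K * sqrt n" if r: "r \<in> Cd" for r
          using dev_r[OF r dev(3) K(4) moment_z2[OF ind_meas[OF r] ind_bd]] by (simp add: z_def)
        have gz_dev: "\<bar>\<Sum>i=1..n. g (fst (d i)) * (snd (d i) - g (fst (d i))) * indicator r (fst (d i))\<bar> \<le> K * sqrt n" if r: "r \<in> Cd" for r
        proof -
          have gr_meas: "(\<lambda>x. g x * indicator r x) \<in> borel_measurable borel"
            by (intro borel_measurable_times g ind_meas[OF r])
          have "\<bar>g x * indicator r x\<bar> \<le> L" for x using gL[of x] L by (simp add: indicator_def)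
          from moment_z[OF gr_meas this]
          have "(\<integral>v. (g (fst v) * z v) * indicator r (fst v) \<partial>P) = 0" by (simp add: mult_ac)
          from dev_r[OF r dev(2) K(3) this] show ?thesis by (simp add: z_def)
        qed
        have "K2' * real n powr (\<alpha> - 1/2) \<le> K2 * real n powr (\<alpha> - 1/2)"
          by (intro mult_right_mono) (auto simp: K2_def)
        then have s2': "\<bar>s2 n d - \<sigma>\<^sup>2\<bar> \<le> K2 * real n powr (\<alpha> - 1/2)" using s2 by (simp add: d_def)
        \<comment> \<open>Likewise \<open>z\<close> has integral 0 over each cell, so its sum there
          is n times the deviation.\<close>
        have cells_z: "(\<Sum>A\<in>\<P>. \<bar>\<Sum>i=1..n. (snd (d i) - g (fst (d i))) * indicator A (fst (d i))\<bar>) = n * cell_dev P n d \<P> z"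
          unfolding cell_dev_def sum_distrib_left
        proof (rule sum.cong[OF refl])
          fix A assume "A \<in> \<P>"
          note meas[OF this, measurable]
          have "(\<integral>v. z v * indicator A (fst v) \<partial>P) = 0" by (rule moment_z[OF _ ind_bd]) measurable
          then show "\<bar>\<Sum>i=1..n. (snd (d i) - g (fst (d i))) * indicator A (fst (d i))\<bar> =
              n * \<bar>emp_dev P n d (\<lambda>v. z v * indicator A (fst v))\<bar>"
            using n by (simp add: emp_dev_def z_def abs_divide)
        qed
        have L0: "L \<ge> 0" and \<delta>0: "\<delta> \<ge> 0" using L \<delta> by simp_all
        have cov': "emp_prob n d r > real n powr (-\<alpha>)" if "r \<in> Cd" for r
          using cov that by (simp add: d_def Cd_def)
        have split': "Cd = significant_sets n d (s2 n d) (\<beta> n \<omega>) Cd \<union> insignificant_sets n d (s2 n d) (\<beta> n \<omega>) (\<epsilon> n \<omega>) Cd"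
          using split unfolding d_def Cd_def .
        have ratios': "\<bar>redundancy_ratio (significant_sets n d (s2 n d) (\<beta> n \<omega>) Cd) / redundancy_bound \<alpha> n (\<beta> n \<omega>)\<bar> \<le> \<delta>"
          "\<bar>redundancy_ratio (insignificant_sets n d (s2 n d) (\<beta> n \<omega>) (\<epsilon> n \<omega>) Cd) / redundancy_bound \<alpha> n (\<epsilon> n \<omega>)\<bar> \<le> \<delta>"
          using ratios unfolding d_def Cd_def .
        have "(\<Sum>A\<in>\<P>. \<Sum>i=1..n. (b A - g (fst (d i)))\<^sup>2 * indicator A (fst (d i)))
            \<le> n * (\<delta> * A0) + 4 * L * (n * cell_dev P n d \<P> z)"
          unfolding cells_z[symmetric] unfolding A0_def b_def \<P>_def
          by (rule suitable_cells_bound[where d = d and g = g and n = n and \<C> = Cd and ?s2.0 = "s2 n d" and v = "\<sigma>\<^sup>2"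
              and L = L and K = K and ?K2.0 = K2 and \<alpha> = \<alpha> and \<beta> = "\<beta> n \<omega>" and \<epsilon> = "\<epsilon> n \<omega>" and \<delta> = \<delta>])
            (assumption | rule n finC L0 y cov' split' z_dev gz_dev z2_dev s2' ratios' K(1) K2 \<delta>0)+
        also have "\<dots> = n * (\<delta> * A0 + 4 * L * cell_dev P n d \<P> z)" by (simp add: algebra_simps)
        finally have emp: "(\<Sum>A\<in>\<P>. \<Sum>i=1..n. (b A - g (fst (d i)))\<^sup>2 * indicator A (fst (d i))) / n
            \<le> \<delta> * A0 + 4 * L * cell_dev P n d \<P> z"
          using n by (simp add: field_simps)
        \<comment> \<open>The cells cover exactly the union of the collection, so this mass is at
          most the marginal whose rate is assumed.\<close>
        have out: "measure P {v \<in> space P. fst v \<notin> \<Union>\<P>} \<le> K1 * real n powr (\<alpha> - 1/2)"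
        proof -
          have [measurable]: "\<Union>\<P> \<in> sets borel" using fin meas by (intro sets.finite_Union) auto
          have cyl_meas: "(- \<Union>\<P>) \<times> UNIV \<in> sets Q"
          proof -
            have "fst -` (- \<Union>\<P>) \<inter> space (borel :: ((real ^ 'd) \<times> real) measure) \<in> sets borel"
              by (rule measurable_sets[of fst borel borel]) measurable
            moreover have "fst -` (- \<Union>\<P>) \<inter> space (borel :: ((real ^ 'd) \<times> real) measure) = (- \<Union>\<P>) \<times> UNIV"
              by auto
            ultimately show ?thesis by (simp add: sets_Q)
          qed
          have "measure P {v \<in> space P. fst v \<notin> \<Union>\<P>} = measure Q {v \<in> space P. fst v \<notin> \<Union>\<P>}"
            unfolding P_def using S_borel by (intro measure_restrict_space) (auto simp: sets_Q space_Q space_restrict_space)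
          also have "\<dots> \<le> measure Q ((- \<Union>\<P>) \<times> UNIV)"
            by (rule Q.finite_measure_mono[OF _ cyl_meas]) auto
          also have "\<dots> = x_marginal Q (- \<Union>(\<C> n (D n \<omega>)))"
            by (simp add: x_marginal_def \<P>_def Union_gen_partition Cd_def d_def)
          finally show ?thesis using marg by linarith
        qed
        have cds: "cell_dev P n d \<P> (\<lambda>_. 1) < t" "cell_dev P n d \<P> (\<lambda>v. g (fst v)) < t"
          "cell_dev P n d \<P> (\<lambda>v. (g (fst v))\<^sup>2) < t" "cell_dev P n d \<P> z < t"
          using cells unfolding DD \<P>_def Cd_def by simp_all
        have "(\<integral>v. (h (fst v) - g (fst v))\<^sup>2 \<partial>P) \<le> L\<^sup>2 * measure P {v \<in> space P. fst v \<notin> \<Union>\<P>}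
          + (\<Sum>A\<in>\<P>. \<Sum>i=1..n. (b A - g (fst (d i)))\<^sup>2 * indicator A (fst (d i))) / n
          + L\<^sup>2 * cell_dev P n d \<P> (\<lambda>_. 1) + 2 * L * cell_dev P n d \<P> (\<lambda>z. g (fst z))
          + cell_dev P n d \<P> (\<lambda>z. (g (fst z))\<^sup>2)"
          unfolding h_def by (rule partition_risk_le[OF P fst_P g gL fin disj meas bL])
        also have "\<dots> \<le> L\<^sup>2 * (K1 * real n powr (\<alpha> - 1/2)) + (\<delta> * A0 + 4 * L * t) + L\<^sup>2 * t + 2 * L * t + t"
        proof (intro add_mono mult_left_mono out)
          have "4 * L * cell_dev P n d \<P> z \<le> 4 * L * t" using cds L by (intro mult_left_mono) auto
          with emp show "(\<Sum>A\<in>\<P>. \<Sum>i=1..n. (b A - g (fst (d i)))\<^sup>2 * indicator A (fst (d i))) / n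
            \<le> \<delta> * A0 + 4 * L * t" by linarith
        qed (use cds L in auto)
        also have "\<dots> = L\<^sup>2 * (K1 * real n powr (\<alpha> - 1/2)) + \<delta> * A0 + (L\<^sup>2 + 6 * L + 1) * t"
          by (simp add: algebra_simps)
        also have "\<dots> \<le> e" using small e by (simp add: \<delta>A0 t_sum)
        finally have "(\<integral>v. (h (fst v) - g (fst v))\<^sup>2 \<partial>P) \<le> e" .
        moreover have "(\<integral>v. (h (fst v) - g (fst v))\<^sup>2 \<partial>P) \<ge> 0" by (rule Bochner_Integration.integral_nonneg) simp
        ultimately show "\<bar>excess_risk Q gstar (partition_estimator n (D n \<omega>) (\<C> n (D n \<omega>))) / 1\<bar> \<le> e"
          by (simp add: ex)
      qed
    qed (simp add: \<eta>_def)
  qed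
qed

end
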